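(* Let $\varphi:\,]a,+\infty[\,\to\mathbb{R}$ be a smooth function with $\dot\varphi>0$ and $\ddot\varphi\ge 0$ on $]a,+\infty[$, such that for all sufficiently large $u$ $$\dot{\varphi}(u)=\alpha u+\beta+\sum_{n=1}^{\infty}\frac{a_n}{u^n},\qquad a_n\in\mathbb{R},$$ where either $\alpha>0$ and the first non-vanishing $a_k$ (if any) is positive, or $\alpha=0$, $\beta>0$ and the first non-vanishing $a_k$ (if any) is negative. Let $\Sigma$ be a complete properly embedded (connected) $[\varphi,\vec e_3]$-minimal surface in $\mathbb{R}^3$ (contained in $\mathbb{R}^2\times]a,+\infty[$) with a single end that is smoothly asymptotic to a $[\varphi,\vec e_3]$-minimal bowl. Then $\Sigma$ is a $[\varphi,\vec e_3]$-minimal bowl.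
   Context: A dot denotes the derivative of $\varphi$ with respect to the height variable. A surface $\Sigma\subset\mathbb{R}^2\times]a,+\infty[$ is $[\varphi,\vec e_3]$-minimal if its mean curvature vector (trace of the vector-valued second fundamental form) satisfies $\mathbf{H}=\dot\varphi\,\vec e_3^{\,\perp}$, where $\dot\varphi$ is evaluated at the height of the point, $\vec e_3=(0,0,1)$, and $\perp$ is the projection onto the normal bundle. A $[\varphi,\vec e_3]$-minimal bowl is the surface of revolution about the vertical axis ($\vec e_3$-axis) that is the graph of $u=u(r)$, $r=\sqrt{x^2+y^2}$, where $u$ is the maximal $C^2$ solution of $u''=(1+u'^2)(\dot\varphi(u)-u'/r)$, $u(0)=z_0\in\,]a,+\infty[$, $u'(0)=0$. A $[\varphi,\vec e_3]$-minimal end is said to be smoothly asymptotic to a rotational-type example (in particular to a bowl) if, outside a ball, it is the vertical graph of a function $u_\Sigma$ of $x\in\mathbb{R}^2$ such that, as $|x|\to\infty$: if $\alpha>0$, $$\varphi(u_\Sigma(x))=C\,e^{\alpha|x|^2}+O(|x|^2)\quad\text{for some constant } C>0;$$ and if $\alpha=0$ (and $\beta>0$), up to an additive constant, $$\mathcal{G}(u_\Sigma(x))=\frac{|x|^2}{2}-\frac{1}{\beta^2}\log|x|+O(|x|^{-2}),\qquad \mathcal{G}(u)=\int_{u_0}^{u}\frac{d\xi}{\dot\varphi(\xi)} .$$ *)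

theory Defs
  imports "HOL-Analysis.Analysis" "HOL-Library.Landau_Symbols"
begin

text \<open>Both notions below are meant for open sets only.\<close>

fun Ck_on :: "nat \<Rightarrow> 'a::euclidean_space set \<Rightarrow> ('a \<Rightarrow> 'b::real_normed_vector) \<Rightarrow> bool" where
  "Ck_on 0 U f \<longleftrightarrow> continuous_on U f"
| "Ck_on (Suc k) U f \<longleftrightarrow>
     (\<forall>x\<in>U. f differentiable (at x)) \<and> (\<forall>v. Ck_on k U (\<lambda>x. frechet_derivative f (at x) v))"

definition smooth_on :: "'a::euclidean_space set \<Rightarrow> ('a \<Rightarrow> 'b::real_normed_vector) \<Rightarrow> bool" where
  "smooth_on U f \<longleftrightarrow> (\<forall>k. Ck_on k U f)"

definition pd :: "'n \<Rightarrow> (real^'n::finite \<Rightarrow> 'b::real_normed_vector) \<Rightarrow> real^'n \<Rightarrow> 'b" where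
  "pd i f q = frechet_derivative f (at q) (axis i 1)"

definition local_parametrization :: "(real^3) set \<Rightarrow> (real^2) set \<Rightarrow> (real^2 \<Rightarrow> real^3) \<Rightarrow> bool" where
  "local_parametrization S U X \<longleftrightarrow>
     open U \<and> smooth_on U X \<and> (\<forall>q\<in>U. inj (frechet_derivative X (at q))) \<and>
     openin (top_of_set S) (X ` U) \<and> (\<exists>Y. homeomorphism U (X ` U) X Y)"

definition embedded_surface :: "(real^3) set \<Rightarrow> bool" where
  "embedded_surface S \<longleftrightarrow> (\<forall>p\<in>S. \<exists>U X. local_parametrization S U X \<and> p \<in> X ` U)"

text \<open>The inclusion of an embedded surface into space is a proper map iff its image is closed.\<close>

definition properly_embedded_surface :: "(real^3) set \<Rightarrow> bool" where
  "properly_embedded_surface S \<longleftrightarrow> embedded_surface S \<and> closed S"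

definition curve_length :: "(real \<Rightarrow> real^3) \<Rightarrow> real" where
  "curve_length g = integral {0..1} (\<lambda>t. norm (vector_derivative g (at t)))"

text \<open>C1 curves that are not required to be regular suffice: a piecewise C1 curve can be
  reparametrized so that it stops at its corners. The library notion of piecewise C1 path would not
  do, as it allows derivatives that are not integrable near the break points.\<close>

definition intrinsic_dist :: "(real^3) set \<Rightarrow> real^3 \<Rightarrow> real^3 \<Rightarrow> real" where
  "intrinsic_dist S p q =
     Inf {curve_length g | g. g C1_differentiable_on {0..1} \<and> path_image g \<subseteq> S \<and> pathstart g = p \<and> pathfinish g = q}"

text \<open>Metric completeness for the Riemannian distance; for a connected surface this distance is
  an infimum over a nonempty set, hence meaningful.\<close>

definition complete_surface :: "(real^3) set \<Rightarrow> bool" where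
  "complete_surface S \<longleftrightarrow>
     (\<forall>s. (\<forall>n. s n \<in> S) \<and>
          (\<forall>e>0. \<exists>N::nat. \<forall>m\<ge>N. \<forall>n\<ge>N. intrinsic_dist S (s m) (s n) < e) \<longrightarrow>
          (\<exists>p\<in>S. (\<lambda>n. intrinsic_dist S (s n) p) \<longlonglongrightarrow> 0))"

definition unit_normal :: "(real^2 \<Rightarrow> real^3) \<Rightarrow> real^2 \<Rightarrow> real^3" where
  "unit_normal X q = sgn (cross3 (pd 1 X q) (pd 2 X q))"

definition normal_part :: "(real^2 \<Rightarrow> real^3) \<Rightarrow> real^2 \<Rightarrow> real^3 \<Rightarrow> real^3" where
  "normal_part X q w = (w \<bullet> unit_normal X q) *\<^sub>R unit_normal X q"

definition first_form :: "(real^2 \<Rightarrow> real^3) \<Rightarrow> real^2 \<Rightarrow> real^2^2" where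
  "first_form X q = (\<chi> i j. pd i X q \<bullet> pd j X q)"

text \<open>Vector-valued second fundamental form on the coordinate fields: the normal part of the flat
  covariant derivative of one coordinate field along the other.\<close>

definition second_form :: "(real^2 \<Rightarrow> real^3) \<Rightarrow> real^2 \<Rightarrow> 2 \<Rightarrow> 2 \<Rightarrow> real^3" where
  "second_form X q i j = normal_part X q (pd i (pd j X) q)"

definition mean_curvature_vector :: "(real^2 \<Rightarrow> real^3) \<Rightarrow> real^2 \<Rightarrow> real^3" where
  "mean_curvature_vector X q =
     (\<Sum>i\<in>UNIV. \<Sum>j\<in>UNIV. (matrix_inv (first_form X q) $ i $ j) *\<^sub>R second_form X q i j)"

text \<open>The equation does not depend on the parametrization near a given point.\<close>

definition phi_minimal :: "(real \<Rightarrow> real) \<Rightarrow> (real^3) set \<Rightarrow> bool" where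
  "phi_minimal \<phi> S \<longleftrightarrow>
     (\<forall>U X. local_parametrization S U X \<longrightarrow>
        (\<forall>q\<in>U. mean_curvature_vector X q = deriv \<phi> (X q $ 3) *\<^sub>R normal_part X q (axis 3 1)))"

definition hproj :: "real^3 \<Rightarrow> real^2" where
  "hproj p = vector [p $ 1, p $ 2]"

definition vertical_graph :: "(real^2) set \<Rightarrow> (real^2 \<Rightarrow> real) \<Rightarrow> (real^3) set" where
  "vertical_graph D u = {p. hproj p \<in> D \<and> p $ 3 = u (hproj p)}"

text \<open>One topological end, for a closed set: components of the complement of a compact part that
  are not relatively compact are exactly the unbounded ones.\<close>

definition single_end :: "(real^3) set \<Rightarrow> bool" where
  "single_end S \<longleftrightarrow>
     (\<forall>K. compact K \<and> K \<subseteq> S \<longrightarrow> (\<exists>!E. E \<in> components (S - K) \<and> \<not> bounded E))"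

definition G_fun :: "(real \<Rightarrow> real) \<Rightarrow> real \<Rightarrow> real \<Rightarrow> real" where
  "G_fun \<phi> u0 u = (LBINT \<xi>=u0..u. 1 / deriv \<phi> \<xi>)"

text \<open>Stated for a surface with a single end, so that the part of the surface outside a large ball
  represents the end.\<close>

definition smoothly_asymptotic_to_bowl ::
  "ereal \<Rightarrow> (real \<Rightarrow> real) \<Rightarrow> real \<Rightarrow> real \<Rightarrow> (real^3) set \<Rightarrow> bool" where
  "smoothly_asymptotic_to_bowl a \<phi> \<alpha> \<beta> S \<longleftrightarrow>
     (\<exists>R>0. \<exists>D u. S - ball 0 R = vertical_graph D u \<and>
        (\<forall>\<^sub>F x in at_infinity. x \<in> D) \<and>
        (\<alpha> > 0 \<longrightarrow>
          (\<exists>C>0. (\<lambda>x. \<phi> (u x) - C * exp (\<alpha> * (norm x)\<^sup>2)) \<in> O[at_infinity](\<lambda>x. (norm x)\<^sup>2))) \<and>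
        (\<alpha> = 0 \<longrightarrow>
          (\<exists>u0 c. a < ereal u0 \<and>
             (\<lambda>x. G_fun \<phi> u0 (u x) - ((norm x)\<^sup>2 / 2 - 1 / \<beta>\<^sup>2 * ln (norm x) + c))
               \<in> O[at_infinity](\<lambda>x. 1 / (norm x)\<^sup>2))))"

text \<open>A solution on $[0,R[$ with $0 < R \le \infty$; the profile has values in $]a,\infty[$ and is
  twice continuously differentiable up to $r=0$, where derivatives are one-sided.\<close>

definition bowl_profile ::
  "ereal \<Rightarrow> (real \<Rightarrow> real) \<Rightarrow> real \<Rightarrow> ereal \<Rightarrow> (real \<Rightarrow> real) \<Rightarrow> bool" where
  "bowl_profile a \<phi> z0 R u \<longleftrightarrow> 0 < R \<and>
     (let J = {r. 0 \<le> r \<and> ereal r < R} in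
      \<exists>u' u''. (\<forall>r\<in>J. a < ereal (u r) \<and>
          (u has_real_derivative u' r) (at r within J) \<and>
          (u' has_real_derivative u'' r) (at r within J)) \<and>
        continuous_on J u'' \<and> u 0 = z0 \<and> u' 0 = 0 \<and>
        (\<forall>r\<in>J. r > 0 \<longrightarrow> u'' r = (1 + (u' r)\<^sup>2) * (deriv \<phi> (u r) - u' r / r)))"

text \<open>It suffices to compare with solutions on half-open intervals, since a solution on $[0,R]$
  extends beyond $R$.\<close>

definition maximal_bowl_profile ::
  "ereal \<Rightarrow> (real \<Rightarrow> real) \<Rightarrow> real \<Rightarrow> ereal \<Rightarrow> (real \<Rightarrow> real) \<Rightarrow> bool" where
  "maximal_bowl_profile a \<phi> z0 R u \<longleftrightarrow> bowl_profile a \<phi> z0 R u \<and>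
     \<not> (\<exists>R' w. R < R' \<and> bowl_profile a \<phi> z0 R' w \<and> (\<forall>r. 0 \<le> r \<and> ereal r < R \<longrightarrow> w r = u r))"

definition is_bowl :: "ereal \<Rightarrow> (real \<Rightarrow> real) \<Rightarrow> (real^3) set \<Rightarrow> bool" where
  "is_bowl a \<phi> S \<longleftrightarrow>
     (\<exists>z0 R u. a < ereal z0 \<and> maximal_bowl_profile a \<phi> z0 R u \<and>
        S = vertical_graph {x. ereal (norm x) < R} (\<lambda>x. u (norm x)))"

end

theory Submission
  imports Defs
begin

text \<open>Any two points of the surface at equal distance from the axis have equal height. Indeed, let
  \<open>R\<close> be a rotation about the axis and suppose that \<open>P $ 3 > Q $ 3\<close> for some points of the surface with
  \<open>hproj Q = R (hproj P)\<close>. By the asymptotics this excess tends to \<open>0\<close> at infinity, and the surface is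
  compact over disks because it has a single end; so the height difference, penalized by the distance of
  \<open>R (hproj P)\<close> and \<open>hproj Q\<close>, has an interior maximum. There the tangent planes are not vertical, and
  comparing the two equations contradicts the monotonicity of \<open>deriv \<phi>\<close>. As \<open>deriv \<phi>\<close> may be constant
  between the two heights, a small multiple of \<open>exp (K * P $ 1)\<close> is added to make the comparison strict.

  Hence the projection to the plane is injective, and by invariance of domain it is onto: the surface is
  the graph of a radial function. Its meridian has no vertical tangent, so it is twice differentiable, and the
  mean curvature equation becomes the differential equation of the bowl.\<close>

section \<open>Parametrizations and the scalar mean curvature equation\<close>

text \<open>Away from its end the surface is only known to be embedded, so before symmetry is proved
  the height is no function on a planar domain, and the maximum principle for two graphs cannot be
  applied. Doubling the variables avoids this: \<open>P\<close> and \<open>Q\<close> move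
  independently on the surface, and at a maximum the gradient of the test function prescribes both
  tangent planes by normals with third component 1. Only the derivatives of two charts at single
  points then enter, through \<open>mean_curvature_scalar\<close>.

  The comparison ends in a bound for \<open>K\<close> by quantities fixed before \<open>K\<close>
  and \<open>\<delta>\<close>: the penalty \<open>\<kappa>\<close>, a slope bound \<open>N\<close>
  and an upper bound \<open>\<Phi>\<close> for \<open>deriv \<phi>\<close>. Choosing
  \<open>K\<close> beyond that bound is the contradiction.

  The asymptotic formulas control \<open>\<phi>\<close> or \<open>G_fun\<close> of the height, not
  the height itself. For \<alpha> > 0 convexity together with the growth of
  \<open>deriv \<phi>\<close> turns them into convergence of height differences; for \<alpha> = 0
  the bound \<open>deriv \<phi> \<le> \<beta>\<close> does.

  The differential equation is singular on the axis, so continuity of the second derivative of the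
  profile at 0 needs an argument of its own.\<close>

definition dX :: "(real^2 \<Rightarrow> 'b::real_normed_vector) \<Rightarrow> real^2 \<Rightarrow> real^2 \<Rightarrow> 'b" where
  "dX X q v = (v $ 1) *\<^sub>R pd 1 X q + (v $ 2) *\<^sub>R pd 2 X q"

text \<open>The direction \<open>w\<close> is frozen while the base point moves along
  \<open>v\<close>. The two orders are kept apart; mixed terms enter the curvature formulas below
  only through their sum.\<close>

definition ddX :: "(real^2 \<Rightarrow> 'b::real_normed_vector) \<Rightarrow> real^2 \<Rightarrow> real^2 \<Rightarrow> real^2 \<Rightarrow> 'b" where
  "ddX X q v w = dX (\<lambda>q. dX X q w) q v"

lemma smooth_on_differentiable: "smooth_on U f \<Longrightarrow> x \<in> U \<Longrightarrow> f differentiable (at x)"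
  unfolding smooth_on_def by (metis Ck_on.simps(2))

lemma smooth_on_frechet_derivative:
  "smooth_on U f \<Longrightarrow> smooth_on U (\<lambda>x. frechet_derivative f (at x) v)"
  unfolding smooth_on_def by (metis Ck_on.simps(2))

lemma smooth_on_continuous_on: "smooth_on U f \<Longrightarrow> continuous_on U f"
  unfolding smooth_on_def by (metis Ck_on.simps(1))

lemma smooth_on_pd: "smooth_on U f \<Longrightarrow> smooth_on U (pd i f)"
  unfolding pd_def [abs_def] by (rule smooth_on_frechet_derivative)

lemma vec2_decomp: "(v::real^2) = (v $ 1) *\<^sub>R axis 1 1 + (v $ 2) *\<^sub>R axis 2 1"
  by (simp add: vec_eq_iff forall_2 axis_def)

lemma frechet_derivative_eq_dX:
  fixes f :: "real^2 \<Rightarrow> 'b::real_normed_vector"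
  assumes "f differentiable (at q)"
  shows "frechet_derivative f (at q) = dX f q"
proof
  fix v
  interpret l: linear "frechet_derivative f (at q)"
    using assms by (rule linear_frechet_derivative)
  show "frechet_derivative f (at q) v = dX f q v"
    by (subst vec2_decomp) (simp add: l.add l.scaleR dX_def pd_def)
qed

lemma has_derivative_dX:
  fixes f :: "real^2 \<Rightarrow> 'b::real_normed_vector"
  shows "f differentiable (at q) \<Longrightarrow> (f has_derivative dX f q) (at q)"
  by (metis frechet_derivative_eq_dX frechet_derivative_works)

lemma dX_eqI: "(f has_derivative f') (at q) \<Longrightarrow> dX f q = f'"
  by (metis differentiableI frechet_derivative_at frechet_derivative_eq_dX)

lemma ddX_expand:
  assumes "smooth_on U X" "q \<in> U"
  shows "ddX X q v w = (w $ 1) *\<^sub>R dX (pd 1 X) q v + (w $ 2) *\<^sub>R dX (pd 2 X) q v"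
    and "((\<lambda>q. dX X q w) has_derivative (\<lambda>v. ddX X q v w)) (at q)"
proof -
  have "(pd 1 X has_derivative dX (pd 1 X) q) (at q)" "(pd 2 X has_derivative dX (pd 2 X) q) (at q)"
    using assms has_derivative_dX smooth_on_differentiable smooth_on_pd by blast+
  then have *: "((\<lambda>q. dX X q w) has_derivative
      (\<lambda>v. (w $ 1) *\<^sub>R dX (pd 1 X) q v + (w $ 2) *\<^sub>R dX (pd 2 X) q v)) (at q)"
    unfolding dX_def [of X] by (auto intro!: derivative_eq_intros)
  show **: "ddX X q v w = (w $ 1) *\<^sub>R dX (pd 1 X) q v + (w $ 2) *\<^sub>R dX (pd 2 X) q v" for v
    unfolding ddX_def using dX_eqI [OF *] by simp
  show "((\<lambda>q. dX X q w) has_derivative (\<lambda>v. ddX X q v w)) (at q)"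
    using * by (simp add: **)
qed

lemma chart_curve:
  assumes "smooth_on U X" "q + s *\<^sub>R v \<in> U"
  shows "((\<lambda>s. X (q + s *\<^sub>R v)) has_vector_derivative dX X (q + s *\<^sub>R v) v) (at s)"
    and "((\<lambda>s. dX X (q + s *\<^sub>R v) v) has_vector_derivative ddX X (q + s *\<^sub>R v) v v) (at s)"
proof -
  have l: "((\<lambda>s. q + s *\<^sub>R v) has_derivative (\<lambda>s. s *\<^sub>R v)) (at s)"
    by (auto intro!: derivative_eq_intros)
  have hom: "dX f q (r *\<^sub>R v) = r *\<^sub>R dX f q v" for f :: "real^2 \<Rightarrow> 'a" and q v r
    by (simp add: dX_def scaleR_add_right)
  have "(X has_derivative dX X (q + s *\<^sub>R v)) (at (q + s *\<^sub>R v))"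
    using assms has_derivative_dX smooth_on_differentiable by blast
  from has_derivative_compose [OF l this]
  show "((\<lambda>s. X (q + s *\<^sub>R v)) has_vector_derivative dX X (q + s *\<^sub>R v) v) (at s)"
    by (simp add: has_vector_derivative_def hom)
  have "((\<lambda>q. dX X q v) has_derivative (\<lambda>w. ddX X (q + s *\<^sub>R v) w v)) (at (q + s *\<^sub>R v))"
    using ddX_expand(2) [OF assms] .
  from has_derivative_compose [OF l this]
  show "((\<lambda>s. dX X (q + s *\<^sub>R v) v) has_vector_derivative ddX X (q + s *\<^sub>R v) v v) (at s)"
    by (simp add: has_vector_derivative_def ddX_def hom)
qed

lemma linear_dX: "linear (dX f q)"
  by (auto intro!: linearI simp: dX_def algebra_simps)

lemma local_parametrizationD:
  assumes "local_parametrization S U X"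
  shows "open U" "smooth_on U X" "continuous_on U X" "X ` U \<subseteq> S" "openin (top_of_set S) (X ` U)"
  using assms openin_imp_subset [where S = S and T = "X ` U"] smooth_on_continuous_on
  unfolding local_parametrization_def by blast+

lemma dX_injective:
  assumes "local_parametrization S U X" "q \<in> U" "dX X q v = 0"
  shows "v = 0"
proof -
  have "inj (frechet_derivative X (at q))" "X differentiable (at q)"
    using assms smooth_on_differentiable by (auto simp: local_parametrization_def)
  then show ?thesis
    using assms(3) linear_dX linear_injective_0 frechet_derivative_eq_dX by metis
qed

lemma chart_normal:
  assumes X: "local_parametrization S U X" and q: "q \<in> U"
  shows "cross3 (pd 1 X q) (pd 2 X q) \<noteq> 0" "cross3 (pd 1 X q) (pd 2 X q) \<bullet> dX X q v = 0"
proof -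
  let ?E = "pd 1 X q" and ?F = "pd 2 X q"
  show "cross3 ?E ?F \<noteq> 0"
  proof
    assume "cross3 ?E ?F = 0"
    then have "collinear {0, ?E, ?F}" by (simp add: cross_eq_0)
    then consider "?E = 0" | c where "?F = c *\<^sub>R ?E"
      unfolding collinear_lemma by (metis scale_zero_left)
    then show False
    proof cases
      case 1
      then have "dX X q (axis 1 1) = 0" by (simp add: dX_def axis_def)
      with dX_injective [OF X q] show False by (metis axis_eq_0_iff zero_neq_one)
    next
      case 2
      then have "dX X q (vector [c, -1]) = 0" by (simp add: dX_def)
      then have "vector [c, -1] = (0 :: real^2)" by (rule dX_injective [OF X q])
      then show False by (simp add: vec_eq_iff forall_2)
    qed
  qed
  show "cross3 ?E ?F \<bullet> dX X q v = 0"
    by (simp add: dX_def inner_add_right dot_cross_self)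
qed

lemma matrix_inv_2x2:
  fixes A :: "real^2^2"
  assumes sym: "A $ 1 $ 2 = A $ 2 $ 1" and d: "A $ 1 $ 1 * A $ 2 $ 2 - (A $ 2 $ 1)\<^sup>2 \<noteq> 0" (is "?d \<noteq> 0")
  shows "matrix_inv A $ 1 $ 1 = A $ 2 $ 2 / ?d" "matrix_inv A $ 1 $ 2 = - A $ 2 $ 1 / ?d"
    "matrix_inv A $ 2 $ 1 = - A $ 2 $ 1 / ?d" "matrix_inv A $ 2 $ 2 = A $ 1 $ 1 / ?d"
proof -
  define B :: "real^2^2" where "B = vector [vector [A $ 2 $ 2 / ?d, - A $ 2 $ 1 / ?d],
     vector [- A $ 2 $ 1 / ?d, A $ 1 $ 1 / ?d]]"
  have *: "x / ?d + y / ?d = 0" if "x + y = 0" for x y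
    using that by (simp flip: add_divide_distrib)
  have AB: "A ** B = mat 1"
    unfolding vec_eq_iff forall_2 matrix_matrix_mult_def sum_2 mat_def B_def
    using d by (auto intro!: * simp: sym power2_eq_square mult.commute simp flip: diff_divide_distrib)
  then have BA: "B ** A = mat 1"
    by (simp add: matrix_left_right_inverse)
  \<comment> \<open>\<open>matrix_inv\<close> is a choice among two-sided inverses, so its defining
    equations become available once some inverse has been exhibited; uniqueness then identifies it
    with \<open>B\<close>.\<close>
  have "\<exists>A'. A ** A' = mat 1 \<and> A' ** A = mat 1"
    using AB BA by blast
  then have "A ** matrix_inv A = mat 1 \<and> matrix_inv A ** A = mat 1"
    unfolding matrix_inv_def by (rule someI_ex)
  then have "matrix_inv A = B"
    by (metis AB matrix_mul_assoc matrix_mul_lid matrix_mul_rid)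
  then show "matrix_inv A $ 1 $ 1 = A $ 2 $ 2 / ?d" "matrix_inv A $ 1 $ 2 = - A $ 2 $ 1 / ?d"
    "matrix_inv A $ 2 $ 1 = - A $ 2 $ 1 / ?d" "matrix_inv A $ 2 $ 2 = A $ 1 $ 1 / ?d"
    by (simp_all add: B_def)
qed

text \<open>Since \<open>n\<close> is parallel to \<open>cross3 E F\<close>, projecting
  \<open>x\<close> to the normal line loses nothing against \<open>n\<close>. This allows the vector
  equation to be tested against a normal of any length and sign.\<close>

lemma inner_unit_normal:
  assumes m: "cross3 E F \<noteq> 0" and n: "n \<bullet> E = 0" "n \<bullet> F = 0"
  shows "(x \<bullet> sgn (cross3 E F)) * (sgn (cross3 E F) \<bullet> n) = x \<bullet> n"
proof -
  let ?m = "cross3 E F"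
  have "cross3 ?m n = 0"
    using n by (simp add: cross3_simps forall_3 vec_eq_iff inner_vec_def sum_3) algebra
  then have "cross3 ?m x \<bullet> cross3 ?m n = 0" by simp
  then have "(?m \<bullet> ?m) * (x \<bullet> n) = (x \<bullet> ?m) * (?m \<bullet> n)"
    by (simp add: dot_cross inner_commute mult.commute)
  moreover have "?m \<bullet> ?m = (norm ?m)\<^sup>2" by (simp add: power2_norm_eq_inner)
  moreover have "norm ?m \<noteq> 0" using m by simp
  ultimately show ?thesis
    by (simp add: sgn_div_norm power2_eq_square field_simps)
qed

text \<open>The trace over the inverse metric, cleared of denominators and written in two arbitrary
  directions instead of the coordinate basis. Later proofs choose \<open>v\<close>, \<open>w\<close>
  and \<open>n\<close> adapted to the geometry and never reparametrize.\<close>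

lemma mean_curvature_scalar:
  assumes min: "phi_minimal \<phi> S" and X: "local_parametrization S U X" and q: "q \<in> U"
    and n: "n \<bullet> pd 1 X q = 0" "n \<bullet> pd 2 X q = 0"
  shows "(dX X q w \<bullet> dX X q w) * (n \<bullet> ddX X q v v)
      - (dX X q v \<bullet> dX X q w) * (n \<bullet> ddX X q v w + n \<bullet> ddX X q w v)
      + (dX X q v \<bullet> dX X q v) * (n \<bullet> ddX X q w w)
    = ((dX X q v \<bullet> dX X q v) * (dX X q w \<bullet> dX X q w) - (dX X q v \<bullet> dX X q w)\<^sup>2)
        * deriv \<phi> (X q $ 3) * n $ 3"
proof -
  have sm: "smooth_on U X" by (rule local_parametrizationD(2) [OF X])
  let ?E = "pd 1 X q" and ?F = "pd 2 X q"
  let ?g11 = "?E \<bullet> ?E" and ?g12 = "?E \<bullet> ?F" and ?g22 = "?F \<bullet> ?F"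
  let ?D = "?g11 * ?g22 - ?g12\<^sup>2"
  have m: "cross3 ?E ?F \<noteq> 0"
    by (rule chart_normal(1) [OF X q])
  have D: "?D \<noteq> 0"
  proof -
    have "?D = cross3 ?E ?F \<bullet> cross3 ?E ?F"
      by (simp add: dot_cross inner_commute power2_eq_square)
    then show ?thesis using m by simp
  qed
  let ?G = "first_form X q"
  have G: "?G $ 1 $ 1 = ?g11" "?G $ 1 $ 2 = ?g12" "?G $ 2 $ 1 = ?g12" "?G $ 2 $ 2 = ?g22"
    by (auto simp: first_form_def inner_commute)
  have inv: "matrix_inv ?G $ 1 $ 1 = ?g22 / ?D" "matrix_inv ?G $ 1 $ 2 = - ?g12 / ?D"
    "matrix_inv ?G $ 2 $ 1 = - ?g12 / ?D" "matrix_inv ?G $ 2 $ 2 = ?g11 / ?D"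
    using matrix_inv_2x2 [of ?G] D unfolding G by simp_all
  have np: "n \<bullet> normal_part X q x = n \<bullet> x" for x
  proof -
    have "n \<bullet> normal_part X q x = (x \<bullet> sgn (cross3 ?E ?F)) * (sgn (cross3 ?E ?F) \<bullet> n)"
      by (simp add: normal_part_def unit_normal_def inner_commute)
    then show ?thesis using inner_unit_normal [OF m n] by (simp add: inner_commute)
  qed
  define b where "b i j = n \<bullet> pd i (pd j X) q" for i j
  have "n \<bullet> mean_curvature_vector X q = deriv \<phi> (X q $ 3) * n $ 3"
    using min X q by (simp add: phi_minimal_def np inner_axis)
  moreover have "n \<bullet> mean_curvature_vector X q =
      (?g22 / ?D) * b 1 1 - (?g12 / ?D) * (b 1 2 + b 2 1) + (?g11 / ?D) * b 2 2"
    unfolding mean_curvature_vector_def sum_2 inv second_form_def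
    by (simp add: inner_add_right inner_diff_right np b_def diff_divide_distrib add_divide_distrib algebra_simps)
  ultimately have eq: "?g22 * b 1 1 - ?g12 * (b 1 2 + b 2 1) + ?g11 * b 2 2 = ?D * deriv \<phi> (X q $ 3) * n $ 3"
  proof -
    have "x = d * r" if "x1 / d - x2 / d * y + x3 / d * z = r" "d \<noteq> 0" "x = x1 - x2 * y + x3 * z"
      for x x1 x2 x3 y z d r :: real
      using that by (simp add: field_simps)
    from this [of "?g22 * b 1 1" ?D ?g12 "b 1 2 + b 2 1" ?g11 "b 2 2" "deriv \<phi> (X q $ 3) * n $ 3"]
    show ?thesis
      using D \<open>n \<bullet> mean_curvature_vector X q = deriv \<phi> (X q $ 3) * n $ 3\<close>
        \<open>n \<bullet> mean_curvature_vector X q = _ / _ * _ - _ + _\<close> by (simp add: mult.assoc)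
  qed
  have B: "n \<bullet> ddX X q v w = v$1 * w$1 * b 1 1 + v$1 * w$2 * b 1 2 + v$2 * w$1 * b 2 1 + v$2 * w$2 * b 2 2" for v w
    unfolding ddX_expand(1)[OF sm q] dX_def b_def
    by (simp add: inner_add_right algebra_simps)
  have g: "dX X q v \<bullet> dX X q w = v$1 * w$1 * ?g11 + (v$1 * w$2 + v$2 * w$1) * ?g12 + v$2 * w$2 * ?g22" for v w
    unfolding dX_def by (simp add: inner_add_right inner_add_left inner_commute algebra_simps)
  \<comment> \<open>Passing from the coordinate basis to \<open>v\<close>, \<open>w\<close>
    multiplies both the curvature expression and the Gram determinant by the square of the
    determinant of \<open>v\<close> and \<open>w\<close>.\<close>
  have "(dX X q w \<bullet> dX X q w) * (n \<bullet> ddX X q v v)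
      - (dX X q v \<bullet> dX X q w) * (n \<bullet> ddX X q v w + n \<bullet> ddX X q w v)
      + (dX X q v \<bullet> dX X q v) * (n \<bullet> ddX X q w w)
      = (v$1 * w$2 - v$2 * w$1)\<^sup>2 * (?g22 * b 1 1 - ?g12 * (b 1 2 + b 2 1) + ?g11 * b 2 2)"
    unfolding B g by algebra
  also have "\<dots> = (v$1 * w$2 - v$2 * w$1)\<^sup>2 * ?D * deriv \<phi> (X q $ 3) * n $ 3"
    unfolding eq by simp
  also have "(v$1 * w$2 - v$2 * w$1)\<^sup>2 * ?D =
      (dX X q v \<bullet> dX X q v) * (dX X q w \<bullet> dX X q w) - (dX X q v \<bullet> dX X q w)\<^sup>2"
    unfolding g by algebra
  finally show ?thesis .
qed

section \<open>Charts as local graphs over a plane, and curves lying in the surface\<close>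

lemma has_vector_derivative_compose:
  assumes "(q has_vector_derivative q') (at t)" "(f has_derivative f') (at (q t))"
  shows "((\<lambda>t. f (q t)) has_vector_derivative f' q') (at t)"
proof -
  interpret bounded_linear f' using assms(2) by (rule has_derivative_bounded_linear)
  show ?thesis
    using has_derivative_compose [OF assms(1) [unfolded has_vector_derivative_def] assms(2)]
    by (simp add: has_vector_derivative_def scaleR)
qed

lemma continuous_on_dX:
  assumes "smooth_on U X" shows "continuous_on U (\<lambda>q. dX X q v)"
  unfolding dX_def
  by (intro continuous_intros smooth_on_continuous_on smooth_on_pd assms)

lemma local_inverse:
  fixes F :: "real^2 \<Rightarrow> real^2"
  assumes "open U" and diff: "\<And>q. q \<in> U \<Longrightarrow> F differentiable (at q)"
    and cont: "\<And>v. continuous_on U (\<lambda>q. dX F q v)" and q0: "q0 \<in> U" and inj: "inj (dX F q0)"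
  obtains U' V g g' where "open U'" "U' \<subseteq> U" "q0 \<in> U'" "open V" "F q0 \<in> V" "homeomorphism U' V F g"
    "\<And>y. y \<in> V \<Longrightarrow> (g has_derivative g' y) (at y)"
    "\<And>y h. y \<in> V \<Longrightarrow> dX F (g y) (g' y h) = h"
    "\<And>y. y \<in> V \<Longrightarrow> inj (dX F (g y))"
proof -
  define f' where "f' q = Blinfun (dX F q)" for q
  have bl: "bounded_linear (dX F q)" for q
    using linear_dX by (rule linear_conv_bounded_linear [THEN iffD1])
  have f': "blinfun_apply (f' q) = dX F q" for q
    by (simp add: f'_def bounded_linear_Blinfun_apply bl)
  have contf: "continuous_on U f'"
    by (rule continuous_on_blinfun_componentwise) (simp add: f' cont)
  obtain h where h: "linear h" "\<And>x. h (dX F q0 x) = x"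
    using linear_injective_left_inverse [OF linear_dX inj] by (auto simp: fun_eq_iff)
  have "Blinfun h o\<^sub>L f' q0 = id_blinfun"
    using h by (intro blinfun_eqI) (simp add: f' bounded_linear_Blinfun_apply linear_conv_bounded_linear)
  from inverse_function_theorem [OF \<open>open U\<close> _ contf q0 this]
  obtain U' V g g' where *: "open U'" "U' \<subseteq> U" "q0 \<in> U'" "open V" "F q0 \<in> V" "homeomorphism U' V F g"
    "\<And>y. y \<in> V \<Longrightarrow> (g has_derivative g' y) (at y)"
    "\<And>y. y \<in> V \<Longrightarrow> g' y = inv (dX F (g y))"
    "\<And>y. y \<in> V \<Longrightarrow> bij (dX F (g y))"
    unfolding f' using has_derivative_dX [OF diff] by metis
  show thesis
    by (rule that [OF *(1-7)]) (use * in \<open>auto simp: bij_is_inj bij_is_surj surj_f_inv_f\<close>)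
qed

text \<open>The inverse function theorem applied to \<open>L\<close> composed with the chart.
  \<open>L\<close> stays general because two projections are needed: to the coordinates of a tangent
  plane in \<open>curve_in_chart\<close>, and to the horizontal plane in
  \<open>profile_regular\<close>.\<close>

lemma chart_projection:
  fixes L :: "real^3 \<Rightarrow> real^2"
  assumes X: "local_parametrization S U X" and q0: "q0 \<in> U" and L: "linear L"
    and inj: "\<forall>v. L (dX X q0 v) = 0 \<longrightarrow> v = 0"
  obtains V O' g g' where "open V" "L (X q0) \<in> V" "open O'" "X q0 \<in> O'"
    "\<And>y. y \<in> V \<Longrightarrow> g y \<in> U" "\<And>y. y \<in> V \<Longrightarrow> L (X (g y)) = y" "g (L (X q0)) = q0"
    "\<And>y. y \<in> V \<Longrightarrow> (g has_derivative g' y) (at y)"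
    "\<And>y h. y \<in> V \<Longrightarrow> L (dX X (g y) (g' y h)) = h"
    "\<And>y v. y \<in> V \<Longrightarrow> L (dX X (g y) v) = 0 \<Longrightarrow> v = 0"
    "\<And>P. P \<in> S \<Longrightarrow> P \<in> O' \<Longrightarrow> L P \<in> V \<and> X (g (L P)) = P"
    "\<And>y. y \<in> V \<Longrightarrow> X (g y) \<in> S"
proof -
  have U: "open U" "smooth_on U X" and S: "openin (top_of_set S) (X ` U)"
    using X by (auto simp: local_parametrization_def)
  obtain Y where hom: "homeomorphism U (X ` U) X Y"
    using X by (auto simp: local_parametrization_def)
  have der: "((\<lambda>q. L (X q)) has_derivative (\<lambda>v. L (dX X q v))) (at q)" if "q \<in> U" for q
    using has_derivative_compose [OF has_derivative_dX [OF smooth_on_differentiable [OF U(2) that]]]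
      linear_imp_has_derivative [OF L] by blast
  then have dF: "dX (\<lambda>q. L (X q)) q = (\<lambda>v. L (dX X q v))" if "q \<in> U" for q
    using that dX_eqI by blast
  have c: "continuous_on U (\<lambda>q. dX (\<lambda>q. L (X q)) q v)" for v
    by (rule continuous_on_eq [OF linear_continuous_on_compose [OF continuous_on_dX [OF U(2)] L]])
      (simp add: dF)
  have "linear (\<lambda>v. L (dX X q0 v))"
    using linear_compose [OF linear_dX L] by (simp add: o_def)
  then have "inj (\<lambda>v. L (dX X q0 v))"
    using inj by (simp add: linear_injective_0)
  then have "inj (dX (\<lambda>q. L (X q)) q0)"
    by (simp add: dF q0)
  from local_inverse [OF U(1) _ c q0 this]
  obtain U' V g g' where *: "open U'" "U' \<subseteq> U" "q0 \<in> U'" "open V" "L (X q0) \<in> V"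
    "homeomorphism U' V (\<lambda>q. L (X q)) g"
    "\<And>y. y \<in> V \<Longrightarrow> (g has_derivative g' y) (at y)"
    "\<And>y h. y \<in> V \<Longrightarrow> dX (\<lambda>q. L (X q)) (g y) (g' y h) = h"
    "\<And>y. y \<in> V \<Longrightarrow> inj (dX (\<lambda>q. L (X q)) (g y))"
    using der differentiableI by metis
  have gU: "g y \<in> U" if "y \<in> V" for y
    using * that by (auto simp: homeomorphism_def)
  have lin: "linear (\<lambda>v. L (dX X q v))" for q
    using linear_compose [OF linear_dX L] by (simp add: o_def)
  have "openin (top_of_set (X ` U)) (X ` U')"
    using homeomorphism_imp_open_map [OF hom] * U by (simp add: open_openin_trans open_subset)
  then have "openin (top_of_set S) (X ` U')"
    using S openin_trans by blast
  then obtain O' where O': "open O'" "X ` U' = S \<inter> O'"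
    by (auto simp: openin_open)
  show thesis
  proof (rule that [OF *(4,5) O'(1), of g g'])
    show "X q0 \<in> O'" using O' * by blast
    show "L (X (g y)) = y" if "y \<in> V" for y using * that by (auto simp: homeomorphism_def)
    show "g (L (X q0)) = q0" using * by (auto simp: homeomorphism_def)
    show "L P \<in> V \<and> X (g (L P)) = P" if "P \<in> S" "P \<in> O'" for P
    proof -
      have "P \<in> X ` U'" unfolding O'(2) using that by blast
      then obtain q where "q \<in> U'" "P = X q" by blast
      then show ?thesis
        using homeomorphism_apply1 [OF *(6)] homeomorphism_image1 [OF *(6)] by force
    qed
    show "X (g y) \<in> S" if "y \<in> V" for y
      using gU [OF that] S openin_subset by fastforce
    show "v = 0" if "y \<in> V" "L (dX X (g y) v) = 0" for y v
      using *(9) [OF that(1)] that lin [of "g y"] by (simp add: dF gU linear_injective_0)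
    show "L (dX X (g y) (g' y h)) = h" if "y \<in> V" for y h
      using *(8) [OF that] dF gU that by metis
  qed (use * gU in auto)
qed

text \<open>The normal part of the acceleration of a curve in a surface depends on its velocity only.\<close>

lemma curve_in_chart:
  assumes X: "local_parametrization S U X" and q0: "q0 \<in> U" and "0 < e"
    and \<gamma>: "\<And>t. \<bar>t\<bar> < e \<Longrightarrow> \<gamma> t \<in> S" "\<gamma> 0 = X q0"
    and d\<gamma>: "\<And>t. \<bar>t\<bar> < e \<Longrightarrow> (\<gamma> has_vector_derivative \<gamma>' t) (at t)" and c: "isCont \<gamma>' 0"
  obtains w where "\<gamma>' 0 = dX X q0 w"
    "\<And>n a. (\<And>v. n \<bullet> dX X q0 v = 0) \<Longrightarrow> ((\<lambda>t. n \<bullet> \<gamma>' t) has_real_derivative a) (at 0)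
      \<Longrightarrow> a = n \<bullet> ddX X q0 w w"
proof -
  have U: "open U" "smooth_on U X"
    using X by (auto simp: local_parametrization_def)
  let ?E = "pd 1 X q0" and ?F = "pd 2 X q0"
  \<comment> \<open>Inner products with the partial derivatives at \<open>q0\<close>: injective on
    the tangent plane, since a tangent vector in the kernel is orthogonal to itself.\<close>
  define L :: "real^3 \<Rightarrow> real^2" where "L p = vector [p \<bullet> ?E, p \<bullet> ?F]" for p
  have L: "linear L"
    by (auto intro!: linearI simp: L_def vec_eq_iff forall_2 inner_add_left)
  then have L': "bounded_linear L" by (rule linear_conv_bounded_linear [THEN iffD1])
  have inj: "\<forall>v. L (dX X q0 v) = 0 \<longrightarrow> v = 0"
  proof (intro allI impI)
    fix v assume that: "L (dX X q0 v) = 0"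
    have "dX X q0 v \<bullet> ?E = 0" "dX X q0 v \<bullet> ?F = 0"
      using that by (simp_all add: L_def vec_eq_iff forall_2)
    then have "dX X q0 v \<bullet> dX X q0 v = 0"
      by (simp add: dX_def [of X q0 v] inner_add_right)
    then show "v = 0" using dX_injective [OF X q0] by simp
  qed
  obtain V O' g g' where g: "open V" "L (X q0) \<in> V" "open O'" "X q0 \<in> O'"
    "\<And>y. y \<in> V \<Longrightarrow> g y \<in> U" "\<And>y. y \<in> V \<Longrightarrow> L (X (g y)) = y" "g (L (X q0)) = q0"
    "\<And>y. y \<in> V \<Longrightarrow> (g has_derivative g' y) (at y)"
    "\<And>y h. y \<in> V \<Longrightarrow> L (dX X (g y) (g' y h)) = h"
    "\<And>y v. y \<in> V \<Longrightarrow> L (dX X (g y) v) = 0 \<Longrightarrow> v = 0"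
    "\<And>P. P \<in> S \<Longrightarrow> P \<in> O' \<Longrightarrow> L P \<in> V \<and> X (g (L P)) = P"
    "\<And>y. y \<in> V \<Longrightarrow> X (g y) \<in> S"
    by (rule chart_projection [OF X q0 L inj]) blast
  have \<gamma>c: "isCont \<gamma> 0"
    using d\<gamma> [of 0] \<open>0 < e\<close> has_vector_derivative_continuous by auto
  then have "\<forall>\<^sub>F t in nhds 0. \<gamma> t \<in> O'"
    using topological_tendstoD [of \<gamma> "\<gamma> 0" "nhds 0", OF _ g(3)] g(4)
    unfolding \<gamma>(2) [symmetric] by (simp add: continuous_at tendsto_at_iff_tendsto_nhds)
  then obtain e' where e': "e' > 0" "\<And>t. \<bar>t\<bar> < e' \<Longrightarrow> \<gamma> t \<in> O'"
    by (auto simp: eventually_nhds_metric dist_real_def)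
  define d where "d = min e e'"
  define q where "q t = g (L (\<gamma> t))" for t
  define q' where "q' t = g' (L (\<gamma> t)) (L (\<gamma>' t))" for t
  have d: "d > 0" using e' \<open>0 < e\<close> by (simp add: d_def)
  have V: "L (\<gamma> t) \<in> V" "X (q t) = \<gamma> t" "q t \<in> U" if "\<bar>t\<bar> < d" for t
  proof -
    have "\<gamma> t \<in> S" "\<gamma> t \<in> O'" using that \<gamma>(1) e'(2) by (auto simp: d_def)
    note * = g(11) [OF this]
    show "L (\<gamma> t) \<in> V" using * ..
    show "X (q t) = \<gamma> t" unfolding q_def using * ..
    show "q t \<in> U" unfolding q_def by (rule g(5) [OF conjunct1 [OF *]])
  qed
  have dq: "(q has_vector_derivative q' t) (at t)" if "\<bar>t\<bar> < d" for t
  proof -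
    have "((\<lambda>t. L (\<gamma> t)) has_vector_derivative L (\<gamma>' t)) (at t)"
      by (rule bounded_linear.has_vector_derivative [OF L' d\<gamma>]) (use that in \<open>simp add: d_def\<close>)
    from has_vector_derivative_compose [OF this g(8) [OF V(1) [OF that]]]
    show ?thesis unfolding q_def [abs_def] q'_def .
  qed
  have q00: "q 0 = q0" using g(7) \<gamma>(2) by (simp add: q_def)
  have \<gamma>': "\<gamma>' t = dX X (q t) (q' t)" if "\<bar>t\<bar> < d" for t
  proof -
    have "((\<lambda>t. X (q t)) has_vector_derivative dX X (q t) (q' t)) (at t)"
      using has_vector_derivative_compose [OF dq [OF that]] V(3) [OF that]
        has_derivative_dX smooth_on_differentiable U(2) by blast
    then have "(\<gamma> has_vector_derivative dX X (q t) (q' t)) (at t)"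
      by (rule has_vector_derivative_transform_within_open [of _ _ _ "{-d<..<d}"])
        (use that V(2) in \<open>auto simp: abs_less_iff\<close>)
    then show ?thesis
      using d\<gamma> [of t] that vector_derivative_unique_at by (auto simp: d_def)
  qed
  have qc: "q \<midarrow>0\<rightarrow> q0"
    using dq [of 0] d has_vector_derivative_continuous q00 by (force simp: continuous_at)
  have pdc: "(\<lambda>t. pd i X (q t)) \<midarrow>0\<rightarrow> pd i X q0" for i
  proof -
    have "isCont (pd i X) q0"
      using smooth_on_continuous_on [OF smooth_on_pd [OF U(2)]] U(1) q0 by (simp add: continuous_on_eq_continuous_at)
    then show ?thesis using isCont_tendsto_compose [OF _ qc] by blast
  qed
  have ev: "\<forall>\<^sub>F t in at 0. \<bar>t\<bar> < d"
    using d by (auto simp: eventually_at dist_real_def intro!: exI [of _ d])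
  define A where "A i p t = pd i X (q t) \<bullet> p" for i p t
  define dt where "dt t = A 1 ?E t * A 2 ?F t - A 2 ?E t * A 1 ?F t" for t
  have Ac: "A i p \<midarrow>0\<rightarrow> pd i X q0 \<bullet> p" for i p
    unfolding A_def [abs_def] by (intro tendsto_intros pdc)
  have \<gamma>'c: "\<gamma>' \<midarrow>0\<rightarrow> \<gamma>' 0" using c by (simp add: continuous_at)
  let ?D = "(?E \<bullet> ?E) * (?F \<bullet> ?F) - (?E \<bullet> ?F)\<^sup>2"
  have D0: "?D \<noteq> 0"
  proof
    assume 0: "?D = 0"
    define v :: "real^2" where "v = vector [?F \<bullet> ?F, - (?E \<bullet> ?F)]"
    have "L (dX X q0 v) = 0"
      using 0 by (simp add: L_def vec_eq_iff forall_2 dX_def v_def inner_diff_left inner_diff_right inner_commute mult.commute power2_eq_square)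
    then have "v = 0" using inj by blast
    then have "?F = 0" by (simp add: v_def vec_eq_iff forall_2)
    then have "dX X q0 (axis 2 1) = 0" by (simp add: dX_def axis_def)
    from dX_injective [OF X q0 this] show False by (simp add: axis_eq_0_iff)
  qed
  have dtc: "dt \<midarrow>0\<rightarrow> ?D"
    using tendsto_diff [OF tendsto_mult [OF Ac Ac] tendsto_mult [OF Ac Ac], of 1 ?E 2 ?F 2 ?E 1 ?F]
    by (simp add: dt_def [abs_def] inner_commute power2_eq_square)
  have evd: "\<forall>\<^sub>F t in at 0. dt t \<noteq> 0"
    using dtc D0 by (rule tendsto_imp_eventually_ne)
  \<comment> \<open>The inverse function theorem as used gives no continuity of \<open>g'\<close>.
    The parameter velocity \<open>q'\<close> is therefore recovered from \<gamma>' by a linear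
    system with continuous coefficients, and Cramer's rule yields its continuity at 0.\<close>
  have sys: "\<gamma>' t \<bullet> p = q' t $ 1 * A 1 p t + q' t $ 2 * A 2 p t" if "\<bar>t\<bar> < d" for t p
    unfolding \<gamma>' [OF that] A_def dX_def by (simp add: inner_add_left)
  have cramer: "q' t $ 1 * dt t = (\<gamma>' t \<bullet> ?E) * A 2 ?F t - (\<gamma>' t \<bullet> ?F) * A 2 ?E t"
    "q' t $ 2 * dt t = (\<gamma>' t \<bullet> ?F) * A 1 ?E t - (\<gamma>' t \<bullet> ?E) * A 1 ?F t" if "\<bar>t\<bar> < d" for t
    unfolding sys [OF that] dt_def by algebra+
  have dt0: "dt 0 = ?D"
    by (simp add: dt_def A_def q00 inner_commute power2_eq_square)
  have q'c: "(\<lambda>t. q' t $ 1) \<midarrow>0\<rightarrow> q' 0 $ 1" "(\<lambda>t. q' t $ 2) \<midarrow>0\<rightarrow> q' 0 $ 2"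
  proof -
    have "(\<lambda>t. ((\<gamma>' t \<bullet> ?E) * A 2 ?F t - (\<gamma>' t \<bullet> ?F) * A 2 ?E t) / dt t) \<midarrow>0\<rightarrow>
       ((\<gamma>' 0 \<bullet> ?E) * (?F \<bullet> ?F) - (\<gamma>' 0 \<bullet> ?F) * (?F \<bullet> ?E)) / ?D"
      by (intro tendsto_intros \<gamma>'c Ac dtc D0)
    moreover have "((\<gamma>' 0 \<bullet> ?E) * (?F \<bullet> ?F) - (\<gamma>' 0 \<bullet> ?F) * (?F \<bullet> ?E)) / ?D = q' 0 $ 1"
      using cramer(1) [of 0] d D0 dt0 by (simp add: A_def q00 field_simps)
    moreover have "\<forall>\<^sub>F t in at 0. ((\<gamma>' t \<bullet> ?E) * A 2 ?F t - (\<gamma>' t \<bullet> ?F) * A 2 ?E t) / dt t = q' t $ 1"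
      using ev evd by eventually_elim (use cramer(1) in \<open>simp add: field_simps\<close>)
    ultimately show "(\<lambda>t. q' t $ 1) \<midarrow>0\<rightarrow> q' 0 $ 1"
      using tendsto_cong by force
    have "(\<lambda>t. ((\<gamma>' t \<bullet> ?F) * A 1 ?E t - (\<gamma>' t \<bullet> ?E) * A 1 ?F t) / dt t) \<midarrow>0\<rightarrow>
       ((\<gamma>' 0 \<bullet> ?F) * (?E \<bullet> ?E) - (\<gamma>' 0 \<bullet> ?E) * (?E \<bullet> ?F)) / ?D"
      by (intro tendsto_intros \<gamma>'c Ac dtc D0)
    moreover have "((\<gamma>' 0 \<bullet> ?F) * (?E \<bullet> ?E) - (\<gamma>' 0 \<bullet> ?E) * (?E \<bullet> ?F)) / ?D = q' 0 $ 2"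
      using cramer(2) [of 0] d D0 dt0 by (simp add: A_def q00 field_simps)
    moreover have "\<forall>\<^sub>F t in at 0. ((\<gamma>' t \<bullet> ?F) * A 1 ?E t - (\<gamma>' t \<bullet> ?E) * A 1 ?F t) / dt t = q' t $ 2"
      using ev evd by eventually_elim (use cramer(2) in \<open>simp add: field_simps\<close>)
    ultimately show "(\<lambda>t. q' t $ 2) \<midarrow>0\<rightarrow> q' 0 $ 2"
      using tendsto_cong by force
  qed
  have "a = n \<bullet> ddX X q0 (q' 0) (q' 0)"
    if n: "\<And>v. n \<bullet> dX X q0 v = 0" and a: "((\<lambda>t. n \<bullet> \<gamma>' t) has_real_derivative a) (at 0)" for n a
  proof -
    have n0: "n \<bullet> ?E = 0" "n \<bullet> ?F = 0"
      using n [of "axis 1 1"] n [of "axis 2 1"] by (simp_all add: dX_def axis_def)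
    have "((\<lambda>t. n \<bullet> pd i X (q t)) has_vector_derivative n \<bullet> dX (pd i X) q0 (q' 0)) (at 0)" for i
    proof -
      have "(pd i X has_derivative dX (pd i X) q0) (at q0)"
        using q0 U(2) has_derivative_dX smooth_on_differentiable smooth_on_pd by blast
      then have "((\<lambda>t. pd i X (q t)) has_vector_derivative dX (pd i X) q0 (q' 0)) (at 0)"
        using has_vector_derivative_compose [OF dq [of 0]] d q00 by simp
      then show ?thesis
        by (rule bounded_linear.has_vector_derivative [OF bounded_linear_inner_right])
    qed
    then have lim: "(\<lambda>t. (n \<bullet> pd i X (q t) - n \<bullet> pd i X q0) / t) \<midarrow>0\<rightarrow> n \<bullet> dX (pd i X) q0 (q' 0)" for i
      by (simp add: q00 DERIV_def flip: has_real_derivative_iff_has_vector_derivative)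
    have "(\<lambda>t. (n \<bullet> \<gamma>' t - n \<bullet> \<gamma>' 0) / t) \<midarrow>0\<rightarrow> a"
      using a by (simp add: DERIV_def)
    moreover have "n \<bullet> \<gamma>' 0 = 0"
      using \<gamma>' [of 0] n q00 d by simp
    \<comment> \<open>As \<open>n\<close> is orthogonal to both partials at \<open>q0\<close>, these
      may be subtracted for free. The difference quotient then falls on the partials alone, and mere
      continuity of \<open>q'\<close> suffices for the limit.\<close>
    moreover have "n \<bullet> \<gamma>' t / t = q' t $ 1 * ((n \<bullet> pd 1 X (q t) - n \<bullet> pd 1 X q0) / t)
        + q' t $ 2 * ((n \<bullet> pd 2 X (q t) - n \<bullet> pd 2 X q0) / t)" if "\<bar>t\<bar> < d" for t
      using \<gamma>' [OF that] n0 by (simp add: dX_def inner_add_right add_divide_distrib)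
    then have "\<forall>\<^sub>F t in at 0. n \<bullet> \<gamma>' t / t = q' t $ 1 * ((n \<bullet> pd 1 X (q t) - n \<bullet> pd 1 X q0) / t)
        + q' t $ 2 * ((n \<bullet> pd 2 X (q t) - n \<bullet> pd 2 X q0) / t)"
      using ev by (auto elim: eventually_mono)
    ultimately have "(\<lambda>t. q' t $ 1 * ((n \<bullet> pd 1 X (q t) - n \<bullet> pd 1 X q0) / t)
        + q' t $ 2 * ((n \<bullet> pd 2 X (q t) - n \<bullet> pd 2 X q0) / t)) \<midarrow>0\<rightarrow> a"
      using tendsto_cong by force
    moreover have "(\<lambda>t. q' t $ 1 * ((n \<bullet> pd 1 X (q t) - n \<bullet> pd 1 X q0) / t)
        + q' t $ 2 * ((n \<bullet> pd 2 X (q t) - n \<bullet> pd 2 X q0) / t)) \<midarrow>0\<rightarrow>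
        q' 0 $ 1 * (n \<bullet> dX (pd 1 X) q0 (q' 0)) + q' 0 $ 2 * (n \<bullet> dX (pd 2 X) q0 (q' 0))"
      by (intro tendsto_intros q'c lim)
    ultimately have "a = q' 0 $ 1 * (n \<bullet> dX (pd 1 X) q0 (q' 0)) + q' 0 $ 2 * (n \<bullet> dX (pd 2 X) q0 (q' 0))"
      by (rule LIM_unique)
    then show ?thesis
      by (simp add: ddX_expand(1) [OF U(2) q0] inner_add_right)
  qed
  moreover have "\<gamma>' 0 = dX X q0 (q' 0)"
    using \<gamma>' [of 0] q00 d by simp
  ultimately show thesis using that by blast
qed

section \<open>The comparison principle\<close>

text \<open>The normal has third component 1, so a tangent vector is determined by its horizontal
  part and \<open>W h k\<close> is the parameter direction over \<open>(h, k)\<close>. The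
  coefficients \<open>b11\<close>, \<open>b12\<close>, \<open>b22\<close> are the Hessian of the
  local graph with gradient \<open>(a, b)\<close>, and the last equation is the quasilinear graph
  equation.\<close>

lemma graph_jet:
  assumes min: "phi_minimal \<phi> S" and X: "local_parametrization S U X" and q: "q \<in> U"
    and n: "\<And>v. vector [- a, - b, 1] \<bullet> dX X q v = 0"
  obtains W b11 b12 b22 where
    "\<And>h k. dX X q (W h k) = vector [h, k, a * h + b * k]"
    "\<And>h k. vector [- a, - b, 1] \<bullet> ddX X q (W h k) (W h k) = b11 * h\<^sup>2 + 2 * b12 * h * k + b22 * k\<^sup>2"
    "(1 + b\<^sup>2) * b11 - 2 * a * b * b12 + (1 + a\<^sup>2) * b22 = (1 + a\<^sup>2 + b\<^sup>2) * deriv \<phi> (X q $ 3)"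
proof -
  let ?n = "vector [- a, - b, 1] :: real^3"
  have sm: "smooth_on U X" using X by (simp add: local_parametrization_def)
  define p where "p v = (vector [dX X q v $ 1, dX X q v $ 2] :: real^2)" for v
  have d3: "dX X q v $ 3 = a * dX X q v $ 1 + b * dX X q v $ 2" for v
    using n [of v] by (simp add: inner_vec_def sum_3)
  have lp: "linear p"
    using linear_dX [of X q] by (auto intro!: linearI simp: p_def vec_eq_iff forall_2 linear_add linear_scale)
  have "v = 0" if "p v = 0" for v
  proof -
    have "dX X q v = 0"
      using that d3 [of v] by (simp add: p_def vec_eq_iff forall_2 forall_3)
    then show ?thesis by (rule dX_injective [OF X q])
  qed
  then have "inj p" using lp by (simp add: linear_injective_0)
  then have "surj p" using linear_injective_imp_surjective [OF lp] by simp
  then obtain v w where "p v = vector [1, 0]" "p w = vector [0, 1]" by (metis surjD)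
  then have v: "dX X q v = vector [1, 0, a]" and w: "dX X q w = vector [0, 1, b]"
    using d3 [of v] d3 [of w] by (simp_all add: p_def vec_eq_iff forall_2 forall_3)
  let ?B = "\<lambda>v w. ?n \<bullet> ddX X q v w"
  have eq: "(1 + b\<^sup>2) * ?B v v - a * b * (?B v w + ?B w v) + (1 + a\<^sup>2) * ?B w w
      = (1 + a\<^sup>2 + b\<^sup>2) * deriv \<phi> (X q $ 3)"
  proof -
    have "?n \<bullet> pd 1 X q = 0" "?n \<bullet> pd 2 X q = 0"
      using n [of "axis 1 1"] n [of "axis 2 1"] by (simp_all add: dX_def axis_def)
    from mean_curvature_scalar [OF min X q this, of w v]
    have "(1 + b\<^sup>2) * ?B v v - a * b * (?B v w + ?B w v) + (1 + a\<^sup>2) * ?B w w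
      = ((1 + a\<^sup>2) * (1 + b\<^sup>2) - (a * b)\<^sup>2) * deriv \<phi> (X q $ 3)"
      unfolding v w by (simp add: inner_vec_def sum_3 power2_eq_square)
    also have "(1 + a\<^sup>2) * (1 + b\<^sup>2) - (a * b)\<^sup>2 = 1 + a\<^sup>2 + b\<^sup>2" by algebra
    finally show ?thesis .
  qed
  define W where "W h k = h *\<^sub>R v + k *\<^sub>R w" for h k
  have B: "?B (W h k) (W h k) = h\<^sup>2 * ?B v v + h * k * (?B v w + ?B w v) + k\<^sup>2 * ?B w w" for h k
    unfolding ddX_expand(1)[OF sm q] dX_def W_def inner_add_right inner_scaleR_right scaleR_add_right
      vector_add_component vector_scaleR_component real_scaleR_def by algebra
  show thesis
  proof (rule that)
    show "dX X q (W h k) = vector [h, k, a * h + b * k]" for h k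
      using linear_dX [of X q] by (simp add: W_def linear_add linear_scale v w vec_eq_iff forall_3 mult.commute)
    show "?B (W h k) (W h k) = ?B v v * h\<^sup>2 + 2 * ((?B v w + ?B w v) / 2) * h * k + ?B w w * k\<^sup>2" for h k
      unfolding B by (simp add: algebra_simps)
    show "(1 + b\<^sup>2) * ?B v v - 2 * a * b * ((?B v w + ?B w v) / 2) + (1 + a\<^sup>2) * ?B w w
        = (1 + a\<^sup>2 + b\<^sup>2) * deriv \<phi> (X q $ 3)"
      using eq by (simp add: algebra_simps)
  qed
qed

lemma second_derivative_test:
  fixes G :: "real \<Rightarrow> real"
  assumes "e > 0" and G: "\<And>s. \<bar>s\<bar> < e \<Longrightarrow> (G has_real_derivative G' s) (at s)"
    and G': "(G' has_real_derivative c) (at 0)" and max: "\<And>s. \<bar>s\<bar> < e \<Longrightarrow> G s \<le> G 0"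
  shows "G' 0 = 0" "c \<le> 0"
proof -
  show 0: "G' 0 = 0"
    using DERIV_local_max [OF G [of 0] \<open>e > 0\<close>] max \<open>e > 0\<close> by simp
  show "c \<le> 0"
  proof (rule ccontr)
    assume "\<not> c \<le> 0"
    then obtain d where d: "d > 0" "\<And>h. 0 < h \<Longrightarrow> h < d \<Longrightarrow> G' 0 < G' h"
      using DERIV_pos_inc_right [OF G'] by auto
    define t where "t = min d e / 2"
    have t: "0 < t" "t < d" "t < e" using d \<open>e > 0\<close> by (auto simp: t_def)
    have "\<exists>z. 0 < z \<and> z < t \<and> G t - G 0 = (t - 0) * G' z"
      by (rule MVT2) (use t in \<open>auto intro!: G\<close>)
    then obtain z where "0 < z" "z < t" "G t - G 0 = t * G' z" by auto
    then have "G t > G 0" using d(2) [of z] t 0 by (simp add: algebra_simps)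
    with max [of t] t show False by simp
  qed
qed

text \<open>A lower bound for the form and an upper bound for its trace bound every coefficient from
  both sides; the vectors \<open>(1, 1)\<close> and \<open>(1, -1)\<close> take care of the mixed
  one.\<close>

lemma quadratic_form_bounds:
  fixes \<kappa> T :: real
  assumes lower: "\<And>h k. - (b11 * h\<^sup>2 + 2 * b12 * h * k + b22 * k\<^sup>2) \<le> \<kappa> * (h\<^sup>2 + k\<^sup>2)"
    and tr: "b11 + b22 \<le> T" and \<kappa>: "\<kappa> \<ge> 0" and T: "T \<ge> 0"
  shows "\<bar>b11\<bar> \<le> T + 2 * \<kappa>" "\<bar>b12\<bar> \<le> T + 2 * \<kappa>" "\<bar>b22\<bar> \<le> T + 2 * \<kappa>"
  using lower [of 1 0] lower [of 0 1] lower [of 1 1] lower [of 1 "-1"] tr \<kappa> T by simp_all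

text \<open>If the perturbation strength \<open>\<tau>\<close> vanished, the two quadratic forms would satisfy
  \<open>c h \<le> b (R h)\<close> and the two equations would give no contradiction; the strict gain
  \<open>\<tau> * K * h\<^sup>2\<close> beats the errors of size \<open>O(\<tau>)\<close> as soon as \<open>K\<close> is large.\<close>

lemma comparison_algebra:
  fixes co si \<tau> \<kappa> N \<Phi> K :: real
  assumes R: "co\<^sup>2 + si\<^sup>2 = 1"
    and a: "a1 = co * e1 + si * e2 - \<tau>" "a2 = - si * e1 + co * e2"
    and eqb: "(1 + e2\<^sup>2) * b11 - 2 * e1 * e2 * b12 + (1 + e1\<^sup>2) * b22 = (1 + e1\<^sup>2 + e2\<^sup>2) * g"
    and eqc: "(1 + a2\<^sup>2) * c11 - 2 * a1 * a2 * c12 + (1 + a1\<^sup>2) * c22 = (1 + a1\<^sup>2 + a2\<^sup>2) * f"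
    and lower: "\<And>h k. - (b11 * h\<^sup>2 + 2 * b12 * h * k + b22 * k\<^sup>2) \<le> \<kappa> * (h\<^sup>2 + k\<^sup>2)"
    and comp: "\<And>h k. c11 * h\<^sup>2 + 2 * c12 * h * k + c22 * k\<^sup>2 + \<tau> * K * h\<^sup>2 \<le>
       b11 * (co * h - si * k)\<^sup>2 + 2 * b12 * (co * h - si * k) * (si * h + co * k) + b22 * (si * h + co * k)\<^sup>2"
    and fg: "0 \<le> g" "g \<le> f" "g \<le> \<Phi>" and e: "\<bar>e1\<bar> \<le> N" "\<bar>e2\<bar> \<le> N" and \<tau>: "0 < \<tau>" "\<tau> \<le> 1" and "K \<ge> 0" "\<kappa> \<ge> 0"
  shows "K \<le> 4 * N * \<Phi> + 4 * ((1 + 2 * N\<^sup>2) * \<Phi> + 2 * N\<^sup>2 * \<kappa> + 2 * \<kappa>) * (2 * N + 1)"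
proof -
  define M where "M = (1 + 2 * N\<^sup>2) * \<Phi> + 2 * N\<^sup>2 * \<kappa> + 2 * \<kappa>"
  have N: "N \<ge> 0" "\<Phi> \<ge> 0" using e fg by auto
  have sq: "e1\<^sup>2 \<le> N\<^sup>2" "e2\<^sup>2 \<le> N\<^sup>2" using e abs_le_square_iff N by fastforce+
  have cs: "\<bar>co\<bar> \<le> 1" "\<bar>si\<bar> \<le> 1"
    using R by (metis abs_square_le_1 add.commute le_add_same_cancel1 zero_le_power2)+
  have "(1 + e1\<^sup>2 + e2\<^sup>2) * g \<le> (1 + 2 * N\<^sup>2) * \<Phi>"
    using sq fg N by (intro mult_mono) auto
  moreover have "\<kappa> * (e2\<^sup>2 + e1\<^sup>2) \<le> \<kappa> * (2 * N\<^sup>2)"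
    using sq \<open>\<kappa> \<ge> 0\<close> by (intro mult_left_mono) auto
  \<comment> \<open>The graph operator is the sum of the quadratic form over the two axes and over
    the vector \<open>(- e2, e1)\<close> orthogonal to the gradient. This reading is used for both
    forms.\<close>
  moreover have "b11 + b22 = (1 + e1\<^sup>2 + e2\<^sup>2) * g - (b11 * (- e2)\<^sup>2 + 2 * b12 * (- e2) * e1 + b22 * e1\<^sup>2)"
    using eqb by algebra
  ultimately have tr: "b11 + b22 \<le> (1 + 2 * N\<^sup>2) * \<Phi> + 2 * N\<^sup>2 * \<kappa>"
    using lower [of "- e2" e1] by (simp add: algebra_simps)
  have bM: "\<bar>b11\<bar> \<le> M" "\<bar>b12\<bar> \<le> M" "\<bar>b22\<bar> \<le> M"
    using quadratic_form_bounds [OF lower tr \<open>\<kappa> \<ge> 0\<close>] N \<open>\<kappa> \<ge> 0\<close> by (simp_all add: M_def)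
  have M0: "M \<ge> 0" using bM(1) by linarith
  let ?b = "\<lambda>h k. b11 * h\<^sup>2 + 2 * b12 * h * k + b22 * k\<^sup>2"
  \<comment> \<open>The rotated vector orthogonal to the first gradient differs from
    \<open>(- e2, e1)\<close> only by \<tau> times a unit vector.\<close>
  have rot: "co * (- a2) - si * a1 = - (e2 - \<tau> * si)" "si * (- a2) + co * a1 = e1 - \<tau> * co"
    using R unfolding a by algebra+
  \<comment> \<open>Adding \<open>comp\<close> over \<open>(1, 0)\<close>, \<open>(0, 1)\<close> and
    \<open>(- a2, a1)\<close> assembles the operator for the form \<open>c\<close>. The first of
    these vectors alone already contributes the gain \<open>\<tau> * K\<close>.\<close>
  have "(1 + a1\<^sup>2 + a2\<^sup>2) * f + \<tau> * K * (1 + a2\<^sup>2) \<le> ?b co si + ?b (- si) co + ?b (- (e2 - \<tau> * si)) (e1 - \<tau> * co)"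
    using comp [of 1 0] comp [of 0 1] comp [of "- a2" a1] eqc unfolding rot by (simp add: algebra_simps)
  moreover have "?b co si + ?b (- si) co = b11 + b22"
    using R by algebra
  moreover have "?b (- (e2 - \<tau> * si)) (e1 - \<tau> * co) = ?b (- e2) e1 +
      \<tau> * (b11 * (\<tau> * si\<^sup>2 - 2 * e2 * si) + b12 * (2 * (si * e1 + co * e2) - 2 * \<tau> * si * co) + b22 * (\<tau> * co\<^sup>2 - 2 * e1 * co))"
    (is "_ = _ + \<tau> * ?r") by algebra
  moreover have "b11 + b22 + ?b (- e2) e1 = (1 + e1\<^sup>2 + e2\<^sup>2) * g"
    using eqb by algebra
  \<comment> \<open>All coefficients of the form are at most \<open>M\<close>, so replacing
    \<open>(- e2, e1)\<close> by the tilted vector costs at most a constant times \<tau>.\<close>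
  moreover have "?r \<le> 4 * M * (2 * N + 1)"
  proof -
    have es: "\<bar>x * y\<bar> \<le> N" if "\<bar>x\<bar> \<le> N" "\<bar>y\<bar> \<le> 1" for x y
      using mult_mono [OF that] N by (simp add: abs_mult)
    have ts: "0 \<le> \<tau> * y\<^sup>2" "\<tau> * y\<^sup>2 \<le> 1" if "\<bar>y\<bar> \<le> 1" for y
      using that \<tau> mult_mono [of \<tau> 1 "y\<^sup>2" 1] by (auto simp: abs_square_le_1)
    have tsc: "\<bar>\<tau> * si * co\<bar> \<le> 1"
      using cs \<tau> by (simp add: abs_mult mult_le_one)
    have bl: "x * y \<le> M * z" if "\<bar>x\<bar> \<le> M" "\<bar>y\<bar> \<le> z" for x y z
      using mult_mono [OF that] M0 by (simp flip: abs_mult)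
    have "b11 * (\<tau> * si\<^sup>2 - 2 * e2 * si) \<le> M * (2 * N + 1)"
      using es [OF e(2) cs(2)] ts [OF cs(2)] N by (intro bl [OF bM(1)]) linarith
    moreover have "b12 * (2 * (si * e1 + co * e2) - 2 * \<tau> * si * co) \<le> M * (2 * (2 * N + 1))"
    proof (rule bl [OF bM(2)])
      have "\<bar>si * e1\<bar> \<le> N" "\<bar>co * e2\<bar> \<le> N"
        using es [OF e(1) cs(2)] es [OF e(2) cs(1)] by (simp_all add: mult.commute)
      moreover have "\<bar>2 * (x + y) - 2 * t * si * co\<bar> \<le> 2 * (2 * N + 1)"
        if "\<bar>x\<bar> \<le> N" "\<bar>y\<bar> \<le> N" "z = t * si * co" "\<bar>z\<bar> \<le> 1" for x y z t
      proof -
        have *: "2 * (x + y) - 2 * t * si * co = 2 * (x + y - z)" using that by simp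
        show ?thesis unfolding * using that(1,2,4) unfolding abs_le_iff by auto
      qed
      ultimately show "\<bar>2 * (si * e1 + co * e2) - 2 * \<tau> * si * co\<bar> \<le> 2 * (2 * N + 1)"
        using tsc by blast
    qed
    moreover have "b22 * (\<tau> * co\<^sup>2 - 2 * e1 * co) \<le> M * (2 * N + 1)"
      using es [OF e(1) cs(1)] ts [OF cs(1)] N by (intro bl [OF bM(3)]) linarith
    ultimately show ?thesis by (simp add: algebra_simps)
  qed
  then have "\<tau> * ?r \<le> \<tau> * (4 * M * (2 * N + 1))" using \<tau> by simp
  \<comment> \<open>The tilt lowers the squared gradient by at most \<open>4 * \<tau> * N\<close>;
    passing from \<open>g\<close> to \<open>f\<close> only helps.\<close>
  moreover have "(1 + e1\<^sup>2 + e2\<^sup>2) * g - \<tau> * (4 * N * \<Phi>) \<le> (1 + a1\<^sup>2 + a2\<^sup>2) * f"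
  proof -
    have "a1\<^sup>2 + a2\<^sup>2 = e1\<^sup>2 + e2\<^sup>2 - 2 * \<tau> * (co * e1 + si * e2) + \<tau>\<^sup>2"
      using R unfolding a by algebra
    moreover have "co * e1 \<le> N" "si * e2 \<le> N"
      using mult_mono [OF cs(1) e(1)] mult_mono [OF cs(2) e(2)] N by (simp_all flip: abs_mult)
    then have "2 * \<tau> * (co * e1 + si * e2) \<le> 2 * \<tau> * (2 * N)"
      using \<tau> by (intro mult_left_mono) auto
    moreover have "\<tau>\<^sup>2 \<ge> 0" "2 * \<tau> * (2 * N) = 4 * \<tau> * N" by simp_all
    ultimately have "1 + e1\<^sup>2 + e2\<^sup>2 - 4 * \<tau> * N \<le> 1 + a1\<^sup>2 + a2\<^sup>2"
      by linarith
    then have "(1 + e1\<^sup>2 + e2\<^sup>2 - 4 * \<tau> * N) * g \<le> (1 + a1\<^sup>2 + a2\<^sup>2) * g"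
      using fg by (intro mult_right_mono)
    also have "\<dots> \<le> (1 + a1\<^sup>2 + a2\<^sup>2) * f"
      using fg by (intro mult_left_mono) auto
    finally have "(1 + e1\<^sup>2 + e2\<^sup>2) * g - 4 * \<tau> * N * g \<le> (1 + a1\<^sup>2 + a2\<^sup>2) * f"
      by (simp add: algebra_simps)
    moreover have "4 * \<tau> * N * g \<le> 4 * \<tau> * N * \<Phi>"
      using \<tau> N fg by (intro mult_left_mono) auto
    ultimately show ?thesis by (simp add: algebra_simps)
  qed
  moreover have "\<tau> * K * 1 \<le> \<tau> * K * (1 + a2\<^sup>2)"
    using \<tau> \<open>K \<ge> 0\<close> by (intro mult_left_mono) auto
  ultimately have "\<tau> * K \<le> \<tau> * (4 * N * \<Phi>) + \<tau> * (4 * M * (2 * N + 1))"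
    by linarith
  then have "\<tau> * K \<le> \<tau> * (4 * N * \<Phi> + 4 * M * (2 * N + 1))" by (simp add: algebra_simps)
  then show ?thesis using \<tau> unfolding M_def by simp
qed

lemma vec_component_derivative:
  fixes f :: "real \<Rightarrow> real^3"
  assumes "(f has_vector_derivative f') F"
  shows "((\<lambda>s. f s $ i) has_real_derivative f' $ i) F"
  using bounded_linear.has_vector_derivative [OF bounded_linear_vec_nth assms]
  by (simp add: has_real_derivative_iff_has_vector_derivative)

text \<open>The pair \<open>(co, si)\<close> is a rotation of the horizontal plane. The quadratic
  term penalizes \<open>Q\<close> for not lying over the rotated point, and the exponential supplies
  strict convexity in the first coordinate of \<open>P\<close>.\<close>

definition penalized :: "real \<Rightarrow> real \<Rightarrow> real \<Rightarrow> real \<Rightarrow> real \<Rightarrow> real^3 \<Rightarrow> real^3 \<Rightarrow> real" where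
  "penalized co si \<kappa> \<delta> K P Q = P $ 3 - Q $ 3
     - \<kappa> / 2 * ((co * P $ 1 - si * P $ 2 - Q $ 1)\<^sup>2 + (si * P $ 1 + co * P $ 2 - Q $ 2)\<^sup>2)
     + \<delta> * exp (K * P $ 1)"

text \<open>First and second derivative test along two independent curves. Here \<open>n1\<close> is
  the gradient of the test function in \<open>P\<close> and \<open>- n2\<close> its gradient in
  \<open>Q\<close>; \<tau> is the slope of the exponential term.\<close>

lemma penalized_variation:
  fixes x y :: "real \<Rightarrow> real^3"
  assumes "e > 0"
    and x: "\<And>s. \<bar>s\<bar> < e \<Longrightarrow> (x has_vector_derivative x' s) (at s)" "(x' has_vector_derivative x'') (at 0)"
    and y: "\<And>s. \<bar>s\<bar> < e \<Longrightarrow> (y has_vector_derivative y' s) (at s)" "(y' has_vector_derivative y'') (at 0)"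
    and max: "\<And>s. \<bar>s\<bar> < e \<Longrightarrow> penalized co si \<kappa> \<delta> K (x s) (y s) \<le> penalized co si \<kappa> \<delta> K (x 0) (y 0)"
    and e1: "e1 = \<kappa> * (co * x 0 $ 1 - si * x 0 $ 2 - y 0 $ 1)"
    and e2: "e2 = \<kappa> * (si * x 0 $ 1 + co * x 0 $ 2 - y 0 $ 2)"
    and \<tau>: "\<tau> = \<delta> * K * exp (K * x 0 $ 1)"
    and n1: "n1 = vector [- (co * e1 + si * e2 - \<tau>), - (- si * e1 + co * e2), 1]" and n2: "n2 = vector [- e1, - e2, 1]"
  shows "n1 \<bullet> x' 0 = n2 \<bullet> y' 0"
    and "n1 \<bullet> x'' + \<tau> * K * (x' 0 $ 1)\<^sup>2 \<le> n2 \<bullet> y'' +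
      \<kappa> * ((co * x' 0 $ 1 - si * x' 0 $ 2 - y' 0 $ 1)\<^sup>2 + (si * x' 0 $ 1 + co * x' 0 $ 2 - y' 0 $ 2)\<^sup>2)"
proof -
  note dx = vec_component_derivative [OF x(1)] vec_component_derivative [OF y(1)]
  note dx' = vec_component_derivative [OF x(2)] vec_component_derivative [OF y(2)]
  have e0: "\<bar>0::real\<bar> < e" using \<open>e > 0\<close> by simp
  define G where "G s = penalized co si \<kappa> \<delta> K (x s) (y s)" for s
  define d1 where "d1 s = co * x s $ 1 - si * x s $ 2 - y s $ 1" for s
  define d2 where "d2 s = si * x s $ 1 + co * x s $ 2 - y s $ 2" for s
  define d1' where "d1' s = co * x' s $ 1 - si * x' s $ 2 - y' s $ 1" for s
  define d2' where "d2' s = si * x' s $ 1 + co * x' s $ 2 - y' s $ 2" for s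
  define d1'' where "d1'' = co * x'' $ 1 - si * x'' $ 2 - y'' $ 1"
  define d2'' where "d2'' = si * x'' $ 1 + co * x'' $ 2 - y'' $ 2"
  define G' where "G' s = x' s $ 3 - y' s $ 3 - \<kappa> * (d1 s * d1' s + d2 s * d2' s)
    + \<delta> * K * (exp (K * x s $ 1) * x' s $ 1)" for s
  define G'' where "G'' = x'' $ 3 - y'' $ 3
     - \<kappa> * ((d1' 0 * d1' 0 + d1 0 * d1'') + (d2' 0 * d2' 0 + d2 0 * d2''))
     + \<delta> * K * (exp (K * x 0 $ 1) * x'' $ 1 + exp (K * x 0 $ 1) * (K * x' 0 $ 1) * x' 0 $ 1)"
  have dd: "(d1 has_real_derivative d1' s) (at s)" "(d2 has_real_derivative d2' s) (at s)" if "\<bar>s\<bar> < e" for s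
    unfolding d1_def [abs_def] d2_def [abs_def] d1'_def d2'_def
    by (intro DERIV_diff DERIV_add DERIV_cmult dx that)+
  have dd': "(d1' has_real_derivative d1'') (at 0)" "(d2' has_real_derivative d2'') (at 0)"
    unfolding d1''_def d2''_def d1'_def [abs_def] d2'_def [abs_def]
    by (intro DERIV_diff DERIV_add DERIV_cmult dx')+
  have 1: "(G has_real_derivative G' s) (at s)" if "\<bar>s\<bar> < e" for s
    unfolding G_def [abs_def] penalized_def d1_def [symmetric] d2_def [symmetric] G'_def
    by (rule derivative_eq_intros dx dd that refl)+ (simp add: algebra_simps)
  have 2: "(G' has_real_derivative G'') (at 0)"
    unfolding G'_def [abs_def] G''_def
    by (rule derivative_eq_intros dx dd dx' dd' e0 refl)+ (simp add: algebra_simps)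
  note * = second_derivative_test [OF \<open>e > 0\<close> 1 2]
  have "G' 0 = 0" "G'' \<le> 0"
    using * max by (simp_all add: G_def)
  moreover have "n1 \<bullet> x' 0 - n2 \<bullet> y' 0 = G' 0"
    unfolding n1 n2 G'_def d1'_def d2'_def d1_def d2_def e1 e2 \<tau>
    by (simp add: inner_vec_def sum_3) algebra
  ultimately show "n1 \<bullet> x' 0 = n2 \<bullet> y' 0" by simp
  have "n1 \<bullet> x'' + \<tau> * K * (x' 0 $ 1)\<^sup>2 - (n2 \<bullet> y'' + \<kappa> * ((d1' 0)\<^sup>2 + (d2' 0)\<^sup>2)) = G''
     + 2 * 0"
    unfolding n1 n2 G''_def d1''_def d2''_def d1_def d2_def e1 e2 \<tau>
    by (simp add: inner_vec_def sum_3) algebra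
  with \<open>G'' \<le> 0\<close> show "n1 \<bullet> x'' + \<tau> * K * (x' 0 $ 1)\<^sup>2 \<le> n2 \<bullet> y'' +
      \<kappa> * ((co * x' 0 $ 1 - si * x' 0 $ 2 - y' 0 $ 1)\<^sup>2 + (si * x' 0 $ 1 + co * x' 0 $ 2 - y' 0 $ 2)\<^sup>2)"
    unfolding d1'_def d2'_def by linarith
qed

text \<open>The right-hand side contains neither \<open>K\<close> nor \<delta>, so at an interior
  maximum the perturbation cannot be arbitrarily steep. Chart lines serve as variations of the two
  points.\<close>

lemma comparison_at_maximum:
  assumes min: "phi_minimal \<phi> S" and emb: "embedded_surface S" and PQ: "P \<in> S" "Q \<in> S" and e: "e > 0"
    and max: "\<And>P' Q'. P' \<in> S \<Longrightarrow> Q' \<in> S \<Longrightarrow> dist P' P < e \<Longrightarrow> dist Q' Q < e \<Longrightarrow>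
      penalized co si \<kappa> \<delta> K P' Q' \<le> penalized co si \<kappa> \<delta> K P Q"
    and R: "co\<^sup>2 + si\<^sup>2 = 1"
    and fg: "0 \<le> deriv \<phi> (Q $ 3)" "deriv \<phi> (Q $ 3) \<le> deriv \<phi> (P $ 3)" "deriv \<phi> (Q $ 3) \<le> \<Phi>"
    and N: "\<bar>\<kappa> * (co * P $ 1 - si * P $ 2 - Q $ 1)\<bar> \<le> N" "\<bar>\<kappa> * (si * P $ 1 + co * P $ 2 - Q $ 2)\<bar> \<le> N"
    and \<tau>: "\<delta> > 0" "K > 0" "\<delta> * K * exp (K * P $ 1) \<le> 1" and "\<kappa> \<ge> 0"
  shows "K \<le> 4 * N * \<Phi> + 4 * ((1 + 2 * N\<^sup>2) * \<Phi> + 2 * N\<^sup>2 * \<kappa> + 2 * \<kappa>) * (2 * N + 1)"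
proof -
  obtain U X q where X: "local_parametrization S U X" and q: "q \<in> U" "X q = P"
    using emb PQ by (force simp: embedded_surface_def)
  obtain V Y k where Y: "local_parametrization S V Y" and k: "k \<in> V" "Y k = Q"
    using emb PQ by (force simp: embedded_surface_def)
  define e1 where "e1 = \<kappa> * (co * P $ 1 - si * P $ 2 - Q $ 1)"
  define e2 where "e2 = \<kappa> * (si * P $ 1 + co * P $ 2 - Q $ 2)"
  define \<tau> where "\<tau> = \<delta> * K * exp (K * P $ 1)"
  define a1 where "a1 = co * e1 + si * e2 - \<tau>"
  define a2 where "a2 = - si * e1 + co * e2"
  let ?n1 = "vector [- a1, - a2, 1] :: real^3" and ?n2 = "vector [- e1, - e2, 1] :: real^3"
  have near: "\<exists>d>0. \<forall>s. \<bar>s\<bar> < d \<longrightarrow> q + s *\<^sub>R v \<in> U \<and> X (q + s *\<^sub>R v) \<in> S \<and> dist (X (q + s *\<^sub>R v)) (X q) < e"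
    if X: "local_parametrization S U X" and q: "q \<in> U" for U X q v
  proof -
    have U: "open U" "continuous_on U X" "X ` U \<subseteq> S"
      using local_parametrizationD [OF X] by auto
    have lim: "((\<lambda>s. q + s *\<^sub>R v) \<longlongrightarrow> q + 0 *\<^sub>R v) (nhds 0)"
      by (intro tendsto_intros filterlim_ident)
    then have "\<forall>\<^sub>F s in nhds 0. q + s *\<^sub>R v \<in> U"
      using topological_tendstoD [OF _ U(1)] q by simp
    moreover have "isCont X q"
      using U q by (simp add: continuous_on_eq_continuous_at)
    then have "((\<lambda>s. X (q + s *\<^sub>R v)) \<longlongrightarrow> X q) (nhds 0)"
      using lim isCont_tendsto_compose by fastforce
    then have "\<forall>\<^sub>F s in nhds 0. dist (X (q + s *\<^sub>R v)) (X q) < e"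
      using e by (rule tendstoD)
    ultimately have "\<forall>\<^sub>F s in nhds 0. q + s *\<^sub>R v \<in> U \<and> X (q + s *\<^sub>R v) \<in> S \<and> dist (X (q + s *\<^sub>R v)) (X q) < e"
      by eventually_elim (use U in auto)
    then show ?thesis by (auto simp: eventually_nhds_metric dist_real_def)
  qed
  have var: "?n1 \<bullet> dX X q v = ?n2 \<bullet> dX Y k w \<and>
      ?n1 \<bullet> ddX X q v v + \<tau> * K * (dX X q v $ 1)\<^sup>2 \<le> ?n2 \<bullet> ddX Y k w w +
      \<kappa> * ((co * dX X q v $ 1 - si * dX X q v $ 2 - dX Y k w $ 1)\<^sup>2
         + (si * dX X q v $ 1 + co * dX X q v $ 2 - dX Y k w $ 2)\<^sup>2)" for v w
  proof -
    obtain d where d: "d > 0" "\<And>s. \<bar>s\<bar> < d \<Longrightarrow> q + s *\<^sub>R v \<in> U \<and> X (q + s *\<^sub>R v) \<in> S \<and> dist (X (q + s *\<^sub>R v)) (X q) < e"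
      using near [OF X q(1)] by blast
    obtain d' where d': "d' > 0" "\<And>s. \<bar>s\<bar> < d' \<Longrightarrow> k + s *\<^sub>R w \<in> V \<and> Y (k + s *\<^sub>R w) \<in> S \<and> dist (Y (k + s *\<^sub>R w)) (Y k) < e"
      using near [OF Y k(1)] by blast
    have sm: "smooth_on U X" "smooth_on V Y" using X Y by (auto simp: local_parametrization_def)
    have dd: "((\<lambda>s. dX X (q + s *\<^sub>R v) v) has_vector_derivative ddX X q v v) (at 0)"
      "((\<lambda>s. dX Y (k + s *\<^sub>R w) w) has_vector_derivative ddX Y k w w) (at 0)"
      using chart_curve(2) [OF sm(1), of q 0 v] chart_curve(2) [OF sm(2), of k 0 w] q k by simp_all
    have mx: "penalized co si \<kappa> \<delta> K (X (q + s *\<^sub>R v)) (Y (k + s *\<^sub>R w))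
        \<le> penalized co si \<kappa> \<delta> K (X (q + 0 *\<^sub>R v)) (Y (k + 0 *\<^sub>R w))" if "\<bar>s\<bar> < min d d'" for s
      using max d(2) [of s] d'(2) [of s] that q k by simp
    have D: "((\<lambda>s. X (q + s *\<^sub>R v)) has_vector_derivative dX X (q + s *\<^sub>R v) v) (at s)"
      "((\<lambda>s. Y (k + s *\<^sub>R w)) has_vector_derivative dX Y (k + s *\<^sub>R w) w) (at s)" if "\<bar>s\<bar> < min d d'" for s
      using that d(2) d'(2) by (auto intro!: chart_curve(1) sm)
    show ?thesis
      using penalized_variation [of "min d d'", OF _ D(1) dd(1) D(2) dd(2) mx, of e1 e2 \<tau> ?n1 ?n2] d(1) d'(1)
      by (simp add: q k e1_def e2_def \<tau>_def a1_def a2_def)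
  qed
  have dX0: "dX X q 0 = 0" "dX Y k 0 = 0" "ddX X q 0 0 = 0" "ddX Y k 0 0 = 0"
    by (simp_all add: dX_def ddX_def)
  \<comment> \<open>Keeping the other point at rest separates the first-order condition into two:
    each gradient is normal to the surface, and its third component 1 rules out a vertical tangent
    plane.\<close>
  have nX: "?n1 \<bullet> dX X q v = 0" for v using var [of v 0] by (simp add: dX0)
  have nY: "?n2 \<bullet> dX Y k w = 0" for w using var [of 0 w] by (simp add: dX0)
  obtain W c11 c12 c22 where c: "\<And>h k. dX X q (W h k) = vector [h, k, a1 * h + a2 * k]"
    "\<And>h k. ?n1 \<bullet> ddX X q (W h k) (W h k) = c11 * h\<^sup>2 + 2 * c12 * h * k + c22 * k\<^sup>2"
    "(1 + a2\<^sup>2) * c11 - 2 * a1 * a2 * c12 + (1 + a1\<^sup>2) * c22 = (1 + a1\<^sup>2 + a2\<^sup>2) * deriv \<phi> (X q $ 3)"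
    by (rule graph_jet [OF min X q(1) nX]) blast
  obtain W' b11 b12 b22 where b: "\<And>h l. dX Y k (W' h l) = vector [h, l, e1 * h + e2 * l]"
    "\<And>h l. ?n2 \<bullet> ddX Y k (W' h l) (W' h l) = b11 * h\<^sup>2 + 2 * b12 * h * l + b22 * l\<^sup>2"
    "(1 + e2\<^sup>2) * b11 - 2 * e1 * e2 * b12 + (1 + e1\<^sup>2) * b22 = (1 + e1\<^sup>2 + e2\<^sup>2) * deriv \<phi> (Y k $ 3)"
    by (rule graph_jet [OF min Y k(1) nY]) blast
  show ?thesis
  proof (rule comparison_algebra [OF R a1_def a2_def b(3) c(3)])
    \<comment> \<open>With \<open>P\<close> at rest only the penalty acts against the motion of
      \<open>Q\<close>, whence the lower bound by \<kappa>.\<close>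
    show "- (b11 * h\<^sup>2 + 2 * b12 * h * l + b22 * l\<^sup>2) \<le> \<kappa> * (h\<^sup>2 + l\<^sup>2)" for h l
      using var [of 0 "W' h l"] by (simp add: dX0 b algebra_simps)
    \<comment> \<open>Moving \<open>Q\<close> by the rotated horizontal displacement of
      \<open>P\<close> makes the penalty contribution in \<open>var\<close> vanish.\<close>
    show "c11 * h\<^sup>2 + 2 * c12 * h * l + c22 * l\<^sup>2 + \<tau> * K * h\<^sup>2 \<le>
       b11 * (co * h - si * l)\<^sup>2 + 2 * b12 * (co * h - si * l) * (si * h + co * l) + b22 * (si * h + co * l)\<^sup>2" for h l
      using var [of "W h l" "W' (co * h - si * l) (si * h + co * l)"] by (simp add: b c)
  qed (use fg N \<tau> \<open>\<kappa> \<ge> 0\<close> q k in \<open>auto simp: \<tau>_def e1_def e2_def\<close>)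
qed

section \<open>Rotations and the interior maximum of the penalized height difference\<close>

lemma norm_hproj: "(norm (hproj P))\<^sup>2 = (P $ 1)\<^sup>2 + (P $ 2)\<^sup>2"
  unfolding power2_norm_eq_inner by (simp add: hproj_def inner_vec_def sum_2 power2_eq_square)

lemma linear_hproj: "linear hproj"
  by (auto intro!: linearI simp: hproj_def vec_eq_iff forall_2)

lemma norm_hproj_le: "norm (hproj P) \<le> norm P"
proof -
  have "(norm (hproj P))\<^sup>2 \<le> (norm P)\<^sup>2"
    unfolding norm_hproj by (subst power2_norm_eq_inner) (simp add: inner_vec_def sum_3 power2_eq_square)
  then show ?thesis by (rule power2_le_imp_le) simp
qed

lemma continuous_on_hproj [continuous_intros]:
  "continuous_on A f \<Longrightarrow> continuous_on A (\<lambda>x. hproj (f x))"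
  using continuous_on_compose2 [OF linear_continuous_on [of hproj UNIV]] linear_hproj
  by (simp add: linear_conv_bounded_linear)

lemma hproj_nth [simp]: "hproj P $ 1 = P $ 1" "hproj P $ 2 = P $ 2"
  by (simp_all add: hproj_def)

lemma rotation_between:
  fixes p1 p2 q1 q2 :: real
  assumes "p1\<^sup>2 + p2\<^sup>2 = q1\<^sup>2 + q2\<^sup>2"
  obtains co si where "co\<^sup>2 + si\<^sup>2 = 1" "co * p1 - si * p2 = q1" "si * p1 + co * p2 = q2"
proof (cases "p1\<^sup>2 + p2\<^sup>2 = 0")
  case True
  then have "p1 = 0" "p2 = 0" "q1 = 0" "q2 = 0" using assms by (simp_all add: sum_power2_eq_zero_iff)
  then show thesis using that [of 1 0] by simp
next
  case False
  let ?d = "p1\<^sup>2 + p2\<^sup>2"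
  \<comment> \<open>Real and imaginary part of the complex quotient
    \<open>(q1 + i q2) / (p1 + i p2)\<close>.\<close>
  define co si where "co = (p1 * q1 + p2 * q2) / ?d" and "si = (p1 * q2 - p2 * q1) / ?d"
  have c: "co * ?d = p1 * q1 + p2 * q2" "si * ?d = p1 * q2 - p2 * q1"
    using False by (simp_all add: co_def si_def)
  have "(co\<^sup>2 + si\<^sup>2) * (?d * ?d) = (co * ?d)\<^sup>2 + (si * ?d)\<^sup>2" by algebra
  also have "\<dots> = ?d * ?d" unfolding c assms [symmetric] using assms by algebra
  finally have "co\<^sup>2 + si\<^sup>2 = 1" using False by (metis mult_cancel_right2 no_zero_divisors)
  moreover have "(co * p1 - si * p2) * ?d = (co * ?d) * p1 - (si * ?d) * p2" by algebra
  then have "(co * p1 - si * p2) * ?d = q1 * ?d" unfolding c by (simp add: algebra_simps power2_eq_square)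
  then have "co * p1 - si * p2 = q1" using False by (metis mult_cancel_right)
  moreover have "(si * p1 + co * p2) * ?d = (si * ?d) * p1 + (co * ?d) * p2" by algebra
  then have "(si * p1 + co * p2) * ?d = q2 * ?d" unfolding c by (simp add: algebra_simps power2_eq_square)
  then have "si * p1 + co * p2 = q2" using False by (metis mult_cancel_right)
  ultimately show thesis using that by blast
qed

text \<open>The penalty \<open>\<kappa>\<close> is fixed first, then \<open>K\<close>, then \<open>\<delta>\<close>.\<close>

lemma rotational_comparison:
  assumes min: "phi_minimal \<phi> S" and emb: "embedded_surface S" and "closed S"
    and nonneg: "\<And>P. P \<in> S \<Longrightarrow> 0 \<le> deriv \<phi> (P $ 3)"
    and mono: "\<And>P Q. P \<in> S \<Longrightarrow> Q \<in> S \<Longrightarrow> Q $ 3 \<le> P $ 3 \<Longrightarrow> deriv \<phi> (Q $ 3) \<le> deriv \<phi> (P $ 3)"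
    and bdd: "\<And>\<rho>. bounded {P \<in> S. norm (hproj P) \<le> \<rho>}"
    and asym: "\<And>m. m > 0 \<Longrightarrow> \<exists>\<rho>. \<forall>P\<in>S. \<forall>Q\<in>S. norm (hproj P) = norm (hproj Q) \<and> \<rho> \<le> norm (hproj P) \<longrightarrow> P $ 3 - Q $ 3 < m"
    and P0: "P0 \<in> S" and Q0: "Q0 \<in> S" and eq: "norm (hproj P0) = norm (hproj Q0)"
  shows "P0 $ 3 \<le> Q0 $ 3"
proof (rule ccontr)
  assume "\<not> P0 $ 3 \<le> Q0 $ 3"
  define m where "m = P0 $ 3 - Q0 $ 3"
  have m: "m > 0" using \<open>\<not> _\<close> by (simp add: m_def)
  obtain \<rho>' where \<rho>': "\<And>P Q. P \<in> S \<Longrightarrow> Q \<in> S \<Longrightarrow> norm (hproj P) = norm (hproj Q) \<Longrightarrow> \<rho>' \<le> norm (hproj P) \<Longrightarrow> P $ 3 - Q $ 3 < m / 2"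
    using asym [of "m / 2"] m by (meson half_gt_zero)
  define \<rho> where "\<rho> = max \<rho>' 1"
  have \<rho>: "P $ 3 - Q $ 3 < m / 2" if "P \<in> S" "Q \<in> S" "norm (hproj P) = norm (hproj Q)" "\<rho> \<le> norm (hproj P)" for P Q
    using \<rho>' that by (auto simp: \<rho>_def)
  have P0\<rho>: "norm (hproj P0) < \<rho>"
    using \<rho> [OF P0 Q0 eq] m by (fastforce simp: m_def)
  obtain co si where R: "co\<^sup>2 + si\<^sup>2 = 1" "co * P0 $ 1 - si * P0 $ 2 = Q0 $ 1" "si * P0 $ 1 + co * P0 $ 2 = Q0 $ 2"
    using rotation_between [of "P0 $ 1" "P0 $ 2" "Q0 $ 1" "Q0 $ 2"] eq by (metis norm_hproj)
  \<comment> \<open>\<open>Q\<close> ranges over a disk larger by 1, so that a pair with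
    \<open>Q\<close> on the outer boundary can never lie over points matched by the
    rotation.\<close>
  define A where "A = {P \<in> S. norm (hproj P) \<le> \<rho>}"
  define B where "B = {P \<in> S. norm (hproj P) \<le> \<rho> + 1}"
  have cpt: "compact {P \<in> S. norm (hproj P) \<le> r}" for r
  proof -
    have "closed {P. norm (hproj P) \<le> r}"
      by (intro closed_Collect_le continuous_intros)
    then have "closed (S \<inter> {P. norm (hproj P) \<le> r})" using \<open>closed S\<close> by blast
    then show ?thesis using bdd [of r] by (simp add: compact_eq_bounded_closed Collect_conj_eq)
  qed
  have AB: "compact A" "compact B" "A \<subseteq> B" by (auto simp: A_def B_def cpt)
  have "compact (A \<times> B)" using AB by (intro compact_Times)
  define D where "D PQ = (co * fst PQ $ 1 - si * fst PQ $ 2 - snd PQ $ 1)\<^sup>2 + (si * fst PQ $ 1 + co * fst PQ $ 2 - snd PQ $ 2)\<^sup>2" for PQ :: "(real^3) \<times> (real^3)"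
  have Dc: "continuous_on T D" for T unfolding D_def by (intro continuous_intros)
  \<comment> \<open>The boundary pairs that could compete with the maximum. A matched pair among
    them would lie over the circle of radius \<rho>, where the excess is below \<open>m / 2\<close>;
    hence \<open>D\<close> is positive on this compact set and has a positive lower bound
    \<mu>.\<close>
  define T where "T = (A \<times> B) \<inter> ({PQ. norm (hproj (fst PQ)) = \<rho>} \<union> {PQ. norm (hproj (snd PQ)) = \<rho> + 1}) \<inter> {PQ. m / 2 \<le> fst PQ $ 3 - snd PQ $ 3}"
  have "compact T"
    unfolding T_def using \<open>compact (A \<times> B)\<close>
    by (intro compact_Int_closed closed_Un closed_Collect_eq closed_Collect_le continuous_intros)
  have Dpos: "D PQ > 0" if "PQ \<in> T" for PQ
  proof (rule ccontr)
    assume "\<not> D PQ > 0"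
    obtain P Q where [simp]: "PQ = (P, Q)" by (cases PQ)
    have "D PQ \<ge> 0" by (simp add: D_def)
    then have "D PQ = 0" using \<open>\<not> D PQ > 0\<close> by linarith
    then have "co * P $ 1 - si * P $ 2 = Q $ 1" "si * P $ 1 + co * P $ 2 = Q $ 2"
      by (auto simp: D_def sum_power2_eq_zero_iff)
    moreover have "(co * P $ 1 - si * P $ 2)\<^sup>2 + (si * P $ 1 + co * P $ 2)\<^sup>2
        = (co\<^sup>2 + si\<^sup>2) * ((P $ 1)\<^sup>2 + (P $ 2)\<^sup>2)" by algebra
    ultimately have "(P $ 1)\<^sup>2 + (P $ 2)\<^sup>2 = (Q $ 1)\<^sup>2 + (Q $ 2)\<^sup>2" using R(1) by simp
    then have n: "norm (hproj P) = norm (hproj Q)" by (metis norm_hproj norm_ge_zero power2_eq_imp_eq)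
    with that have "\<rho> \<le> norm (hproj P)" by (auto simp: T_def A_def B_def)
    then show False using \<rho> [of P Q] n that by (auto simp: T_def A_def B_def)
  qed
  obtain \<mu> where \<mu>: "\<mu> > 0" "\<And>PQ. PQ \<in> T \<Longrightarrow> \<mu> \<le> D PQ"
  proof (cases "T = {}")
    case True then show thesis using that [of 1] by simp
  next
    case False
    obtain x where "x \<in> T" "\<And>y. y \<in> T \<Longrightarrow> D x \<le> D y"
      using continuous_attains_inf [OF \<open>compact T\<close> False Dc] by blast
    then show thesis using that [of "D x"] Dpos by blast
  qed
  have "bounded B" using AB by (simp add: compact_imp_bounded)
  then obtain Z where Z: "Z > 0" "\<And>P. P \<in> B \<Longrightarrow> norm P \<le> Z" by (auto simp: bounded_pos)
  have Z3: "\<bar>P $ 3\<bar> \<le> Z" if "P \<in> B" for P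
    using Z(2) [OF that] component_le_norm_cart [of P 3] by linarith
  \<comment> \<open>With this value the penalty on \<open>T\<close> is at least
    \<open>2 * Z\<close>, which no height difference within \<open>B\<close> exceeds.\<close>
  define \<kappa> where "\<kappa> = 4 * Z / \<mu>"
  have \<kappa>: "\<kappa> \<ge> 0" "\<kappa> / 2 * \<mu> = 2 * Z" using Z \<mu> by (simp_all add: \<kappa>_def)
  have bd: "bounded ((\<lambda>PQ. (\<kappa> * (co * fst PQ $ 1 - si * fst PQ $ 2 - snd PQ $ 1), \<kappa> * (si * fst PQ $ 1 + co * fst PQ $ 2 - snd PQ $ 2))) ` (A \<times> B))"
    by (intro compact_imp_bounded compact_continuous_image \<open>compact (A \<times> B)\<close> continuous_intros)
  then obtain N where N0: "\<And>x. x \<in> (\<lambda>PQ. (\<kappa> * (co * fst PQ $ 1 - si * fst PQ $ 2 - snd PQ $ 1),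
      \<kappa> * (si * fst PQ $ 1 + co * fst PQ $ 2 - snd PQ $ 2))) ` (A \<times> B) \<Longrightarrow> norm x \<le> N"
    unfolding bounded_iff by blast
  have N: "\<bar>\<kappa> * (co * P $ 1 - si * P $ 2 - Q $ 1)\<bar> \<le> N" "\<bar>\<kappa> * (si * P $ 1 + co * P $ 2 - Q $ 2)\<bar> \<le> N"
    if "P \<in> A" "Q \<in> B" for P Q
  proof -
    let ?x = "(\<kappa> * (co * P $ 1 - si * P $ 2 - Q $ 1), \<kappa> * (si * P $ 1 + co * P $ 2 - Q $ 2))"
    have "norm ?x \<le> N"
      by (rule N0, rule image_eqI [of _ _ "(P, Q)"]) (use that in simp_all)
    moreover have "norm (fst ?x) \<le> norm ?x" "norm (snd ?x) \<le> norm ?x"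
      by (simp_all only: fst_conv snd_conv norm_fst_le norm_snd_le)
    ultimately show "\<bar>\<kappa> * (co * P $ 1 - si * P $ 2 - Q $ 1)\<bar> \<le> N" "\<bar>\<kappa> * (si * P $ 1 + co * P $ 2 - Q $ 2)\<bar> \<le> N"
      by simp_all
  qed
  have P0A: "P0 \<in> A" using P0 P0\<rho> by (simp add: A_def)
  have Q0B: "Q0 \<in> B" using Q0 P0\<rho> eq by (simp add: B_def)
  have "continuous_on B (\<lambda>P. P $ 3)" by (intro continuous_intros)
  then obtain Qm where Qm: "Qm \<in> B" "\<And>Q. Q \<in> B \<Longrightarrow> Q $ 3 \<le> Qm $ 3"
    using continuous_attains_sup [OF AB(2)] Q0B by blast
  define \<Phi> where "\<Phi> = deriv \<phi> (Qm $ 3)"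
  have \<Phi>: "deriv \<phi> (Q $ 3) \<le> \<Phi>" if "Q \<in> B" for Q
    using mono [of Qm Q] Qm that by (auto simp: \<Phi>_def B_def)
  \<comment> \<open>Depends on \<kappa>, \<open>N\<close> and \<Phi> only, all of them already
    fixed, so \<open>K\<close> may be taken larger.\<close>
  define C where "C = 4 * N * \<Phi> + 4 * ((1 + 2 * N\<^sup>2) * \<Phi> + 2 * N\<^sup>2 * \<kappa> + 2 * \<kappa>) * (2 * N + 1)"
  define K where "K = \<bar>C\<bar> + 1"
  have K: "K > 0" "C < K" by (auto simp: K_def)
  \<comment> \<open>On \<open>A\<close> the first coordinate is at most \<rho>; this choice keeps
    the perturbation below \<open>m / 4\<close> and its slope below 1 there.\<close>
  define \<delta> where "\<delta> = min (m / 4) (1 / K) * exp (- K * \<rho>)"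
  have \<delta>: "\<delta> > 0" using m K by (simp add: \<delta>_def)
  have small: "\<delta> * exp (K * P $ 1) \<le> m / 4" "\<delta> * K * exp (K * P $ 1) \<le> 1" if "P \<in> A" for P
  proof -
    have "P $ 1 \<le> \<rho>"
      using that component_le_norm_cart [of "hproj P" 1] abs_ge_self [of "P $ 1"] by (simp add: A_def)
    then have "exp (K * P $ 1) \<le> exp (K * \<rho>)" using K by simp
    then have "\<delta> * exp (K * P $ 1) \<le> \<delta> * exp (K * \<rho>)" using \<delta> by simp
    also have "\<dots> = min (m / 4) (1 / K)" by (simp add: \<delta>_def exp_minus)
    finally have *: "\<delta> * exp (K * P $ 1) \<le> min (m / 4) (1 / K)" .
    then show "\<delta> * exp (K * P $ 1) \<le> m / 4" by simp
    have "K * (\<delta> * exp (K * P $ 1)) \<le> K * (1 / K)" using * K by (intro mult_left_mono) auto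
    then show "\<delta> * K * exp (K * P $ 1) \<le> 1" using K by (simp add: algebra_simps)
  qed
  let ?F = "penalized co si \<kappa> \<delta> K"
  have F: "?F P Q = P $ 3 - Q $ 3 - \<kappa> / 2 * D (P, Q) + \<delta> * exp (K * P $ 1)" for P Q
    by (simp add: penalized_def D_def)
  have D0: "D PQ \<ge> 0" for PQ by (simp add: D_def)
  have "continuous_on (A \<times> B) (\<lambda>PQ. ?F (fst PQ) (snd PQ))"
    unfolding penalized_def by (intro continuous_intros)
  then obtain P Q where PQ: "P \<in> A" "Q \<in> B" "\<And>P' Q'. P' \<in> A \<Longrightarrow> Q' \<in> B \<Longrightarrow> ?F P' Q' \<le> ?F P Q"
    using continuous_attains_sup [OF \<open>compact (A \<times> B)\<close>, of "\<lambda>PQ. ?F (fst PQ) (snd PQ)"] P0A Q0B by fastforce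
  have "D (P0, Q0) = 0" using R by (simp add: D_def)
  then have "m \<le> ?F P0 Q0" using \<delta> by (simp add: F m_def)
  also have "\<dots> \<le> ?F P Q" using PQ P0A Q0B by blast
  finally have Fm: "m \<le> ?F P Q" .
  have \<kappa>D: "\<kappa> / 2 * D PQ \<ge> 0" for PQ using \<kappa> D0 by simp
  \<comment> \<open>On the boundary the penalized value is at most \<open>m / 2 + m / 4\<close>,
    whereas the maximum is at least the value \<open>m\<close> attained by the matched pair
    \<open>P0\<close>, \<open>Q0\<close>.\<close>
  have int: "norm (hproj P) < \<rho> \<and> norm (hproj Q) < \<rho> + 1"
  proof (rule ccontr)
    assume "\<not> ?thesis"
    then have bdry: "norm (hproj P) = \<rho> \<or> norm (hproj Q) = \<rho> + 1"
      using PQ(1,2) by (auto simp: A_def B_def)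
    have "P $ 3 - Q $ 3 - \<kappa> / 2 * D (P, Q) \<le> m / 2"
    proof (cases "P $ 3 - Q $ 3 < m / 2")
      case True then show ?thesis using \<kappa>D [of "(P, Q)"] by linarith
    next
      case False
      then have "(P, Q) \<in> T" using PQ bdry by (auto simp: T_def)
      then have "\<kappa> / 2 * \<mu> \<le> \<kappa> / 2 * D (P, Q)" using \<mu> \<kappa> by (intro mult_left_mono) auto
      moreover have "P \<in> B" using PQ AB by blast
      then have "P $ 3 - Q $ 3 \<le> 2 * Z" using Z3 [of P] Z3 [of Q] PQ by linarith
      ultimately show ?thesis using \<kappa> m by linarith
    qed
    then show False using Fm small [OF PQ(1)] m unfolding F by linarith
  qed
  have SPQ: "P \<in> S" "Q \<in> S" using PQ by (auto simp: A_def B_def)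
  have "P $ 3 - Q $ 3 > 0"
    using Fm small(1) [OF PQ(1)] m \<kappa>D [of "(P, Q)"] unfolding F by linarith
  then have PQ3: "deriv \<phi> (Q $ 3) \<le> deriv \<phi> (P $ 3)" using mono SPQ by simp
  define e where "e = min (\<rho> - norm (hproj P)) (\<rho> + 1 - norm (hproj Q))"
  have near: "norm (hproj P') \<le> norm (hproj P) + dist P' P" for P P'
  proof -
    have "norm (hproj P') \<le> norm (hproj P) + norm (hproj P' - hproj P)" by norm
    also have "hproj P' - hproj P = hproj (P' - P)" using linear_diff [OF linear_hproj] by simp
    finally show ?thesis using norm_hproj_le [of "P' - P"] by (simp add: dist_norm)
  qed
  have "K \<le> C"
    unfolding C_def
  proof (rule comparison_at_maximum [OF min emb SPQ, of e])
    show "e > 0" using int by (simp add: e_def)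
    show "?F P' Q' \<le> ?F P Q" if "P' \<in> S" "Q' \<in> S" "dist P' P < e" "dist Q' Q < e" for P' Q'
      using PQ(3) [of P' Q'] that near [of P' P] near [of Q' Q] by (simp add: A_def B_def e_def)
  qed (use R nonneg SPQ PQ3 \<Phi> PQ N \<delta> K small \<kappa> in auto)
  then show False using K by simp
qed

section \<open>The end of the surface\<close>

text \<open>A surface is locally connected: images of small parameter disks are connected and
  relatively open, so a component contains a neighbourhood of each of its points.\<close>

lemma component_open_in_surface:
  assumes emb: "embedded_surface S" and K: "closed K" and C: "C \<in> components (S - K)"
  shows "openin (top_of_set S) C"
proof (subst openin_subopen, intro ballI)
  fix p assume p: "p \<in> C"
  have CS: "C \<subseteq> S - K" using C by (rule in_components_subset)
  obtain U X q where X: "local_parametrization S U X" and q: "q \<in> U" "p = X q"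
    using emb p CS by (force simp: embedded_surface_def)
  note D = local_parametrizationD [OF X]
  obtain Y where hom: "homeomorphism U (X ` U) X Y"
    using X by (auto simp: local_parametrization_def)
  have "open (U \<inter> X -` (- K))"
    using D K by (intro continuous_open_preimage) auto
  moreover have "q \<in> U \<inter> X -` (- K)" using q p CS by auto
  ultimately obtain e where e: "e > 0" "ball q e \<subseteq> U \<inter> X -` (- K)"
    using open_contains_ball by blast
  let ?T = "X ` ball q e"
  have "connected ?T"
    using D(3) e by (intro connected_continuous_image) (auto intro: continuous_on_subset)
  moreover have "?T \<subseteq> S - K" using e D(4) by auto
  moreover have pT: "p \<in> ?T" using q e by auto
  ultimately have "?T \<subseteq> C" using components_maximal [OF C] p by blast
  moreover have "openin (top_of_set U) (ball q e)"
    using e by (intro open_subset) auto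
  then have "openin (top_of_set S) ?T"
    using homeomorphism_imp_open_map [OF hom] openin_trans D(5) by metis
  ultimately show "\<exists>T. openin (top_of_set S) T \<and> p \<in> T \<and> T \<subseteq> C" using pT by blast
qed

text \<open>An unbounded set could be a union of infinitely many bounded components. This is
  excluded because every component leaving a ball around \<open>K\<close> crosses its boundary
  sphere, and only finitely many can do so.\<close>

lemma unbounded_component_exists:
  assumes emb: "embedded_surface S" and conn: "connected S" and "closed S"
    and K: "compact K" "K \<subseteq> S" "K \<noteq> {}"
    and W: "openin (top_of_set (S - K)) W" "closedin (top_of_set (S - K)) W" "\<not> bounded W"
  obtains E where "E \<in> components (S - K)" "E \<subseteq> W" "\<not> bounded E"
proof (rule ccontr)
  note E_obtain = that
  assume nt: "\<not> thesis"
  have bdd: "bounded E" if E: "E \<in> components (S - K)" "E \<subseteq> W" for E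
  proof (rule ccontr)
    assume "\<not> bounded E"
    with E have thesis by (rule E_obtain)
    with nt show False ..
  qed
  obtain r where r: "K \<subseteq> ball 0 r"
    using K by (meson bounded_subset_ballD compact_imp_bounded)
  have op: "openin (top_of_set S) C" if "C \<in> components (S - K)" for C
    using component_open_in_surface [OF emb compact_imp_closed [OF K(1)] that] .
  \<comment> \<open>A component avoiding the ball around \<open>K\<close> would be closed in
    \<open>S\<close> as well as open, hence all of \<open>S\<close>, although \<open>K\<close> is
    nonempty. So it has points inside and outside the sphere, and connectedness gives one on
    it.\<close>
  have meets: "C \<inter> sphere 0 r \<noteq> {}" if C: "C \<in> components (S - K)" "\<not> C \<subseteq> cball 0 r" for C
  proof -
    have CS: "C \<subseteq> S - K" and "C \<noteq> {}" using C in_components_subset in_components_nonempty by auto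
    have "C \<inter> ball 0 r \<noteq> {}"
    proof
      assume 0: "C \<inter> ball 0 r = {}"
      have cC: "closedin (top_of_set (S - K)) C" using C closedin_component by blast
      have "closure C \<inter> ball 0 r = {}"
        using 0 open_Int_closure_eq_empty [OF open_ball, of 0 r C] by blast
      moreover obtain T where T: "closed T" "C = (S - K) \<inter> T"
        using cC by (auto simp: closedin_closed)
      then have "closure C \<subseteq> T" by (intro closure_minimal) auto
      ultimately have "S \<inter> closure C \<subseteq> C" unfolding T(2) using r by blast
      moreover have "C \<subseteq> S \<inter> closure C" using CS closure_subset [of C] by blast
      ultimately have "C = S \<inter> closure C" by (rule subset_antisym [rotated])
      then have "closedin (top_of_set S) C" by (metis closedin_closed closed_closure)
      then have "C = {} \<or> C = S" using op [OF C(1)] conn by (auto simp: connected_clopen)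
      then show False using \<open>C \<noteq> {}\<close> CS K by blast
    qed
    then obtain x y where xy: "x \<in> C" "norm x < r" "y \<in> C" "r < norm y" using C by force
    have "connected (norm ` C)"
      using C in_components_connected by (intro connected_continuous_image continuous_intros) auto
    then have "r \<in> norm ` C"
      using xy connectedD_interval [of "norm ` C" "norm x" "norm y" r] by auto
    then show ?thesis by auto
  qed
  define CC where "CC = {C \<in> components (S - K). C \<inter> sphere 0 r \<noteq> {}}"
  \<comment> \<open>The components are disjoint and open in \<open>S\<close>, and they cover the
    compact set \<open>S \<inter> sphere 0 r\<close>.\<close>
  have "finite CC"
  proof -
    have "\<forall>C\<in>components (S - K). \<exists>O'. open O' \<and> C = S \<inter> O'" using op by (auto simp: openin_open)
    then obtain Op where "\<forall>C\<in>components (S - K). open (Op C) \<and> C = S \<inter> Op C" by metis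
    then have Op: "open (Op C)" "\<And>x. x \<in> C \<longleftrightarrow> x \<in> S \<and> x \<in> Op C" if "C \<in> components (S - K)" for C
      using that by blast+
    have cpt: "compact (S \<inter> sphere 0 r)" using \<open>closed S\<close> by (simp add: closed_Int_compact)
    have cov: "S \<inter> sphere 0 r \<subseteq> (\<Union>C\<in>components (S - K). Op C)"
    proof
      fix x assume x: "x \<in> S \<inter> sphere 0 r"
      then have "x \<in> S - K" using r by auto
      then obtain C where "C \<in> components (S - K)" "x \<in> C" by (metis UnionE Union_components)
      then show "x \<in> (\<Union>C\<in>components (S - K). Op C)" using Op(2) by blast
    qed
    obtain \<D> where \<D>: "\<D> \<subseteq> components (S - K)" "finite \<D>" "S \<inter> sphere 0 r \<subseteq> (\<Union>C\<in>\<D>. Op C)"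
      by (rule compactE_image [OF cpt Op(1) cov])
    have "CC \<subseteq> \<D>"
    proof
      fix C assume "C \<in> CC"
      then obtain x where x: "C \<in> components (S - K)" "x \<in> C" "x \<in> sphere 0 r" unfolding CC_def by blast
      then have "x \<in> S" using in_components_subset by blast
      then obtain C' where C': "C' \<in> \<D>" "x \<in> Op C'" using \<D> x by blast
      then have "C' \<in> components (S - K)" using \<D>(1) by blast
      then have "x \<in> C'" using Op(2) C'(2) \<open>x \<in> S\<close> by blast
      then have "C = C'" using components_nonoverlap [OF x(1) \<open>C' \<in> components (S - K)\<close>] x(2) by blast
      then show "C \<in> \<D>" using C' by simp
    qed
    then show ?thesis using \<D> finite_subset by blast
  qed
  have "W \<subseteq> cball 0 r \<union> \<Union>{C \<in> CC. C \<subseteq> W}"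
  proof
    fix x assume x: "x \<in> W"
    then have "x \<in> S - K" using W(1) openin_imp_subset by blast
    then obtain C where C: "C \<in> components (S - K)" "x \<in> C" by (metis UnionE Union_components)
    obtain T T' where T: "open T" "W = (S - K) \<inter> T" "closed T'" "W = (S - K) \<inter> T'"
      using W by (auto simp: openin_open closedin_closed)
    have "C \<inter> W = C \<inter> T" "C \<inter> W = C \<inter> T'"
      using in_components_subset [OF C(1)] T(2,4) by blast+
    then have "openin (top_of_set C) (C \<inter> W)" "closedin (top_of_set C) (C \<inter> W)"
      using T(1,3) openin_open_Int [of T C] closedin_closed_Int [of T' C] by simp_all
    then have "C \<inter> W = {} \<or> C \<inter> W = C"
      using in_components_connected [OF C(1)] by (auto simp: connected_clopen)
    then have "C \<subseteq> W" using C x by blast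
    then show "x \<in> cball 0 r \<union> \<Union>{C \<in> CC. C \<subseteq> W}"
    proof (cases "C \<subseteq> cball 0 r")
      case False
      then have "C \<in> CC" using C meets [of C] by (simp add: CC_def)
      then show ?thesis using \<open>C \<subseteq> W\<close> C by blast
    qed (use C in blast)
  qed
  moreover have "bounded (cball 0 r \<union> \<Union>{C \<in> CC. C \<subseteq> W})"
    using finite_subset [OF _ \<open>finite CC\<close>, of "{C \<in> CC. C \<subseteq> W}"] bdd
    unfolding CC_def by (auto intro!: bounded_Union)
  ultimately show False using W(3) bounded_subset by blast
qed

text \<open>Removing the compact part over an annulus separates \<open>S\<close> into an inner and
  an outer piece. If both were unbounded, each would contain an unbounded component, contradicting
  uniqueness.\<close>

lemma single_end_bounded_core:
  assumes emb: "embedded_surface S" and conn: "connected S" and "closed S" and se: "single_end S"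
    and ann: "bounded {P \<in> S. R \<le> norm (hproj P) \<and> norm (hproj P) \<le> R + 1}" (is "bounded ?K")
    and ne: "{P \<in> S. R \<le> norm (hproj P) \<and> norm (hproj P) \<le> R + 1} \<noteq> {}"
    and ub: "\<not> bounded {P \<in> S. R + 1 < norm (hproj P)}"
  shows "bounded {P \<in> S. norm (hproj P) < R}"
proof (rule ccontr)
  assume ub': "\<not> bounded {P \<in> S. norm (hproj P) < R}"
  have "closed ({P. R \<le> norm (hproj P)} \<inter> {P. norm (hproj P) \<le> R + 1})"
    by (intro closed_Int closed_Collect_le continuous_intros)
  then have "closed (S \<inter> ({P. R \<le> norm (hproj P)} \<inter> {P. norm (hproj P) \<le> R + 1}))"
    using \<open>closed S\<close> by blast
  moreover have "S \<inter> ({P. R \<le> norm (hproj P)} \<inter> {P. norm (hproj P) \<le> R + 1}) = ?K" by auto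
  ultimately have K: "compact ?K" "?K \<subseteq> S" using ann by (auto simp: compact_eq_bounded_closed)
  let ?W1 = "{P \<in> S. norm (hproj P) < R}" and ?W2 = "{P \<in> S. R + 1 < norm (hproj P)}"
  have o: "open {P. norm (hproj P) < R}" "open {P. R + 1 < norm (hproj P)}"
    by (intro open_Collect_less continuous_intros)+
  have e: "(S - ?K) \<inter> {P. norm (hproj P) < R} = ?W1" "(S - ?K) \<inter> {P. R + 1 < norm (hproj P)} = ?W2" by auto
  have 1: "openin (top_of_set (S - ?K)) ?W1" "openin (top_of_set (S - ?K)) ?W2"
    using openin_open_Int [OF o(1), of "S - ?K"] openin_open_Int [OF o(2), of "S - ?K"] unfolding e .
  have W: "(S - ?K) - ?W1 = ?W2" "(S - ?K) - ?W2 = ?W1" by auto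
  have 2: "closedin (top_of_set (S - ?K)) ?W1" "closedin (top_of_set (S - ?K)) ?W2"
    unfolding closedin_def topspace_euclidean_subtopology W using 1 by auto
  obtain E1 where E1: "E1 \<in> components (S - ?K)" "E1 \<subseteq> ?W1" "\<not> bounded E1"
    by (rule unbounded_component_exists [OF emb conn \<open>closed S\<close> K ne 1(1) 2(1) ub'])
  obtain E2 where E2: "E2 \<in> components (S - ?K)" "E2 \<subseteq> ?W2" "\<not> bounded E2"
    by (rule unbounded_component_exists [OF emb conn \<open>closed S\<close> K ne 1(2) 2(2) ub])
  have "E1 = E2" using se K E1 E2 unfolding single_end_def by blast
  then have "E1 = {}" using E1 E2 by force
  then show False using E1 by simp
qed

section \<open>Real-variable estimates behind the asymptotic formulas\<close>

lemma open_height_domain: "open {u. a < ereal u}"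
proof -
  have "open (ereal -` {a<..})" by (intro open_vimage open_greaterThan continuous_on_ereal continuous_on_id)
  then show ?thesis by (simp add: vimage_def)
qed

lemma smooth_on_real_derivatives:
  fixes \<phi> :: "real \<Rightarrow> real"
  assumes "smooth_on U \<phi>" "open U" "u \<in> U"
  shows "(\<phi> has_real_derivative deriv \<phi> u) (at u)" "(deriv \<phi> has_real_derivative deriv (deriv \<phi>) u) (at u)"
proof -
  have 1: "(\<phi> has_real_derivative deriv \<phi> x) (at x)" if "x \<in> U" for x
    using smooth_on_differentiable [OF assms(1) that] by (simp add: DERIV_deriv_iff_real_differentiable)
  show "(\<phi> has_real_derivative deriv \<phi> u) (at u)" using 1 assms by blast
  have e: "frechet_derivative \<phi> (at x) 1 = deriv \<phi> x" if "x \<in> U" for x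
    using frechet_derivative_at [OF 1 [OF that, unfolded has_field_derivative_def]] by (metis mult.right_neutral)
  have "(\<lambda>x. frechet_derivative \<phi> (at x) 1) differentiable (at u)"
    using smooth_on_differentiable smooth_on_frechet_derivative assms by blast
  then obtain D where "((\<lambda>x. frechet_derivative \<phi> (at x) 1) has_derivative D) (at u)"
    by (auto simp: differentiable_def)
  then have "(deriv \<phi> has_derivative D) (at u)"
    by (rule has_derivative_transform_within_open [OF _ assms(2,3)]) (simp add: e)
  then have "deriv \<phi> differentiable (at u)" by (auto simp: differentiable_def)
  then show "(deriv \<phi> has_real_derivative deriv (deriv \<phi>) u) (at u)"
    by (simp add: DERIV_deriv_iff_real_differentiable)
qed

text \<open>In the variable \<open>t = 1 / u\<close> the sum is \<open>t * h t\<close> with a power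
  series \<open>h\<close> that converges at \<open>1 / u0\<close> and is therefore continuous at
  0.\<close>

lemma series_in_inverse_tendsto_0:
  fixes c :: "nat \<Rightarrow> real"
  assumes "\<forall>\<^sub>F u in at_top. (\<lambda>n. c (Suc n) / u ^ Suc n) sums (f u)"
  shows "(f \<longlongrightarrow> 0) at_top"
proof -
  have "\<forall>\<^sub>F u::real in at_top. u > 0" by (rule eventually_gt_at_top)
  with assms have "\<forall>\<^sub>F u in at_top. (\<lambda>n. c (Suc n) / u ^ Suc n) sums (f u) \<and> u > 0"
    by (rule eventually_conj)
  then obtain u0 where u0: "\<And>u. u \<ge> u0 \<Longrightarrow> (\<lambda>n. c (Suc n) / u ^ Suc n) sums (f u) \<and> u > 0"
    by (auto simp: eventually_at_top_linorder)
  have sums: "(\<lambda>n. c (Suc n) * (1 / u) ^ n) sums (u * f u)" if "u \<ge> u0" for u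
  proof -
    have "(\<lambda>n. u * (c (Suc n) / u ^ Suc n)) sums (u * f u)" using u0 [OF that] by (intro sums_mult) auto
    moreover have "u * (c (Suc n) / u ^ Suc n) = c (Suc n) * (1 / u) ^ n" for n
      using u0 [OF that] by (simp add: field_simps)
    ultimately show ?thesis by simp
  qed
  define h where "h t = (\<Sum>n. c (Suc n) * t ^ n)" for t
  have "isCont h 0"
    unfolding h_def by (rule isCont_powser [of _ "1 / u0"]) (use sums [of u0] u0 [of u0] in \<open>auto simp: sums_iff\<close>)
  moreover have inv: "((\<lambda>u::real. 1 / u) \<longlongrightarrow> 0) at_top"
    using tendsto_inverse_0_at_top [OF filterlim_ident] by (simp add: inverse_eq_divide)
  ultimately have "((\<lambda>u. h (1 / u)) \<longlongrightarrow> h 0) at_top"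
    by (rule isCont_tendsto_compose)
  then have "((\<lambda>u. (1 / u) * h (1 / u)) \<longlongrightarrow> 0 * h 0) at_top" using inv by (intro tendsto_mult)
  moreover have "\<forall>\<^sub>F u in at_top. (1 / u) * h (1 / u) = f u"
    using eventually_ge_at_top [of u0] by eventually_elim (use sums u0 in \<open>fastforce simp: h_def sums_iff\<close>)
  ultimately show ?thesis using tendsto_cong by fastforce
qed

text \<open>The quartic term is there because \<open>end_geometry\<close> multiplies a slope bound
  and a height bound, each of order \<open>r^2\<close>.\<close>

lemma exp_square_dominates:
  fixes A B D C \<alpha> :: real
  assumes "C > 0" "\<alpha> > 0"
  shows "\<forall>\<^sub>F r in at_top. A + B * r\<^sup>2 + D * r ^ 4 < C * exp (\<alpha> * r\<^sup>2)"
proof -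
  have "filterlim (\<lambda>r::real. \<alpha> * r\<^sup>2) at_top at_top"
    using assms by (intro filterlim_tendsto_pos_mult_at_top [OF tendsto_const] filterlim_pow_at_top filterlim_ident) auto
  then have lim: "((\<lambda>r. (\<alpha> * r\<^sup>2) ^ k / exp (\<alpha> * r\<^sup>2)) \<longlongrightarrow> 0) at_top" for k
    by (rule filterlim_compose [OF tendsto_power_div_exp_0])
  have "((\<lambda>r. A * ((\<alpha> * r\<^sup>2) ^ 0 / exp (\<alpha> * r\<^sup>2)) + B / \<alpha> * ((\<alpha> * r\<^sup>2) ^ 1 / exp (\<alpha> * r\<^sup>2))
      + D / \<alpha>\<^sup>2 * ((\<alpha> * r\<^sup>2) ^ 2 / exp (\<alpha> * r\<^sup>2))) \<longlongrightarrow> A * 0 + B / \<alpha> * 0 + D / \<alpha>\<^sup>2 * 0) at_top"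
    by (intro tendsto_intros lim)
  then have "\<forall>\<^sub>F r in at_top. A * ((\<alpha> * r\<^sup>2) ^ 0 / exp (\<alpha> * r\<^sup>2)) + B / \<alpha> * ((\<alpha> * r\<^sup>2) ^ 1 / exp (\<alpha> * r\<^sup>2))
      + D / \<alpha>\<^sup>2 * ((\<alpha> * r\<^sup>2) ^ 2 / exp (\<alpha> * r\<^sup>2)) < C"
    using assms by (intro order_tendstoD) auto
  then show ?thesis
  proof eventually_elim
    case (elim r)
    have "A * ((\<alpha> * r\<^sup>2) ^ 0 / exp (\<alpha> * r\<^sup>2)) + B / \<alpha> * ((\<alpha> * r\<^sup>2) ^ 1 / exp (\<alpha> * r\<^sup>2))
      + D / \<alpha>\<^sup>2 * ((\<alpha> * r\<^sup>2) ^ 2 / exp (\<alpha> * r\<^sup>2)) = (A + B * r\<^sup>2 + D * r ^ 4) / exp (\<alpha> * r\<^sup>2)"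
      using assms by (simp add: add_divide_distrib power_mult_distrib flip: power_mult)
    with elim show ?case by (simp add: pos_divide_less_eq)
  qed
qed

lemma square_minus_log_pos:
  fixes \<beta> c K :: real
  shows "\<forall>\<^sub>F r in at_top. 0 < r\<^sup>2 / 2 - 1 / \<beta>\<^sup>2 * ln r + c - K * (1 / r\<^sup>2)"
proof -
  \<comment> \<open>Beyond \<open>r0\<close> the logarithmic term is at most \<open>r^2 / 4\<close>,
    and the two constants together stay below \<open>r / 4\<close>, hence below
    \<open>r^2 / 4\<close>.\<close>
  define r0 where "r0 = 1 + 4 / \<beta>\<^sup>2 + 4 * (\<bar>c\<bar> + \<bar>K\<bar>)"
  show ?thesis using eventually_ge_at_top [of r0]
  proof eventually_elim
    case (elim r)
    have bounds: "1 \<le> r" "x \<le> r" "4 * (\<bar>c\<bar> + \<bar>K\<bar>) < r" if "0 \<le> x" "1 + x + 4 * (\<bar>c\<bar> + \<bar>K\<bar>) \<le> r" for x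
      using that abs_ge_zero [of c] abs_ge_zero [of K] by argo+
    have "4 / \<beta>\<^sup>2 \<ge> 0" by simp
    then have r: "r \<ge> 1" "4 / \<beta>\<^sup>2 \<le> r" "4 * (\<bar>c\<bar> + \<bar>K\<bar>) < r"
      using bounds elim unfolding r0_def by blast+
    have fin: "0 < s / 2 - L + c - k" if "L \<le> s / 4" "r \<le> s" "\<bar>k\<bar> \<le> \<bar>K\<bar>" for s L k
      using that r(3) abs_ge_self [of k] abs_ge_minus_self [of c] by argo
    show ?case
    proof (rule fin)
      have "1 / \<beta>\<^sup>2 * ln r \<le> (r / 4) * r"
        using r ln_bound [of r] by (intro mult_mono) auto
      then show "1 / \<beta>\<^sup>2 * ln r \<le> r\<^sup>2 / 4" by (simp add: power2_eq_square)
      have "r * 1 \<le> r * r" using r by (intro mult_left_mono) auto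
      then show "r \<le> r\<^sup>2" by (simp add: power2_eq_square)
      have "\<bar>K * (1 / r\<^sup>2)\<bar> \<le> \<bar>K\<bar> * 1"
        unfolding abs_mult using r by (intro mult_left_mono) auto
      then show "\<bar>K * (1 / r\<^sup>2)\<bar> \<le> \<bar>K\<bar>" by simp
    qed
  qed
qed

lemma MVT_bounds:
  fixes f :: "real \<Rightarrow> real"
  assumes "x \<le> y" and d: "\<And>t. x \<le> t \<Longrightarrow> t \<le> y \<Longrightarrow> (f has_real_derivative f' t) (at t)"
    and l: "\<And>t. x \<le> t \<Longrightarrow> t \<le> y \<Longrightarrow> l \<le> f' t" and u: "\<And>t. x \<le> t \<Longrightarrow> t \<le> y \<Longrightarrow> f' t \<le> u"
  shows "l * (y - x) \<le> f y - f x" "f y - f x \<le> u * (y - x)"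
proof -
  have "l * (y - x) \<le> f y - f x \<and> f y - f x \<le> u * (y - x)"
  proof (cases "x = y")
    case False
    then have "x < y" using assms(1) by simp
    from MVT2 [OF this d] obtain z where z: "x < z" "z < y" "f y - f x = (y - x) * f' z" by auto
    then show ?thesis using l [of z] u [of z] \<open>x < y\<close> by (simp add: mult.commute mult_right_mono)
  qed simp
  then show "l * (y - x) \<le> f y - f x" "f y - f x \<le> u * (y - x)" by auto
qed

lemma G_fun_has_derivative:
  assumes \<phi>: "\<And>v. a < ereal v \<Longrightarrow> isCont (deriv \<phi>) v" "\<And>v. a < ereal v \<Longrightarrow> deriv \<phi> v > 0"
    and "a < ereal u0" "a < ereal v"
  shows "(G_fun \<phi> u0 has_real_derivative 1 / deriv \<phi> v) (at v)"
proof -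
  obtain e where e: "e > 0" "\<And>w. dist w (min u0 v) < e \<Longrightarrow> a < ereal w"
  proof -
    have "min u0 v \<in> {w. a < ereal w}" using assms by (auto simp: min_def)
    then obtain e where "e > 0" "\<forall>w. dist w (min u0 v) < e \<longrightarrow> w \<in> {w. a < ereal w}"
      using open_height_domain [of a] unfolding open_dist by blast
    then show thesis using that by blast
  qed
  \<comment> \<open>The interval from \<open>l\<close> to \<open>h\<close> has both
    \<open>u0\<close> and \<open>v\<close> in its interior, in either order, and stays in the height
    domain, so the one-sided form of the fundamental theorem becomes a two-sided derivative.\<close>
  define l where "l = min u0 v - e / 2"
  define h where "h = max u0 v + 1"
  have l: "a < ereal l" using e(2) [of l] e(1) by (simp add: l_def dist_real_def)
  have lh: "l < u0" "u0 < h" "l < v" "v < h" using e by (auto simp: l_def h_def)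
  have "continuous_on {l..h} (\<lambda>\<xi>. 1 / deriv \<phi> \<xi>)"
  proof (intro continuous_intros continuous_at_imp_continuous_on ballI)
    fix x assume "x \<in> {l..h}"
    then have "a < ereal x" using l by (meson atLeastAtMost_iff ereal_less_eq(3) less_le_trans)
    then show "isCont (deriv \<phi>) x" "deriv \<phi> x \<noteq> 0" using \<phi> by force+
  qed
  from interval_integral_FTC2 [OF _ _ this, of u0 v] lh
  have "((\<lambda>u. LBINT \<xi>=u0..u. 1 / deriv \<phi> \<xi>) has_vector_derivative 1 / deriv \<phi> v) (at v within {l..h})" by simp
  moreover have "at v within {l..h} = at v" using lh by (intro at_within_interior) auto
  ultimately show ?thesis
    by (simp add: has_real_derivative_iff_has_vector_derivative G_fun_def [abs_def])
qed

text \<open>\<Psi> stands for \<phi> when \<alpha> > 0 and for \<open>G_fun\<close> when \<alpha> =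
  0. Growing at least linearly above \<open>M\<close>, it turns an upper bound for its value into
  one for the height.\<close>

lemma heights_bounded_over_annuli:
  fixes \<Psi> h :: "real \<Rightarrow> real"
  assumes up: "\<And>v. M \<le> v \<Longrightarrow> \<Psi> M + k * (v - M) \<le> \<Psi> v" and "k > 0"
    and low: "\<And>P. P \<in> S \<Longrightarrow> R \<le> norm (hproj P) \<Longrightarrow> M < P $ 3"
    and h: "continuous_on {R..} h" "\<And>P. P \<in> S \<Longrightarrow> R \<le> norm (hproj P) \<Longrightarrow> \<Psi> (P $ 3) \<le> h (norm (hproj P))"
  shows "bounded {P \<in> S. R \<le> norm (hproj P) \<and> norm (hproj P) \<le> \<rho>}"
proof -
  have "continuous_on {R..\<rho>} h" using h(1) by (rule continuous_on_subset) auto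
  then have "bounded (h ` {R..\<rho>})" by (intro compact_imp_bounded compact_continuous_image) auto
  then obtain B where B: "\<And>r. R \<le> r \<Longrightarrow> r \<le> \<rho> \<Longrightarrow> h r \<le> B"
    unfolding bounded_iff by (metis atLeastAtMost_iff image_eqI abs_le_D1 real_norm_def)
  show ?thesis unfolding bounded_iff
  proof (intro exI [of _ "\<rho> + (\<bar>M\<bar> + (B - \<Psi> M) / k)"] ballI)
    fix P assume "P \<in> {P \<in> S. R \<le> norm (hproj P) \<and> norm (hproj P) \<le> \<rho>}"
    then have P: "P \<in> S" "R \<le> norm (hproj P)" "norm (hproj P) \<le> \<rho>" by auto
    have "\<Psi> M + k * (P $ 3 - M) \<le> B"
      using up [of "P $ 3"] low [OF P(1,2)] h(2) [OF P(1,2)] B [OF P(2,3)] by linarith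
    then have "P $ 3 - M \<le> (B - \<Psi> M) / k" using \<open>k > 0\<close> by (simp add: field_simps)
    then have 3: "\<bar>P $ 3\<bar> \<le> \<bar>M\<bar> + (B - \<Psi> M) / k" using low [OF P(1,2)] by linarith
    have "(norm P)\<^sup>2 = (norm (hproj P))\<^sup>2 + (P $ 3)\<^sup>2"
      unfolding norm_hproj by (subst power2_norm_eq_inner) (simp add: inner_vec_def sum_3 power2_eq_square)
    also have "\<dots> \<le> (norm (hproj P) + \<bar>P $ 3\<bar>)\<^sup>2" by (simp add: power2_sum)
    finally have "norm P \<le> norm (hproj P) + \<bar>P $ 3\<bar>" by (rule power2_le_imp_le) simp
    then show "norm P \<le> \<rho> + (\<bar>M\<bar> + (B - \<Psi> M) / k)" using P 3 by linarith
  qed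
qed

text \<open>The three facts about the end on which everything later rests: it covers the exterior of
  a disk, has bounded heights over annuli, and has vanishing oscillation on large circles.\<close>

lemma end_geometry:
  assumes a: "smooth_on {u. a < ereal u} \<phi>" "\<And>u. a < ereal u \<Longrightarrow> deriv \<phi> u > 0"
    "\<And>u. a < ereal u \<Longrightarrow> deriv (deriv \<phi>) u \<ge> 0"
    and lim: "((\<lambda>u. deriv \<phi> u - (\<alpha> * u + \<beta>)) \<longlongrightarrow> 0) at_top"
    and ab: "\<alpha> > 0 \<or> \<alpha> = 0 \<and> \<beta> > 0"
    and S: "S \<subseteq> {p. a < ereal (p $ 3)}"
    and asym: "smoothly_asymptotic_to_bowl a \<phi> \<alpha> \<beta> S"
  obtains R where "R > 0" "\<And>x. R \<le> norm x \<Longrightarrow> \<exists>P\<in>S. hproj P = x"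
    "\<And>\<rho>. bounded {P \<in> S. R \<le> norm (hproj P) \<and> norm (hproj P) \<le> \<rho>}"
    "\<And>m. m > 0 \<Longrightarrow> \<exists>\<rho>. \<forall>P\<in>S. \<forall>Q\<in>S. norm (hproj P) = norm (hproj Q) \<and> \<rho> \<le> norm (hproj P) \<longrightarrow> P $ 3 - Q $ 3 < m"
proof -
  have upc: "a < ereal v" if "a < ereal u" "u \<le> v" for u v
    using that by (meson ereal_less_eq(3) less_le_trans)
  have d\<phi>: "(\<phi> has_real_derivative deriv \<phi> u) (at u)" "(deriv \<phi> has_real_derivative deriv (deriv \<phi>) u) (at u)"
    if "a < ereal u" for u
    using smooth_on_real_derivatives [OF a(1) open_height_domain] that by auto
  have mono: "deriv \<phi> u \<le> deriv \<phi> v" if "a < ereal u" "u \<le> v" for u v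
    by (rule DERIV_nonneg_imp_nondecreasing [OF that(2)]) (use d\<phi>(2) a(3) upc [OF that(1)] in blast)
  have cont: "isCont (deriv \<phi>) v" if "a < ereal v" for v using d\<phi>(2) [OF that] DERIV_isCont by blast
  obtain R0 D u where R0: "R0 > 0" "S - ball 0 R0 = vertical_graph D u" "\<forall>\<^sub>F x in at_infinity. x \<in> D"
    and A: "\<alpha> > 0 \<longrightarrow> (\<exists>C>0. (\<lambda>x. \<phi> (u x) - C * exp (\<alpha> * (norm x)\<^sup>2)) \<in> O[at_infinity](\<lambda>x. (norm x)\<^sup>2))"
    and B: "\<alpha> = 0 \<longrightarrow> (\<exists>u0 c. a < ereal u0 \<and>
             (\<lambda>x. G_fun \<phi> u0 (u x) - ((norm x)\<^sup>2 / 2 - 1 / \<beta>\<^sup>2 * ln (norm x) + c))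
               \<in> O[at_infinity](\<lambda>x. 1 / (norm x)\<^sup>2))"
    using asym unfolding smoothly_asymptotic_to_bowl_def by blast
  obtain R1 where R1: "\<And>x. R1 \<le> norm x \<Longrightarrow> x \<in> D"
    using R0(3) unfolding eventually_at_infinity by blast
  have height: "P $ 3 = u (hproj P)" if "P \<in> S" "R0 \<le> norm (hproj P)" for P
  proof -
    have "P \<in> S - ball 0 R0" using that norm_hproj_le [of P] by simp
    then show ?thesis using R0(2) by (auto simp: vertical_graph_def)
  qed
  have surj: "\<exists>P\<in>S. hproj P = x" if "R1 \<le> norm x" for x
  proof
    let ?P = "vector [x $ 1, x $ 2, u x] :: real^3"
    show h: "hproj ?P = x" by (simp add: vec_eq_iff forall_2)
    then have "?P \<in> vertical_graph D u" using R1 [OF that] by (simp add: vertical_graph_def)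
    then show "?P \<in> S" using R0(2) by blast
  qed
  have aP: "a < ereal (P $ 3)" if "P \<in> S" for P using S that by auto
  show thesis
  proof (cases "\<alpha> > 0")
    case True
    obtain C where C: "C > 0" "(\<lambda>x. \<phi> (u x) - C * exp (\<alpha> * (norm x)\<^sup>2)) \<in> O[at_infinity](\<lambda>x. (norm x)\<^sup>2)"
      using A True by blast
    then obtain K R2 where K: "K > 0" "\<And>x. R2 \<le> norm x \<Longrightarrow> \<bar>\<phi> (u x) - C * exp (\<alpha> * (norm x)\<^sup>2)\<bar> \<le> K * (norm x)\<^sup>2"
      by (elim landau_o.bigE) (auto simp: eventually_at_infinity)
    have "\<forall>\<^sub>F v in at_top. a < ereal v \<and> 0 \<le> v \<and> \<alpha> / 2 * v \<le> deriv \<phi> v"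
    proof -
      \<comment> \<open>\<open>a\<close> is an extended real; a point of the surface supplies a real
        height above it.\<close>
      obtain x :: "real^2" where "norm x = max R1 0" using vector_choose_size [of "max R1 0"] by auto
      then obtain P where "P \<in> S" using surj [of x] by auto
      have "\<forall>\<^sub>F v in at_top. P $ 3 \<le> v" by (rule eventually_ge_at_top)
      then have 1: "\<forall>\<^sub>F v in at_top. a < ereal v" by eventually_elim (rule upc [OF aP [OF \<open>P \<in> S\<close>]])
      have 2: "\<forall>\<^sub>F v in at_top. deriv \<phi> v - (\<alpha> * v + \<beta>) > -1" using lim by (rule order_tendstoD) simp
      have 3: "\<forall>\<^sub>F v in at_top. max 0 (2 * (\<bar>\<beta>\<bar> + 1) / \<alpha>) \<le> v" by (rule eventually_ge_at_top)
      from 1 2 3 show ?thesis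
      proof eventually_elim
        case (elim v)
        then have "\<bar>\<beta>\<bar> + 1 \<le> \<alpha> / 2 * v" using True by (simp add: field_simps)
        then have "\<alpha> / 2 * v \<le> \<alpha> * v + \<beta> - 1" by (simp add: field_simps)
        with elim show ?case by auto
      qed
    qed
    then obtain M where M: "\<And>v. M \<le> v \<Longrightarrow> a < ereal v \<and> 0 \<le> v \<and> \<alpha> / 2 * v \<le> deriv \<phi> v"
      unfolding eventually_at_top_linorder by blast
    have aM: "a < ereal M" "0 \<le> M" using M by auto
    obtain R3 where R3: "\<And>r. R3 \<le> r \<Longrightarrow> \<phi> M + K * r\<^sup>2 + 0 * r ^ 4 < C * exp (\<alpha> * r\<^sup>2)"
      using exp_square_dominates [OF \<open>C > 0\<close> True, of "\<phi> M" K 0] unfolding eventually_at_top_linorder by blast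
    define R where "R = max (max R0 R1) (max R2 R3)"
    have est: "\<bar>\<phi> (P $ 3) - C * exp (\<alpha> * (norm (hproj P))\<^sup>2)\<bar> \<le> K * (norm (hproj P))\<^sup>2" if "P \<in> S" "R \<le> norm (hproj P)" for P
      using K(2) [of "hproj P"] height [OF that(1)] that(2) by (simp add: R_def)
    \<comment> \<open>\<phi> is increasing, so a height of at most \<open>M\<close> would keep it at
      most \<open>\<phi> M\<close>, whereas beyond \<open>R3\<close> the asymptotic formula forces a
      larger value.\<close>
    have low: "M < P $ 3" if "P \<in> S" "R \<le> norm (hproj P)" for P
    proof (rule ccontr)
      assume "\<not> M < P $ 3"
      then have "P $ 3 \<le> M" by simp
      then have "\<phi> (P $ 3) \<le> \<phi> M"
      proof (rule DERIV_nonneg_imp_nondecreasing)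
        fix t assume "P $ 3 \<le> t"
        then have "a < ereal t" using upc aP [OF that(1)] by blast
        then show "\<exists>d. (\<phi> has_real_derivative d) (at t) \<and> 0 \<le> d" using d\<phi>(1) a(2) less_imp_le by blast
      qed
      then show False using est [OF that] R3 [of "norm (hproj P)"] that by (simp add: R_def)
    qed
    \<comment> \<open>Convexity: \<phi> lies above its tangent line at \<open>M\<close>.\<close>
    have up: "\<phi> M + deriv \<phi> M * (v - M) \<le> \<phi> v" if "M \<le> v" for v
    proof -
      have t: "a < ereal t" if "M \<le> t" for t using upc [OF aM(1) that] .
      show ?thesis
        using MVT_bounds(1) [OF that d\<phi>(1) [OF t] mono [OF aM(1)] mono [OF t]] by (simp add: algebra_simps)
    qed
    show thesis
    proof (rule that)
      show "R > 0" using R0 by (simp add: R_def)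
      show "\<exists>P\<in>S. hproj P = x" if "R \<le> norm x" for x using surj that by (simp add: R_def)
      show "bounded {P \<in> S. R \<le> norm (hproj P) \<and> norm (hproj P) \<le> \<rho>}" for \<rho>
      proof (rule heights_bounded_over_annuli [OF up _ low])
        show "deriv \<phi> M > 0" using a(2) aM by blast
        show "continuous_on {R..} (\<lambda>r. C * exp (\<alpha> * r\<^sup>2) + K * r\<^sup>2)" by (intro continuous_intros)
        show "\<phi> (P $ 3) \<le> C * exp (\<alpha> * (norm (hproj P))\<^sup>2) + K * (norm (hproj P))\<^sup>2" if "P \<in> S" "R \<le> norm (hproj P)" for P
          using est [OF that] by linarith
      qed auto
      fix m :: real assume m: "m > 0"
      obtain R4 where R4: "\<And>r. R4 \<le> r \<Longrightarrow> \<phi> M + K * r\<^sup>2 + (4 * K / (\<alpha> * m)) * (2 * K / m) * r ^ 4 < C * exp (\<alpha> * r\<^sup>2)"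
        using exp_square_dominates [OF \<open>C > 0\<close> True] unfolding eventually_at_top_linorder by blast
      show "\<exists>\<rho>. \<forall>P\<in>S. \<forall>Q\<in>S. norm (hproj P) = norm (hproj Q) \<and> \<rho> \<le> norm (hproj P) \<longrightarrow> P $ 3 - Q $ 3 < m"
      proof (intro exI [of _ "max R R4"] ballI impI, rule ccontr)
        fix P Q assume PQ: "P \<in> S" "Q \<in> S" "norm (hproj P) = norm (hproj Q) \<and> max R R4 \<le> norm (hproj P)"
          and n: "\<not> P $ 3 - Q $ 3 < m"
        define r where "r = norm (hproj Q)"
        have r: "R \<le> r" "R4 \<le> r" "norm (hproj P) = r" using PQ by (auto simp: r_def)
        let ?d = "deriv \<phi> (Q $ 3)"
        have Q: "M < Q $ 3" "a < ereal (Q $ 3)" "?d > 0" using low [OF PQ(2)] r aP [OF PQ(2)] a(2) by (auto simp: r_def)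
        have le: "Q $ 3 \<le> P $ 3" using n m by simp
        \<comment> \<open>An excess of \<open>m\<close> forces the slope of \<phi> at the lower
          point to be O(r^2). As that slope is at least \<open>\<alpha> / 2\<close> times the
          height, the height is O(r^2) too, so \<phi> there is O(r^4), against its exponential
          growth.\<close>
        have "?d * (P $ 3 - Q $ 3) \<le> \<phi> (P $ 3) - \<phi> (Q $ 3)"
          by (rule MVT_bounds(1) [OF le d\<phi>(1) [OF upc [OF Q(2)]] mono [OF Q(2)] mono [OF upc [OF Q(2)]]])
        moreover have "?d * m \<le> ?d * (P $ 3 - Q $ 3)" using Q n by (intro mult_left_mono) auto
        moreover have "\<phi> (P $ 3) - \<phi> (Q $ 3) \<le> 2 * K * r\<^sup>2"
          using est [OF PQ(1)] est [OF PQ(2)] r unfolding r_def [symmetric] r(3) by linarith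
        ultimately have "?d * m \<le> 2 * K * r\<^sup>2" by linarith
        then have d: "?d \<le> 2 * K / m * r\<^sup>2" using m by (simp add: field_simps)
        moreover have "\<alpha> / 2 * Q $ 3 \<le> ?d" using M Q by simp
        ultimately have "\<alpha> / 2 * Q $ 3 \<le> 2 * K / m * r\<^sup>2" by linarith
        then have Q3: "Q $ 3 \<le> 4 * K / (\<alpha> * m) * r\<^sup>2" using True m by (simp add: field_simps)
        have "\<phi> (Q $ 3) - \<phi> M \<le> ?d * (Q $ 3 - M)"
          by (rule MVT_bounds(2) [OF less_imp_le [OF Q(1)] d\<phi>(1) [OF upc [OF aM(1)]] mono [OF aM(1)] mono [OF upc [OF aM(1)]]])
        also have "\<dots> \<le> (2 * K / m * r\<^sup>2) * (4 * K / (\<alpha> * m) * r\<^sup>2)"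
          using d Q3 Q aM m K by (intro mult_mono) auto
        also have "\<dots> = (4 * K / (\<alpha> * m)) * (2 * K / m) * r ^ 4" by (simp add: algebra_simps power2_eq_square power4_eq_xxxx)
        finally have "\<phi> (Q $ 3) \<le> \<phi> M + (4 * K / (\<alpha> * m)) * (2 * K / m) * r ^ 4" by simp
        then show False using est [OF PQ(2)] r R4 [OF r(2)] unfolding r_def [symmetric] by linarith
      qed
    qed
  next
    case False
    then have \<alpha>: "\<alpha> = 0" and \<beta>: "\<beta> > 0" using ab by auto
    obtain u0 c where u0: "a < ereal u0" and "(\<lambda>x. G_fun \<phi> u0 (u x) - ((norm x)\<^sup>2 / 2 - 1 / \<beta>\<^sup>2 * ln (norm x) + c))
               \<in> O[at_infinity](\<lambda>x. 1 / (norm x)\<^sup>2)"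
      using B \<alpha> by blast
    then obtain K R2 where K: "K > 0" "\<And>x. R2 \<le> norm x \<Longrightarrow>
        \<bar>G_fun \<phi> u0 (u x) - ((norm x)\<^sup>2 / 2 - 1 / \<beta>\<^sup>2 * ln (norm x) + c)\<bar> \<le> K * (1 / (norm x)\<^sup>2)"
      by (elim landau_o.bigE) (auto simp: eventually_at_infinity)
    let ?G = "G_fun \<phi> u0"
    have dG: "(?G has_real_derivative 1 / deriv \<phi> v) (at v)" if "a < ereal v" for v
      using G_fun_has_derivative [OF cont a(2) u0 that] .
    \<comment> \<open>A nondecreasing function stays below its limit, which is \<beta> because
      \<alpha> = 0. Hence \<open>?G\<close> grows with slope at least
      \<open>1 / \<beta>\<close>.\<close>
    have le\<beta>: "deriv \<phi> v \<le> \<beta>" if "a < ereal v" for v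
    proof (rule tendsto_lowerbound)
      show "(deriv \<phi> \<longlongrightarrow> \<beta>) at_top"
        using tendsto_add [OF lim tendsto_const [of \<beta>]] \<alpha> by simp
      show "\<forall>\<^sub>F w in at_top. deriv \<phi> v \<le> deriv \<phi> w"
        using eventually_ge_at_top [of v] by eventually_elim (rule mono [OF that])
    qed simp
    have G: "(y - x) / \<beta> \<le> ?G y - ?G x" if "a < ereal x" "x \<le> y" for x y
    proof -
      have "?G x - x / \<beta> \<le> ?G y - y / \<beta>"
      proof (rule DERIV_nonneg_imp_nondecreasing [OF that(2)])
        fix t assume "x \<le> t" "t \<le> y"
        then have t: "a < ereal t" using upc that by blast
        have "((\<lambda>v. ?G v - v / \<beta>) has_real_derivative 1 / deriv \<phi> t - 1 / \<beta>) (at t)"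
          by (intro DERIV_diff dG t DERIV_cdivide DERIV_ident)
        moreover have "1 / deriv \<phi> t - 1 / \<beta> \<ge> 0"
          using le\<beta> [OF t] a(2) [OF t] \<beta> by (simp add: frac_le)
        ultimately show "\<exists>d. ((\<lambda>v. ?G v - v / \<beta>) has_real_derivative d) (at t) \<and> 0 \<le> d" by blast
      qed
      then show ?thesis by (simp add: diff_divide_distrib)
    qed
    have G0: "?G u0 = 0" by (simp add: G_fun_def)
    obtain R3 where R3: "\<And>r. R3 \<le> r \<Longrightarrow> 0 < r\<^sup>2 / 2 - 1 / \<beta>\<^sup>2 * ln r + c - K * (1 / r\<^sup>2)"
      using square_minus_log_pos [of \<beta> c K] unfolding eventually_at_top_linorder by blast
    define R where "R = max (max R0 R1) (max R2 R3)"
    have R: "R > 0" using R0 by (simp add: R_def)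
    have est: "\<bar>?G (P $ 3) - ((norm (hproj P))\<^sup>2 / 2 - 1 / \<beta>\<^sup>2 * ln (norm (hproj P)) + c)\<bar> \<le> K * (1 / (norm (hproj P))\<^sup>2)"
      if "P \<in> S" "R \<le> norm (hproj P)" for P
      using K(2) [of "hproj P"] height [OF that(1)] that(2) by (simp add: R_def)
    have low: "u0 < P $ 3" if "P \<in> S" "R \<le> norm (hproj P)" for P
    proof (rule ccontr)
      assume n: "\<not> u0 < P $ 3"
      then have "(u0 - P $ 3) / \<beta> \<le> ?G u0 - ?G (P $ 3)" using G [OF aP [OF that(1)]] by simp
      moreover have "(u0 - P $ 3) / \<beta> \<ge> 0" using n \<beta> by simp
      ultimately have "?G (P $ 3) \<le> 0" using G0 by linarith
      moreover have "R3 \<le> norm (hproj P)" using that by (simp add: R_def)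
      ultimately show False using est [OF that] R3 by fastforce
    qed
    show thesis
    proof (rule that)
      show "R > 0" by (rule R)
      show "\<exists>P\<in>S. hproj P = x" if "R \<le> norm x" for x using surj that by (simp add: R_def)
      show "bounded {P \<in> S. R \<le> norm (hproj P) \<and> norm (hproj P) \<le> \<rho>}" for \<rho>
      proof (rule heights_bounded_over_annuli [OF _ _ low])
        show "?G u0 + 1 / \<beta> * (v - u0) \<le> ?G v" if "u0 \<le> v" for v using G [OF u0 that] by simp
        show "1 / \<beta> > 0" using \<beta> by simp
        show "continuous_on {R..} (\<lambda>r. (r\<^sup>2 / 2 - 1 / \<beta>\<^sup>2 * ln r + c) + K * (1 / r\<^sup>2))"
          using R by (intro continuous_intros) auto
        show "?G (P $ 3) \<le> ((norm (hproj P))\<^sup>2 / 2 - 1 / \<beta>\<^sup>2 * ln (norm (hproj P)) + c) + K * (1 / (norm (hproj P))\<^sup>2)"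
          if "P \<in> S" "R \<le> norm (hproj P)" for P
          using est [OF that] by linarith
      qed auto
      fix m :: real assume m: "m > 0"
      \<comment> \<open>An excess of \<open>m\<close> would give
        \<open>r^2 \<le> 2 * K * \<beta> / m\<close>, while this radius gives
        \<open>2 * K * \<beta> / m < r < r^2\<close>.\<close>
      define \<rho> where "\<rho> = max R (2 * K * \<beta> / m + 1)"
      show "\<exists>\<rho>. \<forall>P\<in>S. \<forall>Q\<in>S. norm (hproj P) = norm (hproj Q) \<and> \<rho> \<le> norm (hproj P) \<longrightarrow> P $ 3 - Q $ 3 < m"
      proof (intro exI [of _ \<rho>] ballI impI, rule ccontr)
        fix P Q assume PQ: "P \<in> S" "Q \<in> S" "norm (hproj P) = norm (hproj Q) \<and> \<rho> \<le> norm (hproj P)"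
          and n: "\<not> P $ 3 - Q $ 3 < m"
        define r where "r = norm (hproj Q)"
        have r: "R \<le> r" "2 * K * \<beta> / m + 1 \<le> r" "norm (hproj P) = r" using PQ by (auto simp: r_def \<rho>_def)
        have "0 < 2 * K * \<beta> / m" using K \<beta> m by simp
        then have "1 < r" using r by linarith
        have "m / \<beta> \<le> (P $ 3 - Q $ 3) / \<beta>" using n \<beta> by (simp add: divide_right_mono)
        also have "\<dots> \<le> ?G (P $ 3) - ?G (Q $ 3)" using G [OF aP [OF PQ(2)], of "P $ 3"] n m by simp
        also have "\<dots> \<le> 2 * (K * (1 / r\<^sup>2))"
          using est [OF PQ(1)] est [OF PQ(2)] r unfolding r_def [symmetric] r(3) by linarith
        finally have "m * r\<^sup>2 \<le> 2 * K * \<beta>" using \<beta> \<open>1 < r\<close> by (simp add: field_simps)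
        then have "r\<^sup>2 \<le> 2 * K * \<beta> / m" using m by (simp add: field_simps)
        moreover have "r * 1 < r * r" using \<open>1 < r\<close> by (intro mult_strict_left_mono) auto
        ultimately show False using r(2) by (simp add: power2_eq_square)
      qed
    qed
  qed
qed

section \<open>The radial profile\<close>

text \<open>The asymptotics say nothing inside radius \<open>R\<close>; the core comes from
  \<open>single_end_bounded_core\<close>, the outer part being unbounded since it has points over
  every large circle.\<close>

lemma bounded_over_disks:
  assumes emb: "embedded_surface S" and conn: "connected S" and "closed S" and se: "single_end S"
    and surj: "\<And>x. R \<le> norm x \<Longrightarrow> \<exists>P\<in>S. hproj P = x" and "R > 0"
    and bdd: "\<And>\<rho>. bounded {P \<in> S. R \<le> norm (hproj P) \<and> norm (hproj P) \<le> \<rho>}"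
  shows "bounded {P \<in> S. norm (hproj P) \<le> \<rho>}"
proof -
  have pt: "\<exists>P\<in>S. norm (hproj P) = r" if "R \<le> r" for r
  proof -
    have "0 \<le> r" using that \<open>R > 0\<close> by simp
    then obtain x :: "real^2" where "norm x = r" by (rule vector_choose_size)
    then show ?thesis using surj [of x] that by auto
  qed
  have "bounded {P \<in> S. norm (hproj P) < R}"
  proof (rule single_end_bounded_core [OF emb conn \<open>closed S\<close> se bdd])
    show "{P \<in> S. R \<le> norm (hproj P) \<and> norm (hproj P) \<le> R + 1} \<noteq> {}"
      using pt [of R] by force
    show "\<not> bounded {P \<in> S. R + 1 < norm (hproj P)}"
    proof
      assume "bounded {P \<in> S. R + 1 < norm (hproj P)}"
      then obtain B where B: "\<And>P. P \<in> S \<Longrightarrow> R + 1 < norm (hproj P) \<Longrightarrow> norm P \<le> B"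
        unfolding bounded_iff by blast
      obtain P where "P \<in> S" "norm (hproj P) = R + 2 + \<bar>B\<bar>" using pt [of "R + 2 + \<bar>B\<bar>"] by auto
      moreover from this have "norm P \<le> B" by (intro B) auto
      ultimately show False using norm_hproj_le [of P] \<open>R > 0\<close> abs_ge_self [of B] by linarith
    qed
  qed
  then have "bounded ({P \<in> S. norm (hproj P) < R} \<union> {P \<in> S. R \<le> norm (hproj P) \<and> norm (hproj P) \<le> \<rho>})"
    using bdd [of \<rho>] by simp
  then show ?thesis by (rule bounded_subset) auto
qed

text \<open>The image is closed by properness over disks and open because an injective continuous
  map between planar open sets is open; the plane is connected.\<close>

lemma projection_onto:
  assumes emb: "embedded_surface S" and "closed S" and "S \<noteq> {}" and inj: "inj_on hproj S"
    and bdd: "\<And>\<rho>. bounded {P \<in> S. norm (hproj P) \<le> \<rho>}"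
  shows "hproj ` S = UNIV"
proof -
  have cpt: "compact (hproj ` {P \<in> S. norm (hproj P) \<le> \<rho>})" for \<rho>
  proof -
    have "closed {P. norm (hproj P) \<le> \<rho>}" by (intro closed_Collect_le continuous_intros)
    then have "closed (S \<inter> {P. norm (hproj P) \<le> \<rho>})" using \<open>closed S\<close> by blast
    then have "compact {P \<in> S. norm (hproj P) \<le> \<rho>}"
      using bdd [of \<rho>] by (simp add: compact_eq_bounded_closed Collect_conj_eq)
    then show ?thesis by (intro compact_continuous_image continuous_intros)
  qed
  have "closure (hproj ` S) \<subseteq> hproj ` S"
  proof
    fix x assume x: "x \<in> closure (hproj ` S)"
    \<comment> \<open>Approximants within distance 1 of \<open>x\<close> all come from this compact
      piece.\<close>
    let ?C = "hproj ` {P \<in> S. norm (hproj P) \<le> norm x + 1}"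
    have "x \<in> closure ?C" unfolding closure_approachable
    proof (intro allI impI)
      fix e :: real assume "e > 0"
      then obtain P where P: "P \<in> S" "dist (hproj P) x < min e 1"
        using x unfolding closure_approachable by (metis imageE min_less_iff_conj zero_less_one)
      have "norm (hproj P) \<le> norm x + dist (hproj P) x" unfolding dist_norm by norm
      then have "hproj P \<in> ?C" using P by auto
      then show "\<exists>y\<in>?C. dist y x < e" using P by auto
    qed
    moreover have "closed ?C" using cpt by (rule compact_imp_closed)
    ultimately have "x \<in> ?C" by (simp add: closure_closed)
    then show "x \<in> hproj ` S" by blast
  qed
  then have "closed (hproj ` S)" using closure_subset_eq by blast
  moreover have "open (hproj ` S)"
  proof (subst open_subopen, intro ballI)
    fix x assume "x \<in> hproj ` S"
    then obtain P where P: "P \<in> S" "x = hproj P" by blast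
    obtain U X q where X: "local_parametrization S U X" and q: "q \<in> U" "P = X q"
      using emb P by (force simp: embedded_surface_def)
    note D = local_parametrizationD [OF X]
    obtain Y where hom: "homeomorphism U (X ` U) X Y"
      using X by (auto simp: local_parametrization_def)
    have "inj_on X U" using hom by (metis homeomorphism_apply1 inj_on_inverseI)
    then have "inj_on (\<lambda>q. hproj (X q)) U"
      using comp_inj_on [of X U hproj] inj_on_subset [OF inj D(4)] by (simp add: o_def)
    then have "open ((\<lambda>q. hproj (X q)) ` U)"
      using D by (intro invariance_of_domain continuous_intros)
    then show "\<exists>T. open T \<and> x \<in> T \<and> T \<subseteq> hproj ` S" using q P D(4) by blast
  qed
  ultimately show ?thesis using clopen \<open>S \<noteq> {}\<close> by (metis image_is_empty)
qed

text \<open>\<open>f r\<close> is the height over \<open>(r, 0)\<close>, for negative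
  \<open>r\<close> as well. The even extension makes 0 an interior point, so that ordinary two-sided
  derivatives are available on the axis.\<close>

lemma radial_graph:
  assumes onto: "hproj ` S = UNIV"
    and sym: "\<And>P Q. P \<in> S \<Longrightarrow> Q \<in> S \<Longrightarrow> norm (hproj P) = norm (hproj Q) \<Longrightarrow> P $ 3 = Q $ 3"
  shows "\<exists>f. (\<forall>P. P \<in> S \<longleftrightarrow> P $ 3 = f (norm (hproj P))) \<and> (\<forall>r. f (- r) = f r)"
proof -
  have "\<exists>P\<in>S. hproj P = vector [r, 0]" for r
    using onto by (metis (mono_tags, lifting) UNIV_I imageE)
  then obtain p where p: "\<And>r. p r \<in> S \<and> hproj (p r) = vector [r, 0]" by metis
  have n: "norm (hproj (p r)) = \<bar>r\<bar>" for r
  proof -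
    have "(norm (hproj (p r)))\<^sup>2 = \<bar>r\<bar>\<^sup>2"
      using p [of r] unfolding norm_hproj by (simp flip: hproj_nth)
    then show ?thesis by (rule power2_eq_imp_eq) auto
  qed
  show ?thesis
  proof (rule exI [of _ "\<lambda>r. p r $ 3"], intro conjI allI)
    show "p (- r) $ 3 = p r $ 3" for r using sym p n by (metis abs_minus_cancel)
    show "P \<in> S \<longleftrightarrow> P $ 3 = p (norm (hproj P)) $ 3" for P
    proof
      show "P $ 3 = p (norm (hproj P)) $ 3" if "P \<in> S"
        using sym [OF that, of "p (norm (hproj P))"] p n by simp
      assume 3: "P $ 3 = p (norm (hproj P)) $ 3"
      obtain Q where Q: "Q \<in> S" "hproj Q = hproj P" using onto by (metis UNIV_I imageE)
      then have "Q $ 3 = P $ 3" using sym [OF Q(1), of "p (norm (hproj P))"] p n 3 by simp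
      moreover have "Q $ 1 = P $ 1" "Q $ 2 = P $ 2" using Q(2) by (metis hproj_nth)+
      ultimately have "Q = P" by (simp add: vec_eq_iff forall_3)
      then show "P \<in> S" using Q by simp
    qed
  qed
qed

section \<open>Regularity of the meridian and its differential equation\<close>

definition revolve :: "real^3 \<Rightarrow> real \<Rightarrow> real^3" where
  "revolve P t = vector [P $ 1 * cos t - P $ 2 * sin t, P $ 1 * sin t + P $ 2 * cos t, P $ 3]"

lemma revolve_0 [simp]: "revolve P 0 = P"
  by (simp add: revolve_def vec_eq_iff forall_3)

lemma norm_hproj_revolve [simp]: "norm (hproj (revolve P t)) = norm (hproj P)"
proof -
  have "(norm (hproj (revolve P t)))\<^sup>2 = ((cos t)\<^sup>2 + (sin t)\<^sup>2) * ((P $ 1)\<^sup>2 + (P $ 2)\<^sup>2)"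
    unfolding norm_hproj revolve_def by (simp only: vector_3) algebra
  then have "(norm (hproj (revolve P t)))\<^sup>2 = (norm (hproj P))\<^sup>2" by (simp add: norm_hproj)
  then show ?thesis by (rule power2_eq_imp_eq) auto
qed

lemma has_vector_derivative_vec3:
  assumes "(x has_real_derivative x') F" "(y has_real_derivative y') F" "(z has_real_derivative z') F"
  shows "((\<lambda>t. vector [x t, y t, z t] :: real^3) has_vector_derivative vector [x', y', z']) F"
proof -
  have e: "(vector [a, b, c] :: real^3) = a *\<^sub>R axis 1 1 + b *\<^sub>R axis 2 1 + c *\<^sub>R axis 3 1" for a b c
    by (simp add: vec_eq_iff forall_3 axis_def)
  have "((\<lambda>t. g t *\<^sub>R axis i (1::real) :: real^3) has_vector_derivative g' *\<^sub>R axis i 1) F"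
    if "(g has_real_derivative g') F" for g g' i
    using bounded_linear.has_vector_derivative [OF bounded_linear_scaleR_left] that
    by (simp add: has_real_derivative_iff_has_vector_derivative)
  then show ?thesis unfolding e using assms by (intro has_vector_derivative_add)
qed

lemma revolve_derivative:
  "(revolve P has_vector_derivative vector [- P $ 1 * sin t - P $ 2 * cos t, P $ 1 * cos t - P $ 2 * sin t, 0]) (at t)"
  unfolding revolve_def [abs_def]
  by (rule has_vector_derivative_vec3; (rule derivative_eq_intros refl)+) simp_all

lemma isCont_vec3:
  "isCont x t \<Longrightarrow> isCont y t \<Longrightarrow> isCont z t \<Longrightarrow> isCont (\<lambda>t. vector [x t, y t, z t] :: real^3) t"
proof -
  have e: "(vector [a, b, c] :: real^3) = a *\<^sub>R axis 1 1 + b *\<^sub>R axis 2 1 + c *\<^sub>R axis 3 1" for a b c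
    by (simp add: vec_eq_iff forall_3 axis_def)
  show "isCont x t \<Longrightarrow> isCont y t \<Longrightarrow> isCont z t \<Longrightarrow> isCont (\<lambda>t. vector [x t, y t, z t] :: real^3) t"
    unfolding e by (intro continuous_intros)
qed

lemma chart_line_in_surface:
  assumes X: "local_parametrization S U X" and q: "q \<in> U"
  obtains e where "e > 0" "\<And>s. \<bar>s\<bar> < e \<Longrightarrow> q + s *\<^sub>R v \<in> U" "\<And>s. \<bar>s\<bar> < e \<Longrightarrow> X (q + s *\<^sub>R v) \<in> S"
    "\<And>s. \<bar>s\<bar> < e \<Longrightarrow> ((\<lambda>s. X (q + s *\<^sub>R v)) has_vector_derivative dX X (q + s *\<^sub>R v) v) (at s)"
    "((\<lambda>s. dX X (q + s *\<^sub>R v) v) has_vector_derivative ddX X q v v) (at 0)"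
proof -
  note D = local_parametrizationD [OF X]
  have "((\<lambda>s. q + s *\<^sub>R v) \<longlongrightarrow> q + 0 *\<^sub>R v) (nhds 0)"
    by (intro tendsto_intros filterlim_ident)
  then have "\<forall>\<^sub>F s in nhds 0. q + s *\<^sub>R v \<in> U"
    using topological_tendstoD [OF _ D(1)] q by simp
  then obtain e where e: "e > 0" "\<And>s. \<bar>s\<bar> < e \<Longrightarrow> q + s *\<^sub>R v \<in> U"
    by (auto simp: eventually_nhds_metric dist_real_def)
  show thesis
  proof (rule that [OF e])
    show "X (q + s *\<^sub>R v) \<in> S" if "\<bar>s\<bar> < e" for s using e(2) [OF that] D(4) by blast
    show "((\<lambda>s. dX X (q + s *\<^sub>R v) v) has_vector_derivative ddX X q v v) (at 0)"
      using chart_curve(2) [OF D(2), of q 0 v] q by simp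
  qed (use chart_curve(1) [OF D(2) e(2)] in auto)
qed

text \<open>Off the axis a vertical tangent plane would force the curvature of the meridian to be \<open>1 / r\<close>,
  bending away from the axis, so that the meridian turns back and is not a graph. On the axis the tangent
  plane is invariant under revolution.\<close>

lemma no_vertical_tangent:
  assumes min: "phi_minimal \<phi> S" and gr: "\<And>P. P \<in> S \<longleftrightarrow> P $ 3 = f (norm (hproj P))"
    and X: "local_parametrization S U X" and q: "q \<in> U" and v0: "hproj (dX X q v0) = 0"
  shows "v0 = 0"
proof (rule ccontr)
  assume "v0 \<noteq> 0"
  let ?E = "pd 1 X q" and ?F = "pd 2 X q" and ?P = "X q"
  define n where "n = cross3 ?E ?F"
  have n: "n \<noteq> 0" "\<And>v. n \<bullet> dX X q v = 0"
    using chart_normal [OF X q] by (auto simp: n_def)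
  have PS: "?P \<in> S" using local_parametrizationD [OF X] q by auto
  define l where "l = dX X q v0 $ 3"
  have c: "dX X q v0 $ 1 = 0" "dX X q v0 $ 2 = 0" using v0 by (metis hproj_nth zero_index)+
  have "l \<noteq> 0"
  proof
    assume "l = 0"
    then have "dX X q v0 = 0" using c by (simp add: vec_eq_iff forall_3 l_def)
    then show False using dX_injective [OF X q] \<open>v0 \<noteq> 0\<close> by blast
  qed
  define v where "v = (1 / l) *\<^sub>R v0"
  have v: "dX X q v = vector [0, 0, 1]"
    using linear_scale [OF linear_dX, of X q "1 / l" v0] c \<open>l \<noteq> 0\<close>
    by (simp add: v_def vec_eq_iff forall_3 l_def)
  have n3: "n $ 3 = 0" using n(2) [of v] unfolding v by (simp add: inner_vec_def sum_3)
  show False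
  proof (cases "hproj ?P = 0")
    case True
    have P0: "?P $ 1 = 0" "?P $ 2 = 0" using True by (metis hproj_nth zero_index)+
    have "hproj (dX X q w) = 0" for w
    proof -
      let ?c = "\<lambda>s. X (q + s *\<^sub>R w)" and ?c' = "\<lambda>s. dX X (q + s *\<^sub>R w) w"
      obtain e where e: "e > 0" "\<And>s. \<bar>s\<bar> < e \<Longrightarrow> ?c s \<in> S"
        "\<And>s. \<bar>s\<bar> < e \<Longrightarrow> (?c has_vector_derivative ?c' s) (at s)" "(?c' has_vector_derivative ddX X q w w) (at 0)"
        by (rule chart_line_in_surface [OF X q, of w]) blast
      \<comment> \<open>The chart line turned by a right angle about the axis passes through the
        same point, so the tangent plane contains each tangent vector together with its quarter
        turn. A horizontal normal then forces every tangent vector to be vertical.\<close>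
      define \<gamma> where "\<gamma> s = (vector [- ?c s $ 2, ?c s $ 1, ?c s $ 3] :: real^3)" for s
      define \<gamma>' where "\<gamma>' s = (vector [- ?c' s $ 2, ?c' s $ 1, ?c' s $ 3] :: real^3)" for s
      have "\<gamma> s \<in> S" if "\<bar>s\<bar> < e" for s
      proof -
        have "(norm (hproj (\<gamma> s)))\<^sup>2 = (norm (hproj (?c s)))\<^sup>2"
          unfolding norm_hproj by (simp add: \<gamma>_def)
        then have "norm (hproj (\<gamma> s)) = norm (hproj (?c s))" by (rule power2_eq_imp_eq) auto
        then show ?thesis using gr e(2) [OF that] by (simp add: \<gamma>_def)
      qed
      moreover have "\<gamma> 0 = ?P" using P0 by (simp add: \<gamma>_def vec_eq_iff forall_3)
      moreover have "(\<gamma> has_vector_derivative \<gamma>' s) (at s)" if "\<bar>s\<bar> < e" for s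
        unfolding \<gamma>_def [abs_def] \<gamma>'_def
        by (intro has_vector_derivative_vec3 DERIV_minus vec_component_derivative e(3) that)
      moreover have "isCont ?c' 0" using has_vector_derivative_continuous [OF e(4)] by simp
      then have "isCont \<gamma>' 0"
        unfolding \<gamma>'_def [abs_def] by (intro isCont_vec3 continuous_intros)
      ultimately obtain w' where "\<gamma>' 0 = dX X q w'"
        using curve_in_chart [OF X q e(1)] by metis
      then have "n \<bullet> \<gamma>' 0 = 0" using n by simp
      then have 1: "n $ 2 * dX X q w $ 1 - n $ 1 * dX X q w $ 2 = 0"
        using n3 by (simp add: \<gamma>'_def inner_vec_def sum_3)
      have 2: "n $ 1 * dX X q w $ 1 + n $ 2 * dX X q w $ 2 = 0"
        using n(2) [of w] n3 by (simp add: inner_vec_def sum_3)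
      have "(n $ 1)\<^sup>2 + (n $ 2)\<^sup>2 \<noteq> 0"
        using n(1) n3 by (auto simp: sum_power2_eq_zero_iff vec_eq_iff forall_3)
      moreover have "((n $ 1)\<^sup>2 + (n $ 2)\<^sup>2) * dX X q w $ 1 = 0" "((n $ 1)\<^sup>2 + (n $ 2)\<^sup>2) * dX X q w $ 2 = 0"
        using 1 2 by algebra+
      ultimately have "dX X q w $ 1 = 0" "dX X q w $ 2 = 0" by (metis mult_eq_0_iff)+
      then show ?thesis by (simp add: vec_eq_iff forall_2)
    qed
    from this [of "axis 1 1"] this [of "axis 2 1"]
    have "hproj ?E = 0" "hproj ?F = 0" by (simp_all add: dX_def axis_def)
    then have "?E $ 1 = 0" "?E $ 2 = 0" "?F $ 1 = 0" "?F $ 2 = 0" by (metis hproj_nth zero_index)+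
    then have "n = 0" by (simp add: n_def cross3_def vec_eq_iff forall_3)
    then show False using n by simp
  next
    case False
    let ?p1 = "?P $ 1" and ?p2 = "?P $ 2"
    define r2 where "r2 = ?p1\<^sup>2 + ?p2\<^sup>2"
    have r2: "r2 > 0" using False by (metis norm_hproj r2_def zero_less_norm_iff zero_less_power)
    \<comment> \<open>The radial vector: the vertical direction and the direction of revolution are
      both tangent, so every normal is a multiple of it.\<close>
    define n0 where "n0 = (vector [?p1, ?p2, 0] :: real^3)"
    let ?\<gamma>' = "\<lambda>t. vector [- ?p1 * sin t - ?p2 * cos t, ?p1 * cos t - ?p2 * sin t, 0] :: real^3"
    have "revolve ?P t \<in> S" for t using gr PS by (metis norm_hproj_revolve revolve_def vector_3(3))
    moreover have "isCont ?\<gamma>' 0" by (intro isCont_vec3 continuous_intros)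
    ultimately obtain w where w: "?\<gamma>' 0 = dX X q w"
      "\<And>n a. (\<And>v. n \<bullet> dX X q v = 0) \<Longrightarrow> ((\<lambda>t. n \<bullet> ?\<gamma>' t) has_real_derivative a) (at 0) \<Longrightarrow> a = n \<bullet> ddX X q w w"
      using curve_in_chart [OF X q zero_less_one, of "revolve ?P" ?\<gamma>'] revolve_derivative [of ?P] by auto
    have w': "dX X q w = vector [- ?p2, ?p1, 0]" using w(1) by simp
    have 1: "?p1 * n $ 2 - ?p2 * n $ 1 = 0" using n(2) [of w] unfolding w' by (simp add: inner_vec_def sum_3 algebra_simps)
    define \<mu> where "\<mu> = (n $ 1 * ?p1 + n $ 2 * ?p2) / r2"
    have "r2 * n $ 1 = (n $ 1 * ?p1 + n $ 2 * ?p2) * ?p1" "r2 * n $ 2 = (n $ 1 * ?p1 + n $ 2 * ?p2) * ?p2"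
      using 1 unfolding r2_def by algebra+
    then have \<mu>: "n = \<mu> *\<^sub>R n0"
      using r2 n3 by (simp add: vec_eq_iff forall_3 n0_def \<mu>_def field_simps)
    then have n0: "n0 \<bullet> dX X q u = 0" for u using n(2) [of u] n(1) unfolding \<mu> by auto
    have "((\<lambda>t. n0 \<bullet> ?\<gamma>' t) has_real_derivative - r2) (at 0)"
      unfolding n0_def inner_vec_def sum_3 vector_3 inner_real_def r2_def
      by (auto intro!: derivative_eq_intros simp: power2_eq_square)
    from w(2) [OF n0 this] have Bw: "n0 \<bullet> ddX X q w w = - r2" by simp
    have "n0 \<bullet> ?E = 0" "n0 \<bullet> ?F = 0"
      using n0 [of "axis 1 1"] n0 [of "axis 2 1"] by (simp_all add: dX_def axis_def)
    \<comment> \<open>The normal is horizontal, so the right-hand side vanishes and the bending of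
      the horizontal circle has to be compensated in the vertical direction.\<close>
    from mean_curvature_scalar [OF min X q this, of w v]
    have "r2 * (n0 \<bullet> ddX X q v v) + n0 \<bullet> ddX X q w w = 0"
      unfolding v w' by (simp add: inner_vec_def sum_3 n0_def r2_def power2_eq_square algebra_simps)
    then have Bv: "n0 \<bullet> ddX X q v v = 1" using r2 Bw by simp
    let ?c = "\<lambda>s. X (q + s *\<^sub>R v)" and ?c' = "\<lambda>s. dX X (q + s *\<^sub>R v) v"
    obtain e where e: "e > 0" "\<And>s. \<bar>s\<bar> < e \<Longrightarrow> ?c s \<in> S"
      "\<And>s. \<bar>s\<bar> < e \<Longrightarrow> (?c has_vector_derivative ?c' s) (at s)" "(?c' has_vector_derivative ddX X q v v) (at 0)"
      by (rule chart_line_in_surface [OF X q, of v]) blast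
    \<comment> \<open>Squared distance from the axis along the chart line with vertical initial
      velocity. Only the acceleration contributes to its second derivative at 0, which is 2: a
      strict minimum, while the height increases strictly through 0.\<close>
    define \<rho> where "\<rho> s = (?c s $ 1)\<^sup>2 + (?c s $ 2)\<^sup>2" for s
    define \<rho>' where "\<rho>' s = 2 * (?c s $ 1 * ?c' s $ 1 + ?c s $ 2 * ?c' s $ 2)" for s
    note dc = vec_component_derivative [OF e(3)] and dc' = vec_component_derivative [OF e(4)]
    have d\<rho>: "(\<rho> has_real_derivative \<rho>' s) (at s)" if "\<bar>s\<bar> < e" for s
      unfolding \<rho>_def [abs_def] \<rho>'_def
      by (rule derivative_eq_intros dc that refl)+ (simp add: algebra_simps)
    have "(\<rho>' has_real_derivative 2 * (n0 \<bullet> ddX X q v v)) (at 0)"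
      unfolding \<rho>'_def [abs_def] using e(1)
      by (auto intro!: derivative_eq_intros dc dc' simp: v n0_def inner_vec_def sum_3)
    then have d\<rho>': "(\<rho>' has_real_derivative 2) (at 0)" by (simp add: Bv)
    have \<rho>'0: "\<rho>' 0 = 0" by (simp add: \<rho>'_def v)
    have dc3: "((\<lambda>s. ?c s $ 3) has_real_derivative 1) (at 0)" using dc [of 0 3] e(1) by (simp add: v)
    obtain d1 where d1: "d1 > 0" "\<And>h. 0 < h \<Longrightarrow> h < d1 \<Longrightarrow> 0 < \<rho>' h"
      using DERIV_pos_inc_right [OF d\<rho>'] \<rho>'0 by auto
    obtain d2 where d2: "d2 > 0" "\<And>h. 0 < h \<Longrightarrow> h < d2 \<Longrightarrow> \<rho>' (- h) < 0"
      using DERIV_pos_inc_left [OF d\<rho>'] \<rho>'0 by auto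
    obtain d3 where d3: "d3 > 0" "\<And>h. 0 < h \<Longrightarrow> h < d3 \<Longrightarrow> ?c 0 $ 3 < ?c h $ 3"
      using DERIV_pos_inc_right [OF dc3] by auto
    obtain d4 where d4: "d4 > 0" "\<And>h. 0 < h \<Longrightarrow> h < d4 \<Longrightarrow> ?c (- h) $ 3 < ?c 0 $ 3"
      using DERIV_pos_inc_left [OF dc3] by auto
    define d where "d = min (min e d1) (min (min d2 d3) d4) / 2"
    have d: "0 < d" "d < e" "d < d1" "d < d2" "d < d3" "d < d4"
      using e(1) d1(1) d2(1) d3(1) d4(1) by (auto simp: d_def)
    have cont: "isCont \<rho> s" if "\<bar>s\<bar> < e" for s using d\<rho> [OF that] DERIV_isCont by blast
    have up: "\<rho> 0 < \<rho> d"
    proof -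
      obtain z where z: "0 < z" "z < d" "\<rho> d - \<rho> 0 = (d - 0) * \<rho>' z"
        using MVT2 [OF d(1), of \<rho> \<rho>'] d\<rho> d by (metis abs_of_nonneg le_less_trans)
      have "0 < (d - 0) * \<rho>' z" using d1(2) [of z] d z by (intro mult_pos_pos) auto
      with z(3) show ?thesis by linarith
    qed
    have down: "\<rho> 0 < \<rho> (- d)"
    proof -
      obtain z where z: "- d < z" "z < 0" "\<rho> 0 - \<rho> (- d) = (0 - (- d)) * \<rho>' z"
        using MVT2 [of "- d" 0 \<rho> \<rho>'] d\<rho> d by (metis abs_le_iff abs_of_nonpos le_less_trans minus_le_iff neg_less_0_iff_less)
      have "(0 - (- d)) * \<rho>' z < 0" using d2(2) [of "- z"] d z by (intro mult_pos_neg) auto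
      with z(3) show ?thesis by linarith
    qed
    \<comment> \<open>A value of \<rho> taken on both sides of its minimum. The two points have
      equal distance from the axis but different heights.\<close>
    define \<eta> where "\<eta> = min (\<rho> d) (\<rho> (- d))"
    obtain t where t: "0 \<le> t" "t \<le> d" "\<rho> t = \<eta>"
      using IVT [of \<rho> 0 \<eta> d] up down cont d by (auto simp: \<eta>_def)
    obtain s where s: "- d \<le> s" "s \<le> 0" "\<rho> s = \<eta>"
      using IVT2 [of \<rho> 0 \<eta> "- d"] up down cont d by (auto simp: \<eta>_def)
    have "t \<noteq> 0" "s \<noteq> 0" using t s up down by (auto simp: \<eta>_def)
    then have "?c s $ 3 < ?c t $ 3"
      using d3(2) [of t] d4(2) [of "- s"] t s d by simp
    moreover have "norm (hproj (?c s)) = norm (hproj (?c t))"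
      using t(3) s(3) by (metis \<rho>_def norm_hproj norm_ge_zero power2_eq_imp_eq)
    then have "?c s $ 3 = ?c t $ 3" using gr e(2) [of s] e(2) [of t] s t d by (simp add: abs_if)
    ultimately show False by simp
  qed
qed

lemma meridian_in_surface:
  assumes "\<And>P. P \<in> S \<longleftrightarrow> P $ 3 = f (norm (hproj P))" "\<And>r. f (- r) = f r"
  shows "vector [r, 0, f r] \<in> S"
proof -
  have "(norm (hproj (vector [r, 0, f r])))\<^sup>2 = \<bar>r\<bar>\<^sup>2" unfolding norm_hproj by simp
  then have "norm (hproj (vector [r, 0, f r])) = \<bar>r\<bar>" by (rule power2_eq_imp_eq) auto
  then show ?thesis using assms by (simp add: abs_if)
qed

lemma chart_normal_differentiable:
  assumes X: "local_parametrization S U X" and q: "q \<in> U"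
  shows "(\<lambda>q. cross3 (pd 1 X q) (pd 2 X q) $ i) differentiable (at q)"
proof -
  have "smooth_on U X" using local_parametrizationD [OF X] by blast
  then have "pd j X differentiable (at q)" for j
    using smooth_on_differentiable [OF smooth_on_pd q] by blast
  then have "(\<lambda>q. pd j X q $ k) differentiable (at q)" for j k
    using bounded_linear.has_derivative [OF bounded_linear_vec_nth] unfolding differentiable_def by blast
  then have "(\<lambda>q. pd j X q $ k * pd l X q $ m - pd j' X q $ k' * pd l' X q $ m') differentiable (at q)"
    for j k l m j' k' l' m' by (intro derivative_intros)
  moreover have "i = 1 \<or> i = 2 \<or> i = 3" by (rule exhaust_3)
  ultimately show ?thesis by (elim disjE) (simp_all add: cross3_def)
qed

text \<open>Without vertical tangents the surface is locally a chart composed with the inverse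
  \<open>g\<close> of its projection. The slope of \<open>f\<close> is a quotient of components of
  the normal, which involves first derivatives of the chart only, so one derivative of
  \<open>g\<close> is enough to differentiate it again.\<close>

lemma profile_regular:
  assumes min: "phi_minimal \<phi> S" and emb: "embedded_surface S"
    and gr: "\<And>P. P \<in> S \<longleftrightarrow> P $ 3 = f (norm (hproj P))" and even: "\<And>r. f (- r) = f r"
  shows "(f has_real_derivative deriv f r) (at r)" "(deriv f has_real_derivative deriv (deriv f) r) (at r)"
proof -
  let ?P = "vector [r, 0, f r] :: real^3"
  note mer = meridian_in_surface [OF gr even]
  obtain U X q where X: "local_parametrization S U X" and q: "q \<in> U" "?P = X q"
    using emb mer [of r] by (force simp: embedded_surface_def)
  note D = local_parametrizationD [OF X]
  have "\<forall>v. hproj (dX X q v) = 0 \<longrightarrow> v = 0"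
    using no_vertical_tangent [OF min gr X q(1)] by blast
  then obtain V O' g g' where g: "open V" "hproj (X q) \<in> V" "open O'" "X q \<in> O'"
    "\<And>y. y \<in> V \<Longrightarrow> g y \<in> U" "\<And>y. y \<in> V \<Longrightarrow> hproj (X (g y)) = y" "g (hproj (X q)) = q"
    "\<And>y. y \<in> V \<Longrightarrow> (g has_derivative g' y) (at y)"
    "\<And>y h. y \<in> V \<Longrightarrow> hproj (dX X (g y) (g' y h)) = h"
    "\<And>y v. y \<in> V \<Longrightarrow> hproj (dX X (g y) v) = 0 \<Longrightarrow> v = 0"
    "\<And>P. P \<in> S \<Longrightarrow> P \<in> O' \<Longrightarrow> hproj P \<in> V \<and> X (g (hproj P)) = P"
    "\<And>y. y \<in> V \<Longrightarrow> X (g y) \<in> S"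
    by (rule chart_projection [OF X q(1) linear_hproj]) blast
  define y where "y s = (vector [s, 0] :: real^2)" for s
  have ye: "y s = s *\<^sub>R axis 1 1" for s by (simp add: y_def vec_eq_iff forall_2 axis_def)
  have dy: "(y has_vector_derivative axis 1 1) (at s)" for s
    unfolding ye [abs_def] by (auto intro!: derivative_eq_intros)
  have "hproj (X q) = y r" by (simp add: q(2) [symmetric] y_def vec_eq_iff forall_2)
  then have "y r \<in> V" using g(2) by simp
  have "isCont y r" using dy has_vector_derivative_continuous by blast
  then have "\<forall>\<^sub>F s in nhds r. y s \<in> V"
    using topological_tendstoD [of y "y r" "nhds r", OF _ g(1) \<open>y r \<in> V\<close>]
    by (simp add: continuous_at tendsto_at_iff_tendsto_nhds)
  then obtain e where e: "e > 0" "\<And>s. \<bar>s - r\<bar> < e \<Longrightarrow> y s \<in> V"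
    by (auto simp: eventually_nhds_metric dist_real_def)
  define I where "I = {r - e<..<r + e}"
  have I: "open I" "r \<in> I" "\<And>s. s \<in> I \<Longrightarrow> y s \<in> V" using e by (auto simp: I_def)
  define m where "m q = cross3 (pd 1 X q) (pd 2 X q)" for q
  have Xg: "X (g (y s)) = vector [s, 0, f s]" if "s \<in> I" for s
  proof -
    have h: "hproj (X (g (y s))) = y s" by (rule g(6) [OF I(3) [OF that]])
    have n: "norm (hproj (X (g (y s)))) = \<bar>s\<bar>" by (simp only: h) (simp add: ye)
    have "X (g (y s)) $ 3 = f \<bar>s\<bar>" using iffD1 [OF gr g(12) [OF I(3) [OF that]]] unfolding n .
    also have "\<dots> = f s" using even [of s] by (auto simp: abs_if)
    finally have "X (g (y s)) $ 3 = f s" .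
    moreover have "X (g (y s)) $ 1 = s" "X (g (y s)) $ 2 = 0"
      using arg_cong [OF h, of "\<lambda>v. v $ 1"] arg_cong [OF h, of "\<lambda>v. v $ 2"] by (simp_all add: y_def)
    ultimately show ?thesis by (simp add: vec_eq_iff forall_3)
  qed
  have dgy: "((\<lambda>s. g (y s)) has_vector_derivative g' (y s) (axis 1 1)) (at s)" if "s \<in> I" for s
    using has_vector_derivative_compose [OF dy g(8)] I that by blast
  have m3: "m (g (y s)) $ 3 \<noteq> 0" if "s \<in> I" for s
  proof
    let ?q = "g (y s)" let ?E = "pd 1 X ?q" and ?F = "pd 2 X ?q"
    assume "m ?q $ 3 = 0"
    then have 0: "?E $ 1 * ?F $ 2 = ?E $ 2 * ?F $ 1" by (simp add: m_def cross3_def)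
    have z: "v = 0" if "hproj (dX X ?q v) = 0" for v using g(10) I \<open>s \<in> I\<close> that by blast
    have "hproj (dX X ?q (vector [?F $ 1, - ?E $ 1])) = 0" "hproj (dX X ?q (vector [?F $ 2, - ?E $ 2])) = 0"
      using 0 by (simp_all add: vec_eq_iff forall_2 dX_def mult.commute)
    then have "?E $ 1 = 0" "?F $ 1 = 0" "?E $ 2 = 0" "?F $ 2 = 0" 
      using z [of "vector [?F $ 1, - ?E $ 1]"] z [of "vector [?F $ 2, - ?E $ 2]"] by (simp_all add: vec_eq_iff forall_2)
    then have "hproj (dX X ?q (axis 1 1)) = 0" by (simp add: vec_eq_iff forall_2 dX_def)
    then show False using z by (metis axis_eq_0_iff zero_neq_one)
  qed
  \<comment> \<open>Slope over the first axis of the plane orthogonal to \<open>m\<close>; the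
    denominator vanishes only for a vertical tangent plane.\<close>
  define F where "F s = - m (g (y s)) $ 1 / m (g (y s)) $ 3" for s
  have df: "(f has_real_derivative F s) (at s)" if s: "s \<in> I" for s
  proof -
    let ?q = "g (y s)" let ?w = "dX X ?q (g' (y s) (axis 1 1))"
    have qU: "?q \<in> U" using g(5) I s by blast
    have "((\<lambda>s. X (g (y s))) has_vector_derivative ?w) (at s)"
      using has_vector_derivative_compose [OF dgy [OF s]] has_derivative_dX smooth_on_differentiable D(2) qU by blast
    then have "((\<lambda>s. X (g (y s)) $ 3) has_real_derivative ?w $ 3) (at s)"
      by (rule vec_component_derivative)
    then have 3: "(f has_real_derivative ?w $ 3) (at s)"
      by (rule has_field_derivative_transform_within_open [OF _ I(1) s]) (simp add: Xg)
    have h: "hproj ?w = axis 1 1" by (rule g(9) [OF I(3) [OF s]])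
    have "?w $ 1 = 1" "?w $ 2 = 0"
      using arg_cong [OF h, of "\<lambda>v. v $ 1"] arg_cong [OF h, of "\<lambda>v. v $ 2"] by (simp_all add: axis_def)
    moreover have "m ?q \<bullet> ?w = 0" using chart_normal(2) [OF X qU] by (simp add: m_def)
    ultimately have "m ?q $ 1 + m ?q $ 3 * ?w $ 3 = 0" by (simp add: inner_vec_def sum_3)
    then have "?w $ 3 = F s" using m3 [OF s] by (simp add: F_def field_simps)
    then show ?thesis using 3 by simp
  qed
  then show "(f has_real_derivative deriv f r) (at r)"
    using I by (metis DERIV_imp_deriv)
  have "(\<lambda>s. m (g (y s)) $ i) differentiable (at r)" for i
  proof -
    have "(\<lambda>q. m q $ i) differentiable (at (g (y r)))"
      unfolding m_def using chart_normal_differentiable [OF X] g(5) I by blast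
    moreover have "(\<lambda>s. g (y s)) differentiable (at r)"
      using dgy [OF I(2)] by (auto simp: has_vector_derivative_def differentiable_def)
    ultimately show ?thesis using differentiable_chain_at [of "\<lambda>s. g (y s)" r "\<lambda>q. m q $ i"] by (simp add: o_def)
  qed
  then have "F differentiable (at r)"
    unfolding F_def [abs_def] using m3 [OF I(2)] by (intro derivative_intros)
  then obtain d where "(F has_real_derivative d) (at r)" by (auto simp: real_differentiable_def)
  then have "(deriv f has_real_derivative d) (at r)"
    by (rule has_field_derivative_transform_within_open [OF _ I(1,2)]) (rule DERIV_imp_deriv [OF df, symmetric])
  then show "(deriv f has_real_derivative deriv (deriv f) r) (at r)" by (simp add: DERIV_imp_deriv)
qed

text \<open>The curvature equation evaluated on the meridian and the circle of revolution, which are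
  orthogonal with squared speeds \<open>1 + (deriv f r)^2\<close> and \<open>r^2\<close>. Their
  accelerations against the normal are \<open>deriv (deriv f) r\<close> and
  \<open>r * deriv f r\<close>.\<close>

lemma profile_equation:
  assumes min: "phi_minimal \<phi> S" and emb: "embedded_surface S"
    and gr: "\<And>P. P \<in> S \<longleftrightarrow> P $ 3 = f (norm (hproj P))" and even: "\<And>r. f (- r) = f r" and r: "r > 0"
  shows "deriv (deriv f) r = (1 + (deriv f r)\<^sup>2) * (deriv \<phi> (f r) - deriv f r / r)"
proof -
  note reg = profile_regular [OF min emb gr even]
  let ?P = "vector [r, 0, f r] :: real^3"
  let ?k = "deriv f r"
  note mer = meridian_in_surface [OF gr even]
  obtain U X q where X: "local_parametrization S U X" and q: "q \<in> U" "?P = X q"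
    using emb mer [of r] by (force simp: embedded_surface_def)
  define \<gamma>1 where "\<gamma>1 t = (vector [r + t, 0, f (r + t)] :: real^3)" for t
  define \<gamma>1' where "\<gamma>1' t = (vector [1, 0, deriv f (r + t)] :: real^3)" for t
  have shift: "((\<lambda>t. h (r + t)) has_real_derivative h') (at t)" if "(h has_real_derivative h') (at (r + t))" for h h' t
    using DERIV_shift [of h h' t r] that by (simp add: add.commute)
  have \<gamma>0: "\<gamma>1 0 = X q" by (simp add: \<gamma>1_def q(2) [symmetric])
  have \<gamma>S: "\<gamma>1 t \<in> S" for t using mer by (simp add: \<gamma>1_def)
  have d\<gamma>: "(\<gamma>1 has_vector_derivative \<gamma>1' t) (at t)" for t
    unfolding \<gamma>1_def [abs_def] \<gamma>1'_def
    by (rule has_vector_derivative_vec3 [OF _ DERIV_const shift [OF reg(1)]]) (auto intro!: derivative_eq_intros)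
  have "isCont (\<lambda>t. deriv f (r + t)) 0"
    using shift [of "deriv f" _ 0] reg DERIV_isCont by fastforce
  then have c\<gamma>: "isCont \<gamma>1' 0" unfolding \<gamma>1'_def [abs_def] by (intro isCont_vec3 continuous_intros)
  obtain v where v: "\<gamma>1' 0 = dX X q v"
    "\<And>n a. (\<And>v. n \<bullet> dX X q v = 0) \<Longrightarrow> ((\<lambda>t. n \<bullet> \<gamma>1' t) has_real_derivative a) (at 0) \<Longrightarrow> a = n \<bullet> ddX X q v v"
    by (rule curve_in_chart [OF X q(1) zero_less_one \<gamma>S \<gamma>0 d\<gamma> c\<gamma>]) blast
  have v': "dX X q v = vector [1, 0, ?k]" using v(1) by (simp add: \<gamma>1'_def)
  let ?\<gamma>2' = "\<lambda>t. vector [- ?P $ 1 * sin t - ?P $ 2 * cos t, ?P $ 1 * cos t - ?P $ 2 * sin t, 0] :: real^3"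
  have "revolve ?P t \<in> S" for t using gr mer [of r] by (metis norm_hproj_revolve revolve_def vector_3(3))
  moreover have "isCont ?\<gamma>2' 0" by (intro isCont_vec3 continuous_intros)
  ultimately obtain w where w: "?\<gamma>2' 0 = dX X q w"
      "\<And>n a. (\<And>v. n \<bullet> dX X q v = 0) \<Longrightarrow> ((\<lambda>t. n \<bullet> ?\<gamma>2' t) has_real_derivative a) (at 0) \<Longrightarrow> a = n \<bullet> ddX X q w w"
    using curve_in_chart [OF X q(1) zero_less_one, of "revolve ?P" ?\<gamma>2'] revolve_derivative [of ?P] q(2) by auto
  have w': "dX X q w = vector [0, r, 0]" using w(1) by simp
  define m where "m = cross3 (pd 1 X q) (pd 2 X q)"
  have m: "m \<noteq> 0" "\<And>u. m \<bullet> dX X q u = 0" using chart_normal [OF X q(1)] by (auto simp: m_def)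
  define n where "n = (vector [- ?k, 0, 1] :: real^3)"
  have "m $ 2 = 0" "m $ 1 + m $ 3 * ?k = 0"
    using m(2) [of v] m(2) [of w] r unfolding v' w' by (simp_all add: inner_vec_def sum_3)
  then have mn: "m = m $ 3 *\<^sub>R n" by (simp add: vec_eq_iff forall_3 n_def)
  then have "m $ 3 \<noteq> 0" using m(1) by auto
  then have n: "n \<bullet> dX X q u = 0" for u
    using m(2) [of u] mn by (metis inner_scaleR_left mult_eq_0_iff)
  have "((\<lambda>t. n \<bullet> \<gamma>1' t) has_real_derivative deriv (deriv f) r) (at 0)"
    unfolding n_def \<gamma>1'_def inner_vec_def sum_3 vector_3 inner_real_def
    using shift [of "deriv f" _ 0] reg(2) [of r] by (auto intro!: derivative_eq_intros)
  from v(2) [OF n this] have Bv: "n \<bullet> ddX X q v v = deriv (deriv f) r" by simp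
  have "((\<lambda>t. n \<bullet> ?\<gamma>2' t) has_real_derivative ?k * r) (at 0)"
    unfolding n_def inner_vec_def sum_3 vector_3 inner_real_def
    by (auto intro!: derivative_eq_intros)
  from w(2) [OF n this] have Bw: "n \<bullet> ddX X q w w = ?k * r" by simp
  have "n \<bullet> pd 1 X q = 0" "n \<bullet> pd 2 X q = 0"
    using n [of "axis 1 1"] n [of "axis 2 1"] by (simp_all add: dX_def axis_def)
  from mean_curvature_scalar [OF min X q(1) this, of w v]
  have "r\<^sup>2 * deriv (deriv f) r + (1 + ?k\<^sup>2) * (?k * r) = (1 + ?k\<^sup>2) * r\<^sup>2 * deriv \<phi> (f r)"
    unfolding v' w' Bv Bw q(2) [symmetric] by (simp add: inner_vec_def sum_3 n_def power2_eq_square)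
  then have "r\<^sup>2 * deriv (deriv f) r = r\<^sup>2 * ((1 + ?k\<^sup>2) * (deriv \<phi> (f r) - ?k / r))"
    using r by (simp add: algebra_simps power2_eq_square)
  then show ?thesis using r by simp
qed

text \<open>The issue is continuity of the second derivative at 0, where
  \<open>profile_equation\<close> gives nothing directly.\<close>

lemma profile_is_bowl:
  assumes min: "phi_minimal \<phi> S" and emb: "embedded_surface S"
    and gr: "\<And>P. P \<in> S \<longleftrightarrow> P $ 3 = f (norm (hproj P))" and even: "\<And>r. f (- r) = f r"
    and S: "S \<subseteq> {p. a < ereal (p $ 3)}" and cont: "\<And>u. a < ereal u \<Longrightarrow> isCont (deriv \<phi>) u"
  shows "bowl_profile a \<phi> (f 0) \<infinity> f"
proof -
  note reg = profile_regular [OF min emb gr even] and ode = profile_equation [OF min emb gr even]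
  have af: "a < ereal (f r)" for r using subsetD [OF S meridian_in_surface [OF gr even, of r]] by simp
  \<comment> \<open>Evenness makes the derivative at 0 equal to its own negative.\<close>
  have "((\<lambda>r. f (- r)) has_real_derivative - deriv f 0) (at 0)"
    using DERIV_mirror [of f "deriv f 0" 0] reg(1) [of 0] by simp
  then have "(f has_real_derivative - deriv f 0) (at 0)" by (simp add: even)
  then have f0: "deriv f 0 = 0" using reg(1) [of 0] DERIV_unique by fastforce
  have cf: "isCont f r" "isCont (deriv f) r" for r using reg DERIV_isCont by blast+
  have c\<phi>: "isCont (\<lambda>r. deriv \<phi> (f r)) r" for r
    using isCont_o2 [OF cf(1) cont [OF af]] .
  let ?L = "deriv (deriv f) 0"
  \<comment> \<open>The singular quotient tends to the second derivative at 0, so the differential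
    equation yields a right-hand limit of \<open>deriv (deriv f)\<close>.\<close>
  have q: "((\<lambda>r. deriv f r / r) \<longlongrightarrow> ?L) (at_right 0)"
    using reg(2) [of 0] f0 by (simp add: DERIV_def filterlim_at_split)
  have "((\<lambda>r. (1 + (deriv f r)\<^sup>2) * (deriv \<phi> (f r) - deriv f r / r)) \<longlongrightarrow>
      (1 + (deriv f 0)\<^sup>2) * (deriv \<phi> (f 0) - ?L)) (at_right 0)"
    using cf(2) [of 0] c\<phi> [of 0] q unfolding continuous_at filterlim_at_split
    by (intro tendsto_intros) auto
  moreover have "\<forall>\<^sub>F r in at_right 0. (1 + (deriv f r)\<^sup>2) * (deriv \<phi> (f r) - deriv f r / r) = deriv (deriv f) r"
    using ode by (auto simp: eventually_at_filter)
  ultimately have lim: "(deriv (deriv f) \<longlongrightarrow> deriv \<phi> (f 0) - ?L) (at_right 0)"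
    using f0 tendsto_cong by force
  \<comment> \<open>By l'Hopital's rule the same quotient also tends to that limit. Comparing both
    values shows that the limit of \<open>deriv (deriv f)\<close> is its value at 0.\<close>
  have "((\<lambda>r. deriv f r / r) \<longlongrightarrow> deriv \<phi> (f 0) - ?L) (at_right 0)"
  proof (rule lhopital_right_0 [where f' = "deriv (deriv f)" and g' = "\<lambda>_. 1"])
    show "(deriv f \<longlongrightarrow> 0) (at_right 0)" using cf(2) [of 0] f0 unfolding continuous_at filterlim_at_split by simp
    show "((\<lambda>r::real. r) \<longlongrightarrow> 0) (at_right 0)" by (rule tendsto_ident_at)
    show "\<forall>\<^sub>F r in at_right 0. (r::real) \<noteq> 0" by (simp add: eventually_at_filter)
    show "((\<lambda>x. deriv (deriv f) x / 1) \<longlongrightarrow> deriv \<phi> (f 0) - ?L) (at_right 0)" using lim by simp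
    show "\<forall>\<^sub>F r in at_right 0. (deriv f has_real_derivative deriv (deriv f) r) (at r)"
      by (intro always_eventually allI reg)
    show "\<forall>\<^sub>F r in at_right 0. ((\<lambda>r::real. r) has_real_derivative 1) (at r)"
      by (intro always_eventually allI DERIV_ident)
  qed simp
  then have "deriv \<phi> (f 0) - ?L = ?L" by (rule tendsto_unique [OF trivial_limit_at_right_real _ q])
  with lim have lim: "(deriv (deriv f) \<longlongrightarrow> ?L) (at_right 0)" by simp
  have J: "{r. 0 \<le> r \<and> ereal r < \<infinity>} = {0..}" by auto
  have "continuous_on {0..} (deriv (deriv f))"
    unfolding continuous_on_eq_continuous_within
  proof
    fix r :: real assume "r \<in> {0..}"
    then consider "r = 0" | "r > 0" by fastforce
    then show "continuous (at r within {0..}) (deriv (deriv f))"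
    proof cases
      case 1
      then show ?thesis using lim by (simp add: continuous_within at_within_Ici_at_right)
    next
      case 2
      have "isCont (\<lambda>r. (1 + (deriv f r)\<^sup>2) * (deriv \<phi> (f r) - deriv f r / r)) r"
        using 2 cf c\<phi> by (intro continuous_intros) auto
      moreover have "\<forall>\<^sub>F s in nhds r. (1 + (deriv f s)\<^sup>2) * (deriv \<phi> (f s) - deriv f s / s) = deriv (deriv f) s"
        using eventually_nhds_in_open [of "{0<..}" r] 2 by (auto elim!: eventually_mono simp: ode)
      ultimately have "isCont (deriv (deriv f)) r" by (rule isCont_cong [THEN iffD1, rotated])
      then show ?thesis by (rule continuous_at_imp_continuous_within)
    qed
  qed
  moreover have "(f has_real_derivative deriv f r) (at r within {0..})"
    "(deriv f has_real_derivative deriv (deriv f) r) (at r within {0..})" for r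
    using reg has_field_derivative_at_within by blast+
  ultimately show ?thesis
    unfolding bowl_profile_def J Let_def using af f0 ode
    by (intro conjI exI [of _ "deriv f"] exI [of _ "deriv (deriv f)"] ballI impI) auto
qed

theorem theoremB:
  fixes a :: ereal and \<phi> :: "real \<Rightarrow> real" and \<alpha> \<beta> :: real and c :: "nat \<Rightarrow> real"
    and S :: "(real^3) set"
  assumes "a < \<infinity>"
    and "smooth_on {u. a < ereal u} \<phi>"
    and "\<And>u. a < ereal u \<Longrightarrow> deriv \<phi> u > 0"
    and "\<And>u. a < ereal u \<Longrightarrow> deriv (deriv \<phi>) u \<ge> 0"
    and "\<forall>\<^sub>F u in at_top. (\<lambda>n. c (Suc n) / u ^ Suc n) sums (deriv \<phi> u - (\<alpha> * u + \<beta>))"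
    and "(\<alpha> > 0 \<and> (\<forall>k\<ge>1. c k \<noteq> 0 \<and> (\<forall>j. 1 \<le> j \<and> j < k \<longrightarrow> c j = 0) \<longrightarrow> c k > 0)) \<or>
         (\<alpha> = 0 \<and> \<beta> > 0 \<and> (\<forall>k\<ge>1. c k \<noteq> 0 \<and> (\<forall>j. 1 \<le> j \<and> j < k \<longrightarrow> c j = 0) \<longrightarrow> c k < 0))"
    and "connected S"
    and "properly_embedded_surface S"
    and "complete_surface S"
    and "S \<subseteq> {p. a < ereal (p $ 3)}"
    and "phi_minimal \<phi> S"
    and "single_end S"
    and "smoothly_asymptotic_to_bowl a \<phi> \<alpha> \<beta> S"
  shows "is_bowl a \<phi> S"
proof -
  have emb: "embedded_surface S" and cl: "closed S"
    using assms(8) by (auto simp: properly_embedded_surface_def)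
  have aS: "a < ereal (P $ 3)" if "P \<in> S" for P using assms(10) that by auto
  have d2: "(deriv \<phi> has_real_derivative deriv (deriv \<phi>) u) (at u)" if "a < ereal u" for u
    using smooth_on_real_derivatives(2) [OF assms(2) open_height_domain] that by simp
  have mono: "deriv \<phi> u \<le> deriv \<phi> v" if "a < ereal u" "u \<le> v" for u v
  proof (rule DERIV_nonneg_imp_nondecreasing [OF that(2)])
    fix t assume "u \<le> t"
    then have "a < ereal t" using that(1) by (meson ereal_less_eq(3) less_le_trans)
    then show "\<exists>y. (deriv \<phi> has_real_derivative y) (at t) \<and> 0 \<le> y" using d2 assms(4) by blast
  qed
  have ab: "\<alpha> > 0 \<or> \<alpha> = 0 \<and> \<beta> > 0" using assms(6) by blast
  obtain R where "R > 0" and R: "\<And>x. R \<le> norm x \<Longrightarrow> \<exists>P\<in>S. hproj P = x"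
    "\<And>\<rho>. bounded {P \<in> S. R \<le> norm (hproj P) \<and> norm (hproj P) \<le> \<rho>}"
    "\<And>m. m > 0 \<Longrightarrow> \<exists>\<rho>. \<forall>P\<in>S. \<forall>Q\<in>S. norm (hproj P) = norm (hproj Q) \<and> \<rho> \<le> norm (hproj P) \<longrightarrow> P $ 3 - Q $ 3 < m"
    by (rule end_geometry [OF assms(2-4) series_in_inverse_tendsto_0 [OF assms(5)] ab assms(10,13)],
        assumption, assumption) blast
  have bdd: "bounded {P \<in> S. norm (hproj P) \<le> \<rho>}" for \<rho>
    by (rule bounded_over_disks [OF emb assms(7) cl assms(12) R(1) \<open>R > 0\<close> R(2)])
  have le: "P $ 3 \<le> Q $ 3" if "P \<in> S" "Q \<in> S" "norm (hproj P) = norm (hproj Q)" for P Q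
    by (rule rotational_comparison [OF assms(11) emb cl _ _ bdd R(3) that])
      (use aS assms(3) mono in \<open>auto intro: less_imp_le\<close>)
  have sym: "P $ 3 = Q $ 3" if "P \<in> S" "Q \<in> S" "norm (hproj P) = norm (hproj Q)" for P Q
    using le [OF that] le [OF that(2,1) that(3) [symmetric]] by (rule antisym)
  have inj: "inj_on hproj S"
  proof (rule inj_onI)
    fix P Q assume PQ: "P \<in> S" "Q \<in> S" "hproj P = hproj Q"
    have "P $ 3 = Q $ 3" by (rule sym [OF PQ(1,2)]) (simp add: PQ(3))
    moreover have "P $ 1 = Q $ 1" "P $ 2 = Q $ 2" using PQ(3) by (metis hproj_nth)+
    ultimately show "P = Q" by (simp add: vec_eq_iff forall_3)
  qed
  have "S \<noteq> {}"
  proof -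
    obtain x :: "real^2" where "norm x = R"
      using vector_choose_size [OF less_imp_le [OF \<open>R > 0\<close>]] .
    then show ?thesis using R(1) [of x] by auto
  qed
  obtain f where f: "\<And>P. P \<in> S \<longleftrightarrow> P $ 3 = f (norm (hproj P))" "\<And>r. f (- r) = f r"
    using radial_graph [OF projection_onto [OF emb cl \<open>S \<noteq> {}\<close> inj bdd] sym] by blast
  have "bowl_profile a \<phi> (f 0) \<infinity> f"
    by (rule profile_is_bowl [OF assms(11) emb f assms(10)]) (use d2 DERIV_isCont in blast)
  \<comment> \<open>The profile is defined on the whole half-line, and no extended real
    \<open>R'\<close> exceeds \<infinity>.\<close>
  then have "maximal_bowl_profile a \<phi> (f 0) \<infinity> f"
    by (simp add: maximal_bowl_profile_def)
  moreover have "S = vertical_graph {x. ereal (norm x) < \<infinity>} (\<lambda>x. f (norm x))"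
    using f(1) by (auto simp: vertical_graph_def)
  moreover have "a < ereal (f 0)" using aS meridian_in_surface [OF f, of 0] by force
  ultimately show ?thesis unfolding is_bowl_def by blast
qed

end
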